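(* For every object $A$ of $\mathrm{Cat}_{\mathrm{pb}}$, the functor $[A,-]_{\mathrm{pb}} : \mathrm{Cat}_{\mathrm{pb}} \to \mathrm{Cat}_{\mathrm{pb}}$ is right adjoint to the functor $- \times A : \mathrm{Cat}_{\mathrm{pb}} \to \mathrm{Cat}_{\mathrm{pb}}$, with unit components $\mathrm{coev}_B : B \to [A, B \times A]_{\mathrm{pb}}$ and counit components $\mathrm{ev}_B : [A,B]_{\mathrm{pb}} \times A \to B$. Thus the internal hom $[A,-]_{\mathrm{pb}}$ together with this unit and counit gives $\mathrm{Cat}_{\mathrm{pb}}$ the structure of a cartesian closed category.
   Context: $\mathrm{Cat}$ is the category of categories and functors (with the usual size convention, e.g. small categories). $\mathrm{Cat}_{\mathrm{pb}}$ is the category whose objects are categories with pullbacks and whose morphisms are pullback-preserving functors; its products are the ordinary cartesian products of categories (with pullbacks computed pointwise). A natural transformation is cartesian if all of its naturality squares are pullback squares. For $A, B$ in $\mathrm{Cat}_{\mathrm{pb}}$, $[A,B]_{\mathrm{pb}}$ is the category whose objects are the pullback-preserving functors $A \to B$ and whose morphisms are the cartesian natural transformations between them; it has pullbacks. For a pullback-preserving functor $F : B \to C$, the functor $[A,F]_{\mathrm{pb}} : [A,B]_{\mathrm{pb}} \to [A,C]_{\mathrm{pb}}$ is given by composition with $F$; this defines an endofunctor $[A,-]_{\mathrm{pb}}$ of $\mathrm{Cat}_{\mathrm{pb}}$. The functor $\mathrm{ev}_B : [A,B]_{\mathrm{pb}} \times A \to B$ is the restriction of the usual evaluation functor $[A,B]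 \times A \to B$ from the ordinary functor category, $(F,a) \mapsto F(a)$. The functor $\mathrm{coev}_B : B \to [A, B\times A]_{\mathrm{pb}}$ is the factorization of the usual coevaluation functor $B \to [A, B \times A]$, which sends $b$ to the functor $a \mapsto (b,a)$ and a morphism $\alpha$ of $B$ to the natural transformation with component $(\alpha, 1_a)$ at $a$. A category with finite products is cartesian closed if for every object $A$ the functor $- \times A$ has a right adjoint. *)

theory Defs
  imports "HOL-Library.FuncSet" "HOL-Library.Nat_Bijection"
begin

section \<open>Categories, functors, natural transformations\<close>

text \<open>
  All maps in the records below are required to be \<open>undefined\<close> off their domain, so that
  equality of records is equality of categories, functors and natural transformations.
  \<open>Cmp C g f\<close> is the composite of \<open>g\<close> after \<open>f\<close>.
\<close>

record ('o, 'a) cat =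
  Ob :: "'o set"
  Ar :: "'a set"
  Dom :: "'a \<Rightarrow> 'o"
  Cod :: "'a \<Rightarrow> 'o"
  Ide :: "'o \<Rightarrow> 'a"
  Cmp :: "'a \<Rightarrow> 'a \<Rightarrow> 'a"

definition build_cat ::
  "'o set \<Rightarrow> 'a set \<Rightarrow> ('a \<Rightarrow> 'o) \<Rightarrow> ('a \<Rightarrow> 'o) \<Rightarrow> ('o \<Rightarrow> 'a) \<Rightarrow> ('a \<Rightarrow> 'a \<Rightarrow> 'a) \<Rightarrow> ('o, 'a) cat"
  where "build_cat X Y d c i m =
    \<lparr>Ob = X, Ar = Y, Dom = restrict d Y, Cod = restrict c Y, Ide = restrict i X,
     Cmp = (\<lambda>g f. if g \<in> Y \<and> f \<in> Y \<and> d g = c f then m g f else undefined)\<rparr>"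

definition hom :: "('o, 'a) cat \<Rightarrow> 'o \<Rightarrow> 'o \<Rightarrow> 'a set"
  where "hom C x y = {f \<in> Ar C. Dom C f = x \<and> Cod C f = y}"

locale category =
  fixes C :: "('o, 'a) cat"
  assumes Dom_ext: "Dom C \<in> Ar C \<rightarrow>\<^sub>E Ob C"
    and Cod_ext: "Cod C \<in> Ar C \<rightarrow>\<^sub>E Ob C"
    and Ide_ext: "Ide C \<in> extensional (Ob C)"
    and Ide_hom: "x \<in> Ob C \<Longrightarrow> Ide C x \<in> hom C x x"
    and Cmp_ext: "\<not> (g \<in> Ar C \<and> f \<in> Ar C \<and> Dom C g = Cod C f) \<Longrightarrow> Cmp C g f = undefined"
    and Cmp_hom: "f \<in> hom C x y \<Longrightarrow> g \<in> hom C y z \<Longrightarrow> Cmp C g f \<in> hom C x z"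
    and Cmp_Ide: "f \<in> hom C x y \<Longrightarrow> Cmp C f (Ide C x) = f"
    and Ide_Cmp: "f \<in> hom C x y \<Longrightarrow> Cmp C (Ide C y) f = f"
    and Cmp_assoc: "f \<in> hom C w x \<Longrightarrow> g \<in> hom C x y \<Longrightarrow> h \<in> hom C y z \<Longrightarrow>
      Cmp C h (Cmp C g f) = Cmp C (Cmp C h g) f"

record ('o, 'a, 'p, 'b) func =
  Src :: "('o, 'a) cat"
  Tgt :: "('p, 'b) cat"
  FOb :: "'o \<Rightarrow> 'p"
  FAr :: "'a \<Rightarrow> 'b"

definition build_func ::
  "('o, 'a) cat \<Rightarrow> ('p, 'b) cat \<Rightarrow> ('o \<Rightarrow> 'p) \<Rightarrow> ('a \<Rightarrow> 'b) \<Rightarrow> ('o, 'a, 'p, 'b) func"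
  where "build_func C D f g =
    \<lparr>Src = C, Tgt = D, FOb = restrict f (Ob C), FAr = restrict g (Ar C)\<rparr>"

locale is_functor =
  fixes F :: "('o, 'a, 'p, 'b) func"
  assumes Src_category: "category (Src F)"
    and Tgt_category: "category (Tgt F)"
    and FOb_ext: "FOb F \<in> Ob (Src F) \<rightarrow>\<^sub>E Ob (Tgt F)"
    and FAr_ext: "FAr F \<in> extensional (Ar (Src F))"
    and FAr_hom: "f \<in> hom (Src F) x y \<Longrightarrow> FAr F f \<in> hom (Tgt F) (FOb F x) (FOb F y)"
    and FAr_Ide: "x \<in> Ob (Src F) \<Longrightarrow> FAr F (Ide (Src F) x) = Ide (Tgt F) (FOb F x)"
    and FAr_Cmp: "f \<in> hom (Src F) x y \<Longrightarrow> g \<in> hom (Src F) y z \<Longrightarrow>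
      FAr F (Cmp (Src F) g f) = Cmp (Tgt F) (FAr F g) (FAr F f)"

definition id_func :: "('o, 'a) cat \<Rightarrow> ('o, 'a, 'o, 'a) func"
  where "id_func C = build_func C C (\<lambda>x. x) (\<lambda>f. f)"

definition comp_func ::
  "('p, 'b, 'q, 'c) func \<Rightarrow> ('o, 'a, 'p, 'b) func \<Rightarrow> ('o, 'a, 'q, 'c) func" (infixr "\<circ>\<^sub>F" 55)
  where "G \<circ>\<^sub>F F = build_func (Src F) (Tgt G) (\<lambda>x. FOb G (FOb F x)) (\<lambda>f. FAr G (FAr F f))"

record ('o, 'a, 'p, 'b) ntrans =
  NSrc :: "('o, 'a, 'p, 'b) func"
  NTgt :: "('o, 'a, 'p, 'b) func"
  Component :: "'o \<Rightarrow> 'b"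

definition build_ntrans ::
  "('o, 'a, 'p, 'b) func \<Rightarrow> ('o, 'a, 'p, 'b) func \<Rightarrow> ('o \<Rightarrow> 'b) \<Rightarrow> ('o, 'a, 'p, 'b) ntrans"
  where "build_ntrans F G t =
    \<lparr>NSrc = F, NTgt = G, Component = restrict t (Ob (Src F))\<rparr>"

locale is_ntrans =
  fixes \<tau> :: "('o, 'a, 'p, 'b) ntrans"
  assumes NSrc_functor: "is_functor (NSrc \<tau>)"
    and NTgt_functor: "is_functor (NTgt \<tau>)"
    and Src_eq: "Src (NSrc \<tau>) = Src (NTgt \<tau>)"
    and Tgt_eq: "Tgt (NSrc \<tau>) = Tgt (NTgt \<tau>)"
    and Component_ext: "Component \<tau> \<in> extensional (Ob (Src (NSrc \<tau>)))"
    and Component_hom: "x \<in> Ob (Src (NSrc \<tau>)) \<Longrightarrow>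
      Component \<tau> x \<in> hom (Tgt (NSrc \<tau>)) (FOb (NSrc \<tau>) x) (FOb (NTgt \<tau>) x)"
    and naturality: "f \<in> hom (Src (NSrc \<tau>)) x y \<Longrightarrow>
      Cmp (Tgt (NSrc \<tau>)) (Component \<tau> y) (FAr (NSrc \<tau>) f) =
      Cmp (Tgt (NSrc \<tau>)) (FAr (NTgt \<tau>) f) (Component \<tau> x)"


section \<open>Pullbacks and cartesian natural transformations\<close>

text \<open>
  \<open>is_pullback C p q f g\<close>: the square with legs \<open>p : P \<rightarrow> X\<close>, \<open>q : P \<rightarrow> Y\<close> over the
  cospan \<open>f : X \<rightarrow> Z\<close>, \<open>g : Y \<rightarrow> Z\<close> commutes and is a pullback.
\<close>

definition is_pullback :: "('o, 'a) cat \<Rightarrow> 'a \<Rightarrow> 'a \<Rightarrow> 'a \<Rightarrow> 'a \<Rightarrow> bool"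
  where "is_pullback C p q f g \<longleftrightarrow>
    p \<in> Ar C \<and> q \<in> Ar C \<and> f \<in> Ar C \<and> g \<in> Ar C \<and>
    Dom C p = Dom C q \<and> Cod C p = Dom C f \<and> Cod C q = Dom C g \<and> Cod C f = Cod C g \<and>
    Cmp C f p = Cmp C g q \<and>
    (\<forall>w h k. h \<in> hom C w (Dom C f) \<longrightarrow> k \<in> hom C w (Dom C g) \<longrightarrow> Cmp C f h = Cmp C g k \<longrightarrow>
      (\<exists>!u. u \<in> hom C w (Dom C p) \<and> Cmp C p u = h \<and> Cmp C q u = k))"

definition has_pullbacks :: "('o, 'a) cat \<Rightarrow> bool"
  where "has_pullbacks C \<longleftrightarrow>
    (\<forall>f\<in>Ar C. \<forall>g\<in>Ar C. Cod C f = Cod C g \<longrightarrow> (\<exists>p q. is_pullback C p q f g))"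

definition preserves_pullbacks :: "('o, 'a, 'p, 'b) func \<Rightarrow> bool"
  where "preserves_pullbacks F \<longleftrightarrow>
    (\<forall>p q f g. is_pullback (Src F) p q f g \<longrightarrow>
      is_pullback (Tgt F) (FAr F p) (FAr F q) (FAr F f) (FAr F g))"

definition pb_functor :: "('o, 'a, 'p, 'b) func \<Rightarrow> bool"
  where "pb_functor F \<longleftrightarrow>
    is_functor F \<and> has_pullbacks (Src F) \<and> has_pullbacks (Tgt F) \<and> preserves_pullbacks F"

definition cartesian_ntrans :: "('o, 'a, 'p, 'b) ntrans \<Rightarrow> bool"
  where "cartesian_ntrans \<tau> \<longleftrightarrow> is_ntrans \<tau> \<and>
    (\<forall>x y. \<forall>f \<in> hom (Src (NSrc \<tau>)) x y.
      is_pullback (Tgt (NSrc \<tau>))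
        (FAr (NSrc \<tau>) f) (Component \<tau> x) (Component \<tau> y) (FAr (NTgt \<tau>) f))"


section \<open>Adjunctions, finite products, cartesian closed categories\<close>

definition adjunction ::
  "('o, 'a, 'p, 'b) func \<Rightarrow> ('p, 'b, 'o, 'a) func \<Rightarrow>
   ('o, 'a, 'o, 'a) ntrans \<Rightarrow> ('p, 'b, 'p, 'b) ntrans \<Rightarrow> bool"
  where "adjunction L R \<eta> \<epsilon> \<longleftrightarrow>
    is_functor L \<and> is_functor R \<and> Src R = Tgt L \<and> Tgt R = Src L \<and>
    is_ntrans \<eta> \<and> NSrc \<eta> = id_func (Src L) \<and> NTgt \<eta> = R \<circ>\<^sub>F L \<and>
    is_ntrans \<epsilon> \<and> NSrc \<epsilon> = L \<circ>\<^sub>F R \<and> NTgt \<epsilon> = id_func (Src R) \<and>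
    (\<forall>x\<in>Ob (Src L).
      Cmp (Tgt L) (Component \<epsilon> (FOb L x)) (FAr L (Component \<eta> x)) = Ide (Tgt L) (FOb L x)) \<and>
    (\<forall>y\<in>Ob (Src R).
      Cmp (Tgt R) (FAr R (Component \<epsilon> y)) (Component \<eta> (FOb R y)) = Ide (Tgt R) (FOb R y))"

definition is_terminal :: "('o, 'a) cat \<Rightarrow> 'o \<Rightarrow> bool"
  where "is_terminal C t \<longleftrightarrow> t \<in> Ob C \<and> (\<forall>x\<in>Ob C. \<exists>!f. f \<in> hom C x t)"

definition is_product :: "('o, 'a) cat \<Rightarrow> 'o \<Rightarrow> 'o \<Rightarrow> 'o \<Rightarrow> 'a \<Rightarrow> 'a \<Rightarrow> bool"
  where "is_product C x y z p q \<longleftrightarrow>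
    z \<in> Ob C \<and> p \<in> hom C z x \<and> q \<in> hom C z y \<and>
    (\<forall>w h k. h \<in> hom C w x \<longrightarrow> k \<in> hom C w y \<longrightarrow>
      (\<exists>!u. u \<in> hom C w z \<and> Cmp C p u = h \<and> Cmp C q u = k))"

definition has_finite_products :: "('o, 'a) cat \<Rightarrow> bool"
  where "has_finite_products C \<longleftrightarrow>
    (\<exists>t. is_terminal C t) \<and> (\<forall>x\<in>Ob C. \<forall>y\<in>Ob C. \<exists>z p q. is_product C x y z p q)"

text \<open>
  \<open>product_functor C A P p q\<close>: the endofunctor \<open>P\<close> of \<open>C\<close> is \<open>- \<times> A\<close>, formed with respect to
  the product projections \<open>p B : P B \<rightarrow> B\<close> and \<open>q B : P B \<rightarrow> A\<close>; on arrows it is \<open>f \<mapsto> f \<times> 1\<close>.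
\<close>

definition product_functor ::
  "('o, 'a) cat \<Rightarrow> 'o \<Rightarrow> ('o, 'a, 'o, 'a) func \<Rightarrow> ('o \<Rightarrow> 'a) \<Rightarrow> ('o \<Rightarrow> 'a) \<Rightarrow> bool"
  where "product_functor C A P p q \<longleftrightarrow>
    is_functor P \<and> Src P = C \<and> Tgt P = C \<and>
    (\<forall>B\<in>Ob C. is_product C B A (FOb P B) (p B) (q B)) \<and>
    (\<forall>B B'. \<forall>f \<in> hom C B B'.
      Cmp C (p B') (FAr P f) = Cmp C f (p B) \<and> Cmp C (q B') (FAr P f) = q B)"

definition cartesian_closed_structure ::
  "('o, 'a) cat \<Rightarrow> ('o \<Rightarrow> ('o, 'a, 'o, 'a) func) \<Rightarrow> ('o \<Rightarrow> 'o \<Rightarrow> 'a) \<Rightarrow> ('o \<Rightarrow> 'o \<Rightarrow> 'a) \<Rightarrow>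
   ('o \<Rightarrow> ('o, 'a, 'o, 'a) func) \<Rightarrow> ('o \<Rightarrow> ('o, 'a, 'o, 'a) ntrans) \<Rightarrow>
   ('o \<Rightarrow> ('o, 'a, 'o, 'a) ntrans) \<Rightarrow> bool"
  where "cartesian_closed_structure C P p q H \<eta> \<epsilon> \<longleftrightarrow>
    category C \<and> has_finite_products C \<and>
    (\<forall>A\<in>Ob C. product_functor C A (P A) (p A) (q A) \<and> adjunction (P A) (H A) (\<eta> A) (\<epsilon> A))"


section \<open>Products and categories of pullback-preserving functors\<close>

definition prod_cat :: "('o, 'a) cat \<Rightarrow> ('p, 'b) cat \<Rightarrow> ('o \<times> 'p, 'a \<times> 'b) cat"
  where "prod_cat C D = build_cat (Ob C \<times> Ob D) (Ar C \<times> Ar D)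
    (\<lambda>(f, g). (Dom C f, Dom D g)) (\<lambda>(f, g). (Cod C f, Cod D g))
    (\<lambda>(x, y). (Ide C x, Ide D y)) (\<lambda>(f', g') (f, g). (Cmp C f' f, Cmp D g' g))"

definition fst_func :: "('o, 'a) cat \<Rightarrow> ('p, 'b) cat \<Rightarrow> ('o \<times> 'p, 'a \<times> 'b, 'o, 'a) func"
  where "fst_func C D = build_func (prod_cat C D) C fst fst"

definition snd_func :: "('o, 'a) cat \<Rightarrow> ('p, 'b) cat \<Rightarrow> ('o \<times> 'p, 'a \<times> 'b, 'p, 'b) func"
  where "snd_func C D = build_func (prod_cat C D) D snd snd"

definition prod_func ::
  "('o, 'a, 'p, 'b) func \<Rightarrow> ('q, 'c, 'r, 'd) func \<Rightarrow>
   ('o \<times> 'q, 'a \<times> 'c, 'p \<times> 'r, 'b \<times> 'd) func"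
  where "prod_func F G = build_func (prod_cat (Src F) (Src G)) (prod_cat (Tgt F) (Tgt G))
    (map_prod (FOb F) (FOb G)) (map_prod (FAr F) (FAr G))"

definition id_ntrans :: "('o, 'a, 'p, 'b) func \<Rightarrow> ('o, 'a, 'p, 'b) ntrans"
  where "id_ntrans F = build_ntrans F F (\<lambda>x. Ide (Tgt F) (FOb F x))"

definition comp_ntrans ::
  "('o, 'a, 'p, 'b) ntrans \<Rightarrow> ('o, 'a, 'p, 'b) ntrans \<Rightarrow> ('o, 'a, 'p, 'b) ntrans"
  where "comp_ntrans \<tau> \<sigma> = build_ntrans (NSrc \<sigma>) (NTgt \<tau>)
    (\<lambda>x. Cmp (Tgt (NSrc \<sigma>)) (Component \<tau> x) (Component \<sigma> x))"

definition whisker ::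
  "('p, 'b, 'q, 'c) func \<Rightarrow> ('o, 'a, 'p, 'b) ntrans \<Rightarrow> ('o, 'a, 'q, 'c) ntrans"
  where "whisker F \<tau> =
    build_ntrans (F \<circ>\<^sub>F NSrc \<tau>) (F \<circ>\<^sub>F NTgt \<tau>) (\<lambda>x. FAr F (Component \<tau> x))"

text \<open>The category \<open>[A,B]\<^sub>p\<^sub>b\<close>.\<close>

definition pb_functors :: "('o, 'a) cat \<Rightarrow> ('p, 'b) cat \<Rightarrow> ('o, 'a, 'p, 'b) func set"
  where "pb_functors A B = {F. pb_functor F \<and> Src F = A \<and> Tgt F = B}"

definition pb_hom_cat ::
  "('o, 'a) cat \<Rightarrow> ('p, 'b) cat \<Rightarrow> (('o, 'a, 'p, 'b) func, ('o, 'a, 'p, 'b) ntrans) cat"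
  where "pb_hom_cat A B = build_cat (pb_functors A B)
    {\<tau>. cartesian_ntrans \<tau> \<and> NSrc \<tau> \<in> pb_functors A B \<and> NTgt \<tau> \<in> pb_functors A B}
    NSrc NTgt id_ntrans comp_ntrans"

definition postcomp ::
  "('o, 'a) cat \<Rightarrow> ('p, 'b, 'q, 'c) func \<Rightarrow>
   (('o, 'a, 'p, 'b) func, ('o, 'a, 'p, 'b) ntrans,
    ('o, 'a, 'q, 'c) func, ('o, 'a, 'q, 'c) ntrans) func"
  where "postcomp A F =
    build_func (pb_hom_cat A (Src F)) (pb_hom_cat A (Tgt F)) (\<lambda>G. F \<circ>\<^sub>F G) (whisker F)"

definition eval_func ::
  "('o, 'a) cat \<Rightarrow> ('p, 'b) cat \<Rightarrow>
   (('o, 'a, 'p, 'b) func \<times> 'o, ('o, 'a, 'p, 'b) ntrans \<times> 'a, 'p, 'b) func"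
  where "eval_func A B = build_func (prod_cat (pb_hom_cat A B) A) B
    (\<lambda>(F, x). FOb F x)
    (\<lambda>(\<tau>, f). Cmp B (FAr (NTgt \<tau>) f) (Component \<tau> (Dom A f)))"

definition pair_func ::
  "('o, 'a) cat \<Rightarrow> ('p, 'b) cat \<Rightarrow> 'p \<Rightarrow> ('o, 'a, 'p \<times> 'o, 'b \<times> 'a) func"
  where "pair_func A B b = build_func A (prod_cat B A) (\<lambda>x. (b, x)) (\<lambda>f. (Ide B b, f))"

definition coeval_func ::
  "('o, 'a) cat \<Rightarrow> ('p, 'b) cat \<Rightarrow>
   ('p, 'b, ('o, 'a, 'p \<times> 'o, 'b \<times> 'a) func, ('o, 'a, 'p \<times> 'o, 'b \<times> 'a) ntrans) func"
  where "coeval_func A B = build_func B (pb_hom_cat A (prod_cat B A))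
    (pair_func A B)
    (\<lambda>f. build_ntrans (pair_func A B (Dom B f)) (pair_func A B (Cod B f)) (\<lambda>x. (f, Ide A x)))"


section \<open>Small categories\<close>

text \<open>
  A type in class \<open>universe\<close> is a universe of sets: \<open>elts v\<close> is the set of members of \<open>v\<close>, and a
  subset of the type is small if it is of this form. The axioms are those of a Grothendieck
  universe (extensionality, subsets, unordered pairs, unions of small families, power sets).
  Foundation and infinity are not used and not imposed.
\<close>

class universe =
  fixes elts :: "'a \<Rightarrow> 'a set"
  assumes elts_inj: "inj elts"
    and elts_subset: "X \<subseteq> elts v \<Longrightarrow> X \<in> range elts"
    and elts_pair: "{x, y} \<in> range elts"
    and elts_UN: "(\<Union>x\<in>elts v. elts (F x)) \<in> range elts"
    and elts_Pow: "{w. elts w \<subseteq> elts v} \<in> range elts"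

text \<open>The axioms are consistent: the hereditarily finite sets satisfy them.\<close>

lemma hereditarily_finite_universe: "class.universe set_decode"
proof -
  have range_iff: "X \<in> range set_decode \<longleftrightarrow> finite X" for X
    by (metis finite_set_decode rangeE rangeI set_encode_inverse)
  have inj: "inj set_decode"
    by (metis injI set_decode_inverse)
  have "finite {w. set_decode w \<subseteq> set_decode v}" for v
  proof (rule finite_imageD)
    show "finite (set_decode ` {w. set_decode w \<subseteq> set_decode v})"
      by (rule finite_subset[of _ "Pow (set_decode v)"]) auto
    show "inj_on set_decode {w. set_decode w \<subseteq> set_decode v}"
      using inj by (rule inj_on_subset) simp
  qed
  then show ?thesis
    by unfold_locales (use inj in \<open>auto simp: range_iff intro: finite_subset\<close>)
qed

definition small :: "'u::universe set \<Rightarrow> bool"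
  where "small X \<longleftrightarrow> X \<in> range elts"

definition set_code :: "'u::universe set \<Rightarrow> 'u"
  where "set_code X = inv elts X"

definition pair_code :: "'u::universe \<times> 'u \<Rightarrow> 'u"
  where "pair_code = (\<lambda>(x, y). set_code {set_code {x}, set_code {x, y}})"

definition graph_code :: "'u::universe set \<Rightarrow> ('u \<Rightarrow> 'u) \<Rightarrow> 'u"
  where "graph_code X f = set_code ((\<lambda>x. pair_code (x, f x)) ` X)"

text \<open>
  A functor or natural transformation between small categories is coded by its graph. Source and
  target category are omitted from the code, so that the codes are injective on the functors
  between two given categories and on the natural transformations between those.
\<close>

definition func_code :: "('u::universe, 'u, 'u, 'u) func \<Rightarrow> 'u"
  where "func_code F =
    pair_code (graph_code (Ob (Src F)) (FOb F), graph_code (Ar (Src F)) (FAr F))"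

definition ntrans_code :: "('u::universe, 'u, 'u, 'u) ntrans \<Rightarrow> 'u"
  where "ntrans_code \<tau> =
    pair_code (func_code (NSrc \<tau>),
      pair_code (func_code (NTgt \<tau>), graph_code (Ob (Src (NSrc \<tau>))) (Component \<tau>)))"

text \<open>
  The isomorphic copy of \<open>C\<close> along maps \<open>f\<close>, \<open>g\<close> that are injective on objects and arrows,
  with the mutually inverse functors \<open>encode f g C\<close> and \<open>decode f g C\<close>.
\<close>

definition transport :: "('o \<Rightarrow> 'p) \<Rightarrow> ('a \<Rightarrow> 'b) \<Rightarrow> ('o, 'a) cat \<Rightarrow> ('p, 'b) cat"
  where "transport f g C = build_cat (f ` Ob C) (g ` Ar C)
    (\<lambda>u. f (Dom C (inv_into (Ar C) g u))) (\<lambda>u. f (Cod C (inv_into (Ar C) g u)))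
    (\<lambda>x. g (Ide C (inv_into (Ob C) f x)))
    (\<lambda>v u. g (Cmp C (inv_into (Ar C) g v) (inv_into (Ar C) g u)))"

definition encode :: "('o \<Rightarrow> 'p) \<Rightarrow> ('a \<Rightarrow> 'b) \<Rightarrow> ('o, 'a) cat \<Rightarrow> ('o, 'a, 'p, 'b) func"
  where "encode f g C = build_func C (transport f g C) f g"

definition decode :: "('o \<Rightarrow> 'p) \<Rightarrow> ('a \<Rightarrow> 'b) \<Rightarrow> ('o, 'a) cat \<Rightarrow> ('p, 'b, 'o, 'a) func"
  where "decode f g C =
    build_func (transport f g C) C (inv_into (Ob C) f) (inv_into (Ar C) g)"


section \<open>The category of small categories with pullbacks\<close>

type_synonym 'u scat = "('u, 'u) cat"
type_synonym 'u sfunc = "('u, 'u, 'u, 'u) func"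

definition Cat_pb :: "('u::universe scat, 'u sfunc) cat"
  where "Cat_pb = build_cat
    {C. category C \<and> small (Ob C) \<and> small (Ar C) \<and> has_pullbacks C}
    {F. pb_functor F \<and> small (Ob (Src F)) \<and> small (Ar (Src F)) \<and>
      small (Ob (Tgt F)) \<and> small (Ar (Tgt F))}
    Src Tgt id_func (\<circ>\<^sub>F)"

text \<open>The object \<open>B \<times> A\<close> of \<open>Cat_pb\<close>, its projections, and the functor \<open>- \<times> A\<close>.\<close>

definition times_cat :: "'u::universe scat \<Rightarrow> 'u scat \<Rightarrow> 'u scat"
  where "times_cat B A = transport pair_code pair_code (prod_cat B A)"

abbreviation pair_encode ::
  "'u::universe scat \<Rightarrow> 'u scat \<Rightarrow> ('u \<times> 'u, 'u \<times> 'u, 'u, 'u) func"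
  where "pair_encode B A \<equiv> encode pair_code pair_code (prod_cat B A)"

abbreviation pair_decode ::
  "'u::universe scat \<Rightarrow> 'u scat \<Rightarrow> ('u, 'u, 'u \<times> 'u, 'u \<times> 'u) func"
  where "pair_decode B A \<equiv> decode pair_code pair_code (prod_cat B A)"

definition proj1 :: "'u::universe scat \<Rightarrow> 'u scat \<Rightarrow> 'u sfunc"
  where "proj1 A B = fst_func B A \<circ>\<^sub>F pair_decode B A"

definition proj2 :: "'u::universe scat \<Rightarrow> 'u scat \<Rightarrow> 'u sfunc"
  where "proj2 A B = snd_func B A \<circ>\<^sub>F pair_decode B A"

definition times_func ::
  "'u::universe scat \<Rightarrow> ('u scat, 'u sfunc, 'u scat, 'u sfunc) func"
  where "times_func A = build_func Cat_pb Cat_pb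
    (\<lambda>B. times_cat B A)
    (\<lambda>F. pair_encode (Tgt F) A \<circ>\<^sub>F prod_func F (id_func A) \<circ>\<^sub>F pair_decode (Src F) A)"

text \<open>The object \<open>[A,B]\<^sub>p\<^sub>b\<close> of \<open>Cat_pb\<close> and the functor \<open>[A,-]\<^sub>p\<^sub>b\<close>.\<close>

definition ihom_cat :: "'u::universe scat \<Rightarrow> 'u scat \<Rightarrow> 'u scat"
  where "ihom_cat A B = transport func_code ntrans_code (pb_hom_cat A B)"

abbreviation hom_encode ::
  "'u::universe scat \<Rightarrow> 'u scat \<Rightarrow> ('u sfunc, ('u, 'u, 'u, 'u) ntrans, 'u, 'u) func"
  where "hom_encode A B \<equiv> encode func_code ntrans_code (pb_hom_cat A B)"

abbreviation hom_decode ::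
  "'u::universe scat \<Rightarrow> 'u scat \<Rightarrow> ('u, 'u, 'u sfunc, ('u, 'u, 'u, 'u) ntrans) func"
  where "hom_decode A B \<equiv> decode func_code ntrans_code (pb_hom_cat A B)"

definition ihom_func ::
  "'u::universe scat \<Rightarrow> ('u scat, 'u sfunc, 'u scat, 'u sfunc) func"
  where "ihom_func A = build_func Cat_pb Cat_pb
    (ihom_cat A)
    (\<lambda>F. hom_encode A (Tgt F) \<circ>\<^sub>F postcomp A F \<circ>\<^sub>F hom_decode A (Src F))"

definition ev :: "'u::universe scat \<Rightarrow> 'u scat \<Rightarrow> 'u sfunc"
  where "ev A B =
    eval_func A B \<circ>\<^sub>F prod_func (hom_decode A B) (id_func A) \<circ>\<^sub>F pair_decode (ihom_cat A B) A"

definition coev :: "'u::universe scat \<Rightarrow> 'u scat \<Rightarrow> 'u sfunc"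
  where "coev A B =
    hom_encode A (times_cat B A) \<circ>\<^sub>F postcomp A (pair_encode B A) \<circ>\<^sub>F coeval_func A B"

definition ev_ntrans ::
  "'u::universe scat \<Rightarrow> ('u scat, 'u sfunc, 'u scat, 'u sfunc) ntrans"
  where "ev_ntrans A =
    build_ntrans (times_func A \<circ>\<^sub>F ihom_func A) (id_func Cat_pb) (ev A)"

definition coev_ntrans ::
  "'u::universe scat \<Rightarrow> ('u scat, 'u sfunc, 'u scat, 'u sfunc) ntrans"
  where "coev_ntrans A =
    build_ntrans (id_func Cat_pb) (ihom_func A \<circ>\<^sub>F times_func A) (coev A)"

end

theory Submission
  imports Defs
begin

text \<open>
  The category of categories is cartesian closed: evaluation and coevaluation make \<open>[A,-]\<close> right adjoint
  to \<open>- \<times> A\<close>. The formulas for evaluation and coevaluation stay the same here; what has to be shown is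
  that this structure restricts to pullback-preserving functors and cartesian transformations.

  The key fact is that pullbacks in \<open>[A,B]\<^sub>p\<^sub>b\<close> exist and are the pointwise ones. The pointwise pullback
  of two cartesian transformations has cartesian projections (\<open>pullback_cube\<close>), so its apex preserves
  pullbacks because the functors below it do (\<open>preserves_pullbacks_along_cartesian\<close>), and it has the
  universal property (\<open>pb_hom_cat_pullbackI\<close>) since, by cancellation of pullback squares, the
  mediating transformation is cartesian. As pullbacks are unique up to isomorphism, every pullback in
  \<open>[A,B]\<^sub>p\<^sub>b\<close> is pointwise (\<open>pb_hom_cat_pullbackD\<close>). Hence postcomposition with a
  pullback-preserving functor, and coevaluation, preserve pullbacks. Evaluation preserves them too
  (\<open>pb_functor_eval_func\<close>): the image of a pullback square of \<open>[A,B]\<^sub>p\<^sub>b \<times> A\<close> is pasted from a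
  pointwise pullback, two cartesian naturality squares, and the image of a pullback in \<open>A\<close> under a
  pullback-preserving functor.

  All of this is done for arbitrary categories. It is carried over to small categories along the
  isomorphisms between a category of pairs or of functors and its copy with coded objects and arrows.
  The axioms of a universe make these copies small and the codes injective. Since every object and
  arrow of \<open>B \<times> A\<close> or \<open>[A,B]\<^sub>p\<^sub>b\<close> is the code of a pair, a functor or a transformation, the naturality of
  unit and counit and the triangle identities are equations between values on codes.
\<close>

section \<open>Arrow-based rules for categories, functors and transformations\<close>

lemma category_arrows [simp]:
  assumes "category C"
  shows Dom_in: "f \<in> Ar C \<Longrightarrow> Dom C f \<in> Ob C"
    and Cod_in: "f \<in> Ar C \<Longrightarrow> Cod C f \<in> Ob C"
    and Ide_in: "x \<in> Ob C \<Longrightarrow> Ide C x \<in> Ar C"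
    and Dom_Ide: "x \<in> Ob C \<Longrightarrow> Dom C (Ide C x) = x"
    and Cod_Ide: "x \<in> Ob C \<Longrightarrow> Cod C (Ide C x) = x"
    and Cmp_in: "g \<in> Ar C \<Longrightarrow> f \<in> Ar C \<Longrightarrow> Dom C g = Cod C f \<Longrightarrow> Cmp C g f \<in> Ar C"
    and Dom_Cmp: "g \<in> Ar C \<Longrightarrow> f \<in> Ar C \<Longrightarrow> Dom C g = Cod C f \<Longrightarrow> Dom C (Cmp C g f) = Dom C f"
    and Cod_Cmp: "g \<in> Ar C \<Longrightarrow> f \<in> Ar C \<Longrightarrow> Dom C g = Cod C f \<Longrightarrow> Cod C (Cmp C g f) = Cod C g"
    and Cmp_Ide_right: "f \<in> Ar C \<Longrightarrow> x = Dom C f \<Longrightarrow> Cmp C f (Ide C x) = f"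
    and Cmp_Ide_left: "f \<in> Ar C \<Longrightarrow> x = Cod C f \<Longrightarrow> Cmp C (Ide C x) f = f"
proof -
  interpret category C by fact
  show "f \<in> Ar C \<Longrightarrow> Dom C f \<in> Ob C" "f \<in> Ar C \<Longrightarrow> Cod C f \<in> Ob C"
    using Dom_ext Cod_ext by auto
  show "x \<in> Ob C \<Longrightarrow> Ide C x \<in> Ar C" "x \<in> Ob C \<Longrightarrow> Dom C (Ide C x) = x"
    "x \<in> Ob C \<Longrightarrow> Cod C (Ide C x) = x"
    using Ide_hom by (auto simp: hom_def)
  have "Cmp C g f \<in> hom C (Dom C f) (Cod C g)" if "g \<in> Ar C" "f \<in> Ar C" "Dom C g = Cod C f"
    using Cmp_hom[of f "Dom C f" "Cod C f" g "Cod C g"] that by (auto simp: hom_def)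
  then show "g \<in> Ar C \<Longrightarrow> f \<in> Ar C \<Longrightarrow> Dom C g = Cod C f \<Longrightarrow> Cmp C g f \<in> Ar C"
    "g \<in> Ar C \<Longrightarrow> f \<in> Ar C \<Longrightarrow> Dom C g = Cod C f \<Longrightarrow> Dom C (Cmp C g f) = Dom C f"
    "g \<in> Ar C \<Longrightarrow> f \<in> Ar C \<Longrightarrow> Dom C g = Cod C f \<Longrightarrow> Cod C (Cmp C g f) = Cod C g"
    by (auto simp: hom_def)
  show "f \<in> Ar C \<Longrightarrow> x = Dom C f \<Longrightarrow> Cmp C f (Ide C x) = f"
    using Cmp_Ide[of f x "Cod C f"] by (auto simp: hom_def)
  show "f \<in> Ar C \<Longrightarrow> x = Cod C f \<Longrightarrow> Cmp C (Ide C x) f = f"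
    using Ide_Cmp[of f "Dom C f" x] by (auto simp: hom_def)
qed

text \<open>Not a default simplification rule: some computations use it from right to left.\<close>

lemma Cmp_assoc':
  assumes "category C" "f \<in> Ar C" "g \<in> Ar C" "h \<in> Ar C" "Dom C g = Cod C f" "Dom C h = Cod C g"
  shows "Cmp C (Cmp C h g) f = Cmp C h (Cmp C g f)"
proof -
  interpret category C by fact
  show ?thesis
    using Cmp_assoc[of f "Dom C f" "Cod C f" g "Cod C g" h "Cod C h"] assms by (auto simp: hom_def)
qed

lemma build_cat_simps [simp]:
  "Ob (build_cat X Y d c i m) = X"
  "Ar (build_cat X Y d c i m) = Y"
  "f \<in> Y \<Longrightarrow> Dom (build_cat X Y d c i m) f = d f"
  "f \<in> Y \<Longrightarrow> Cod (build_cat X Y d c i m) f = c f"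
  "x \<in> X \<Longrightarrow> Ide (build_cat X Y d c i m) x = i x"
  "g \<in> Y \<Longrightarrow> f \<in> Y \<Longrightarrow> d g = c f \<Longrightarrow> Cmp (build_cat X Y d c i m) g f = m g f"
  by (auto simp: build_cat_def)

lemma category_build_cat:
  assumes "\<And>f. f \<in> Y \<Longrightarrow> d f \<in> X" "\<And>f. f \<in> Y \<Longrightarrow> c f \<in> X"
    and "\<And>x. x \<in> X \<Longrightarrow> i x \<in> Y" "\<And>x. x \<in> X \<Longrightarrow> d (i x) = x" "\<And>x. x \<in> X \<Longrightarrow> c (i x) = x"
    and cmp: "\<And>g f. g \<in> Y \<Longrightarrow> f \<in> Y \<Longrightarrow> d g = c f \<Longrightarrow> m g f \<in> Y \<and> d (m g f) = d f \<and> c (m g f) = c g"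
    and "\<And>f. f \<in> Y \<Longrightarrow> m f (i (d f)) = f" "\<And>f. f \<in> Y \<Longrightarrow> m (i (c f)) f = f"
    and "\<And>h g f. h \<in> Y \<Longrightarrow> g \<in> Y \<Longrightarrow> f \<in> Y \<Longrightarrow> d g = c f \<Longrightarrow> d h = c g \<Longrightarrow> m h (m g f) = m (m h g) f"
  shows "category (build_cat X Y d c i m)"
  using assms by unfold_locales (auto simp: hom_def build_cat_def)

lemma functor_arrows [simp]:
  assumes "is_functor F"
  shows FOb_in: "x \<in> Ob (Src F) \<Longrightarrow> Tgt F = D \<Longrightarrow> FOb F x \<in> Ob D"
    and FAr_in: "f \<in> Ar (Src F) \<Longrightarrow> Tgt F = D \<Longrightarrow> FAr F f \<in> Ar D"
    and Dom_FAr: "f \<in> Ar (Src F) \<Longrightarrow> Tgt F = D \<Longrightarrow> Dom D (FAr F f) = FOb F (Dom (Src F) f)"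
    and Cod_FAr: "f \<in> Ar (Src F) \<Longrightarrow> Tgt F = D \<Longrightarrow> Cod D (FAr F f) = FOb F (Cod (Src F) f)"
    and FAr_Ide': "x \<in> Ob C \<Longrightarrow> Src F = C \<Longrightarrow> FAr F (Ide C x) = Ide (Tgt F) (FOb F x)"
    and FAr_Cmp': "g \<in> Ar C \<Longrightarrow> f \<in> Ar C \<Longrightarrow> Dom C g = Cod C f \<Longrightarrow> Src F = C \<Longrightarrow>
      FAr F (Cmp C g f) = Cmp (Tgt F) (FAr F g) (FAr F f)"
proof -
  interpret is_functor F by fact
  show "x \<in> Ob (Src F) \<Longrightarrow> Tgt F = D \<Longrightarrow> FOb F x \<in> Ob D"
    using FOb_ext by auto
  have "FAr F f \<in> hom (Tgt F) (FOb F (Dom (Src F) f)) (FOb F (Cod (Src F) f))"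
    if "f \<in> Ar (Src F)"
    using that by (intro FAr_hom) (auto simp: hom_def)
  then show "f \<in> Ar (Src F) \<Longrightarrow> Tgt F = D \<Longrightarrow> FAr F f \<in> Ar D"
    "f \<in> Ar (Src F) \<Longrightarrow> Tgt F = D \<Longrightarrow> Dom D (FAr F f) = FOb F (Dom (Src F) f)"
    "f \<in> Ar (Src F) \<Longrightarrow> Tgt F = D \<Longrightarrow> Cod D (FAr F f) = FOb F (Cod (Src F) f)"
    by (auto simp: hom_def)
  show "x \<in> Ob C \<Longrightarrow> Src F = C \<Longrightarrow> FAr F (Ide C x) = Ide (Tgt F) (FOb F x)"
    using FAr_Ide by auto
  show "g \<in> Ar C \<Longrightarrow> f \<in> Ar C \<Longrightarrow> Dom C g = Cod C f \<Longrightarrow> Src F = C \<Longrightarrow>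
      FAr F (Cmp C g f) = Cmp (Tgt F) (FAr F g) (FAr F f)"
    using FAr_Cmp[of f "Dom C f" "Cod C f" g "Cod C g"] by (auto simp: hom_def)
qed

lemma functor_category [simp]:
  assumes "is_functor F"
  shows "category (Src F)" "category (Tgt F)"
  using is_functor.Src_category[OF assms] is_functor.Tgt_category[OF assms] .

lemma build_func_simps [simp]:
  "Src (build_func C D f g) = C"
  "Tgt (build_func C D f g) = D"
  "x \<in> Ob C \<Longrightarrow> FOb (build_func C D f g) x = f x"
  "a \<in> Ar C \<Longrightarrow> FAr (build_func C D f g) a = g a"
  by (auto simp: build_func_def)

lemma functor_build_func:
  assumes "category C" "category D"
    and "\<And>x. x \<in> Ob C \<Longrightarrow> f x \<in> Ob D"
    and "\<And>a. a \<in> Ar C \<Longrightarrow> g a \<in> Ar D"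
    and "\<And>a. a \<in> Ar C \<Longrightarrow> Dom D (g a) = f (Dom C a)"
    and "\<And>a. a \<in> Ar C \<Longrightarrow> Cod D (g a) = f (Cod C a)"
    and "\<And>x. x \<in> Ob C \<Longrightarrow> g (Ide C x) = Ide D (f x)"
    and "\<And>b a. a \<in> Ar C \<Longrightarrow> b \<in> Ar C \<Longrightarrow> Dom C b = Cod C a \<Longrightarrow> g (Cmp C b a) = Cmp D (g b) (g a)"
  shows "is_functor (build_func C D f g)"
proof (rule is_functor.intro)
  show "category (Src (build_func C D f g))" "category (Tgt (build_func C D f g))"
    using assms by auto
qed (use assms in \<open>auto simp: hom_def\<close>, auto simp: build_func_def)

lemma functor_eqI:
  assumes "is_functor F" "is_functor G" "Src F = Src G" "Tgt F = Tgt G"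
    and "\<And>x. x \<in> Ob (Src F) \<Longrightarrow> FOb F x = FOb G x"
    and "\<And>f. f \<in> Ar (Src F) \<Longrightarrow> FAr F f = FAr G f"
  shows "F = G"
proof -
  interpret F: is_functor F by fact
  interpret G: is_functor G by fact
  have "FOb F = FOb G"
    using F.FOb_ext G.FOb_ext assms by (intro extensionalityI[of _ "Ob (Src F)"]) (auto simp: PiE_def)
  moreover have "FAr F = FAr G"
    using F.FAr_ext G.FAr_ext assms by (intro extensionalityI[of _ "Ar (Src F)"]) auto
  ultimately show ?thesis
    using assms by simp
qed

lemma id_func_simps [simp]:
  "Src (id_func C) = C" "Tgt (id_func C) = C"
  "x \<in> Ob C \<Longrightarrow> FOb (id_func C) x = x" "f \<in> Ar C \<Longrightarrow> FAr (id_func C) f = f"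
  by (auto simp: id_func_def)

lemma functor_id_func [simp]: "category C \<Longrightarrow> is_functor (id_func C)"
  unfolding id_func_def by (rule functor_build_func) auto

lemma comp_func_simps [simp]:
  "Src (G \<circ>\<^sub>F F) = Src F" "Tgt (G \<circ>\<^sub>F F) = Tgt G"
  "x \<in> Ob (Src F) \<Longrightarrow> FOb (G \<circ>\<^sub>F F) x = FOb G (FOb F x)"
  "f \<in> Ar (Src F) \<Longrightarrow> FAr (G \<circ>\<^sub>F F) f = FAr G (FAr F f)"
  by (auto simp: comp_func_def)

lemma functor_comp_func [simp]:
  "is_functor F \<Longrightarrow> is_functor G \<Longrightarrow> Src G = Tgt F \<Longrightarrow> is_functor (G \<circ>\<^sub>F F)"
  unfolding comp_func_def by (rule functor_build_func) auto

lemma comp_func_id [simp]: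
  assumes "is_functor F"
  shows "Src F = C \<Longrightarrow> F \<circ>\<^sub>F id_func C = F" "Tgt F = D \<Longrightarrow> id_func D \<circ>\<^sub>F F = F"
  using assms by (auto intro!: functor_eqI)

lemma comp_func_assoc:
  "is_functor F \<Longrightarrow> is_functor G \<Longrightarrow> is_functor H \<Longrightarrow> Src G = Tgt F \<Longrightarrow> Src H = Tgt G \<Longrightarrow>
    H \<circ>\<^sub>F (G \<circ>\<^sub>F F) = (H \<circ>\<^sub>F G) \<circ>\<^sub>F F"
  by (auto intro!: functor_eqI)

lemma ntrans_arrows [simp]:
  assumes "is_ntrans \<tau>"
  shows NSrc_functor': "is_functor (NSrc \<tau>)"
    and NTgt_functor': "is_functor (NTgt \<tau>)"
    and Component_in: "x \<in> Ob (Src (NSrc \<tau>)) \<Longrightarrow> Tgt (NSrc \<tau>) = D \<Longrightarrow> Component \<tau> x \<in> Ar D"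
    and Dom_Component: "x \<in> Ob (Src (NSrc \<tau>)) \<Longrightarrow> Tgt (NSrc \<tau>) = D \<Longrightarrow>
      Dom D (Component \<tau> x) = FOb (NSrc \<tau>) x"
    and Cod_Component: "x \<in> Ob (Src (NSrc \<tau>)) \<Longrightarrow> Tgt (NSrc \<tau>) = D \<Longrightarrow>
      Cod D (Component \<tau> x) = FOb (NTgt \<tau>) x"
proof -
  interpret is_ntrans \<tau> by fact
  show "is_functor (NSrc \<tau>)" "is_functor (NTgt \<tau>)"
    "x \<in> Ob (Src (NSrc \<tau>)) \<Longrightarrow> Tgt (NSrc \<tau>) = D \<Longrightarrow> Component \<tau> x \<in> Ar D"
    "x \<in> Ob (Src (NSrc \<tau>)) \<Longrightarrow> Tgt (NSrc \<tau>) = D \<Longrightarrow> Dom D (Component \<tau> x) = FOb (NSrc \<tau>) x"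
    "x \<in> Ob (Src (NSrc \<tau>)) \<Longrightarrow> Tgt (NSrc \<tau>) = D \<Longrightarrow> Cod D (Component \<tau> x) = FOb (NTgt \<tau>) x"
    using NSrc_functor NTgt_functor Component_hom by (auto simp: hom_def)
qed

lemma ntrans_naturality:
  assumes "is_ntrans \<tau>" "Src (NSrc \<tau>) = C" "Tgt (NSrc \<tau>) = D" "f \<in> Ar C"
  shows "Cmp D (Component \<tau> (Cod C f)) (FAr (NSrc \<tau>) f) =
    Cmp D (FAr (NTgt \<tau>) f) (Component \<tau> (Dom C f))"
  using is_ntrans.naturality[OF assms(1), of f "Dom C f" "Cod C f"] assms by (auto simp: hom_def)

lemma build_ntrans_simps [simp]:
  "NSrc (build_ntrans F G t) = F" "NTgt (build_ntrans F G t) = G"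
  "x \<in> Ob (Src F) \<Longrightarrow> Component (build_ntrans F G t) x = t x"
  by (auto simp: build_ntrans_def)

lemma ntrans_build_ntrans:
  assumes "is_functor F" "is_functor G" "Src F = Src G" "Tgt F = Tgt G"
    and "\<And>x. x \<in> Ob (Src F) \<Longrightarrow> t x \<in> Ar (Tgt F)"
    and "\<And>x. x \<in> Ob (Src F) \<Longrightarrow> Dom (Tgt F) (t x) = FOb F x"
    and "\<And>x. x \<in> Ob (Src F) \<Longrightarrow> Cod (Tgt F) (t x) = FOb G x"
    and "\<And>f. f \<in> Ar (Src F) \<Longrightarrow> Cmp (Tgt F) (t (Cod (Src F) f)) (FAr F f) =
      Cmp (Tgt F) (FAr G f) (t (Dom (Src F) f))"
  shows "is_ntrans (build_ntrans F G t)"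
proof (rule is_ntrans.intro)
  show "is_functor (NSrc (build_ntrans F G t))" "is_functor (NTgt (build_ntrans F G t))"
    using assms by auto
  show "Component (build_ntrans F G t) \<in> extensional (Ob (Src (NSrc (build_ntrans F G t))))"
    by (simp add: build_ntrans_def)
qed (use assms in \<open>auto simp: hom_def\<close>)

lemma ntrans_eqI:
  assumes "is_ntrans \<sigma>" "is_ntrans \<tau>" "NSrc \<sigma> = NSrc \<tau>" "NTgt \<sigma> = NTgt \<tau>"
    and "\<And>x. x \<in> Ob (Src (NSrc \<sigma>)) \<Longrightarrow> Component \<sigma> x = Component \<tau> x"
  shows "\<sigma> = \<tau>"
proof -
  have "Component \<sigma> = Component \<tau>"
    using assms is_ntrans.Component_ext[of \<sigma>] is_ntrans.Component_ext[of \<tau>]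
    by (intro extensionalityI[of _ "Ob (Src (NSrc \<sigma>))"]) auto
  then show ?thesis
    using assms by simp
qed

section \<open>Pullback squares\<close>

lemma is_pullbackD:
  assumes "is_pullback C p q f g"
  shows "p \<in> Ar C" "q \<in> Ar C" "f \<in> Ar C" "g \<in> Ar C"
    "Dom C p = Dom C q" "Cod C p = Dom C f" "Cod C q = Dom C g" "Cod C f = Cod C g"
    "Cmp C f p = Cmp C g q"
  using assms by (auto simp: is_pullback_def)

lemma pullback_lift:
  assumes "is_pullback C p q f g" "h \<in> Ar C" "k \<in> Ar C" "Dom C h = Dom C k"
    "Cod C h = Dom C f" "Cod C k = Dom C g" "Cmp C f h = Cmp C g k"
  obtains u where "u \<in> Ar C" "Dom C u = Dom C h" "Cod C u = Dom C p" "Cmp C p u = h" "Cmp C q u = k"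
proof -
  have "h \<in> hom C (Dom C h) (Dom C f)" "k \<in> hom C (Dom C h) (Dom C g)"
    using assms by (auto simp: hom_def)
  then have "\<exists>u. u \<in> hom C (Dom C h) (Dom C p) \<and> Cmp C p u = h \<and> Cmp C q u = k"
    using assms(1,7) unfolding is_pullback_def by blast
  then show ?thesis
    using that by (auto simp: hom_def)
qed

lemma pullback_unique:
  assumes "category C" "is_pullback C p q f g" "u \<in> Ar C" "v \<in> Ar C" "Dom C u = Dom C v"
    "Cod C u = Dom C p" "Cod C v = Dom C p" "Cmp C p u = Cmp C p v" "Cmp C q u = Cmp C q v"
  shows "u = v"
proof -
  note [simp] = is_pullbackD[OF assms(2)]
  let ?h = "Cmp C p u" and ?k = "Cmp C q u"
  have "?h \<in> hom C (Dom C u) (Dom C f)" "?k \<in> hom C (Dom C u) (Dom C g)"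
    using assms by (auto simp: hom_def)
  moreover have "Cmp C f ?h = Cmp C g ?k"
    using assms by (simp add: Cmp_assoc'[symmetric])
  ultimately have "\<exists>!u'. u' \<in> hom C (Dom C u) (Dom C p) \<and> Cmp C p u' = ?h \<and> Cmp C q u' = ?k"
    using assms(2) unfolding is_pullback_def by blast
  moreover have "u \<in> hom C (Dom C u) (Dom C p)" "v \<in> hom C (Dom C u) (Dom C p)"
    using assms by (auto simp: hom_def)
  ultimately show ?thesis
    using assms(8,9) by metis
qed

lemma is_pullbackI:
  assumes "p \<in> Ar C" "q \<in> Ar C" "f \<in> Ar C" "g \<in> Ar C"
    "Dom C p = Dom C q" "Cod C p = Dom C f" "Cod C q = Dom C g" "Cod C f = Cod C g"
    "Cmp C f p = Cmp C g q"
    and lift: "\<And>h k. h \<in> Ar C \<Longrightarrow> k \<in> Ar C \<Longrightarrow> Dom C h = Dom C k \<Longrightarrow> Cod C h = Dom C f \<Longrightarrow>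
      Cod C k = Dom C g \<Longrightarrow> Cmp C f h = Cmp C g k \<Longrightarrow>
      \<exists>u. u \<in> Ar C \<and> Dom C u = Dom C h \<and> Cod C u = Dom C p \<and> Cmp C p u = h \<and> Cmp C q u = k"
    and unique: "\<And>u v. u \<in> Ar C \<Longrightarrow> v \<in> Ar C \<Longrightarrow> Dom C u = Dom C v \<Longrightarrow> Cod C u = Dom C p \<Longrightarrow>
      Cod C v = Dom C p \<Longrightarrow> Cmp C p u = Cmp C p v \<Longrightarrow> Cmp C q u = Cmp C q v \<Longrightarrow> u = v"
  shows "is_pullback C p q f g"
  unfolding is_pullback_def
proof (intro conjI allI impI)
  fix w h k
  assume *: "h \<in> hom C w (Dom C f)" "k \<in> hom C w (Dom C g)" "Cmp C f h = Cmp C g k"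
  then obtain u where "u \<in> Ar C" "Dom C u = Dom C h" "Cod C u = Dom C p" "Cmp C p u = h" "Cmp C q u = k"
    using lift[of h k] by (auto simp: hom_def)
  then show "\<exists>!u. u \<in> hom C w (Dom C p) \<and> Cmp C p u = h \<and> Cmp C q u = k"
    using * by (intro ex1I[of _ u]) (auto simp: hom_def intro: unique)
qed (use assms in auto)

lemma is_pullback_swap:
  assumes "is_pullback C p q f g"
  shows "is_pullback C q p g f"
  unfolding is_pullback_def
proof (intro conjI allI impI)
  fix w h k
  assume "h \<in> hom C w (Dom C g)" "k \<in> hom C w (Dom C f)" "Cmp C g h = Cmp C f k"
  then have "\<exists>!u. u \<in> hom C w (Dom C p) \<and> Cmp C p u = k \<and> Cmp C q u = h"
    using assms unfolding is_pullback_def by metis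
  then show "\<exists>!u. u \<in> hom C w (Dom C q) \<and> Cmp C q u = h \<and> Cmp C p u = k"
    using is_pullbackD(5)[OF assms] by (simp add: conj_commute)
qed (use is_pullbackD[OF assms] in simp_all)

text \<open>
  Pasting and cancellation: \<open>g\<close> is pulled back along \<open>f\<close> to \<open>p\<close>, and \<open>p\<close> along \<open>h\<close> to \<open>p'\<close>. If the
  square that produces \<open>p'\<close> commutes, it is a pullback precisely if the outer one is.
\<close>

lemma pullback_paste:
  assumes C: "category C" and 1: "is_pullback C p q f g" and 2: "is_pullback C p' q' h p"
  shows "is_pullback C p' (Cmp C q q') (Cmp C f h) g"
proof -
  note [simp] = C is_pullbackD(1-4,6-8)[OF 1] is_pullbackD(1-4,6-8)[OF 2]
  note [simp] = is_pullbackD(5)[OF 1, symmetric] is_pullbackD(5)[OF 2, symmetric]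
  show ?thesis
  proof (rule is_pullbackI)
    have "Cmp C (Cmp C f h) p' = Cmp C (Cmp C f p) q'"
      using is_pullbackD(9)[OF 2] by (simp add: Cmp_assoc')
    also have "\<dots> = Cmp C g (Cmp C q q')"
      using is_pullbackD(9)[OF 1] by (simp add: Cmp_assoc')
    finally show "Cmp C (Cmp C f h) p' = Cmp C g (Cmp C q q')" .
  next
    fix a b
    assume a: "a \<in> Ar C" "b \<in> Ar C" "Dom C a = Dom C b" "Cod C a = Dom C (Cmp C f h)"
      "Cod C b = Dom C g" "Cmp C (Cmp C f h) a = Cmp C g b"
    obtain u where u: "u \<in> Ar C" "Dom C u = Dom C a" "Cod C u = Dom C p"
      "Cmp C p u = Cmp C h a" "Cmp C q u = b"
      using pullback_lift[OF 1, of "Cmp C h a" b] a by (auto simp: Cmp_assoc')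
    obtain v where v: "v \<in> Ar C" "Dom C v = Dom C a" "Cod C v = Dom C p'"
      "Cmp C p' v = a" "Cmp C q' v = u"
      using pullback_lift[OF 2, of a u] a u by auto
    show "\<exists>u. u \<in> Ar C \<and> Dom C u = Dom C a \<and> Cod C u = Dom C p' \<and> Cmp C p' u = a \<and>
      Cmp C (Cmp C q q') u = b"
      using u v by (intro exI[of _ v]) (auto simp: Cmp_assoc')
  next
    fix u v
    assume uv: "u \<in> Ar C" "v \<in> Ar C" "Dom C u = Dom C v" "Cod C u = Dom C p'" "Cod C v = Dom C p'"
      "Cmp C p' u = Cmp C p' v" "Cmp C (Cmp C q q') u = Cmp C (Cmp C q q') v"
    have "Cmp C p (Cmp C q' u) = Cmp C p (Cmp C q' v)"
    proof -
      have "Cmp C p (Cmp C q' w) = Cmp C h (Cmp C p' w)" if "w \<in> Ar C" "Cod C w = Dom C p'" for w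
        using is_pullbackD(9)[OF 2] that by (simp add: Cmp_assoc'[symmetric])
      with uv show ?thesis by simp
    qed
    then have "Cmp C q' u = Cmp C q' v"
      using uv by - (rule pullback_unique[OF C 1], auto simp: Cmp_assoc')
    with uv show "u = v"
      by - (rule pullback_unique[OF C 2], auto)
  qed auto
qed

lemma pullback_cancel:
  assumes C: "category C" and 1: "is_pullback C p q f g"
    and 2: "is_pullback C p' (Cmp C q q') (Cmp C f h) g"
    and q': "q' \<in> Ar C" "Cod C q' = Dom C p" "Cmp C h p' = Cmp C p q'" "Dom C q' = Dom C p'"
    and h: "h \<in> Ar C" "Cod C h = Dom C f" "Dom C h = Cod C p'"
  shows "is_pullback C p' q' h p"
proof -
  note [simp] = C is_pullbackD(1-4,6-8)[OF 1] q'(1,2,4) h is_pullbackD(1)[OF 2]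
  note [simp] = is_pullbackD(5)[OF 1, symmetric]
  show ?thesis
  proof (rule is_pullbackI)
    fix a b
    assume a: "a \<in> Ar C" "b \<in> Ar C" "Dom C a = Dom C b" "Cod C a = Dom C h"
      "Cod C b = Dom C p" "Cmp C h a = Cmp C p b"
    have "Cmp C (Cmp C f h) a = Cmp C (Cmp C f p) b"
      using a by (simp add: Cmp_assoc')
    also have "\<dots> = Cmp C g (Cmp C q b)"
      using a is_pullbackD(9)[OF 1] by (simp add: Cmp_assoc')
    finally obtain u where u: "u \<in> Ar C" "Dom C u = Dom C a" "Cod C u = Dom C p'"
      "Cmp C p' u = a" "Cmp C (Cmp C q q') u = Cmp C q b"
      using pullback_lift[OF 2, of a "Cmp C q b"] a by auto
    have "Cmp C p (Cmp C q' u) = Cmp C (Cmp C h p') u"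
      using u by (simp add: Cmp_assoc' q'(3))
    also have "\<dots> = Cmp C p b"
      using u a by (simp add: Cmp_assoc')
    finally have "Cmp C q' u = b"
      using a u by - (rule pullback_unique[OF C 1], auto simp: Cmp_assoc')
    with u show "\<exists>u. u \<in> Ar C \<and> Dom C u = Dom C a \<and> Cod C u = Dom C p' \<and> Cmp C p' u = a \<and> Cmp C q' u = b"
      by auto
  next
    fix u v
    assume "u \<in> Ar C" "v \<in> Ar C" "Dom C u = Dom C v" "Cod C u = Dom C p'" "Cod C v = Dom C p'"
      "Cmp C p' u = Cmp C p' v" "Cmp C q' u = Cmp C q' v"
    then show "u = v"
      by - (rule pullback_unique[OF C 2], auto simp: Cmp_assoc')
  qed (simp_all add: q'(3))
qed

lemma pullback_iso:
  assumes C: "category C" and 1: "is_pullback C p q f g"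
    and e: "e \<in> Ar C" "e' \<in> Ar C" "Cod C e = Dom C p" "Dom C e' = Dom C p"
      "Cod C e' = Dom C e" "Cmp C e e' = Ide C (Cod C e)" "Cmp C e' e = Ide C (Dom C e)"
  shows "is_pullback C (Cmp C p e) (Cmp C q e) f g"
proof -
  note [simp] = C is_pullbackD(1-4,6-8)[OF 1] e
  note [simp] = is_pullbackD(5)[OF 1, symmetric]
  show ?thesis
  proof (rule is_pullbackI)
    show "Cmp C f (Cmp C p e) = Cmp C g (Cmp C q e)"
      using is_pullbackD(9)[OF 1] by (simp add: Cmp_assoc'[symmetric])
  next
    fix a b
    assume a: "a \<in> Ar C" "b \<in> Ar C" "Dom C a = Dom C b" "Cod C a = Dom C f"
      "Cod C b = Dom C g" "Cmp C f a = Cmp C g b"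
    then obtain u where u: "u \<in> Ar C" "Dom C u = Dom C a" "Cod C u = Dom C p"
      "Cmp C p u = a" "Cmp C q u = b"
      using pullback_lift[OF 1] by metis
    have "Cmp C e (Cmp C e' u) = u"
      using u by (simp add: Cmp_assoc'[symmetric])
    with u show "\<exists>u. u \<in> Ar C \<and> Dom C u = Dom C a \<and> Cod C u = Dom C (Cmp C p e) \<and>
      Cmp C (Cmp C p e) u = a \<and> Cmp C (Cmp C q e) u = b"
      by (intro exI[of _ "Cmp C e' u"]) (auto simp: Cmp_assoc')
  next
    fix u v
    assume uv: "u \<in> Ar C" "v \<in> Ar C" "Dom C u = Dom C v" "Cod C u = Dom C (Cmp C p e)"
      "Cod C v = Dom C (Cmp C p e)"
      "Cmp C (Cmp C p e) u = Cmp C (Cmp C p e) v" "Cmp C (Cmp C q e) u = Cmp C (Cmp C q e) v"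
    have "Cmp C e u = Cmp C e v"
      using uv by - (rule pullback_unique[OF C 1], auto simp: Cmp_assoc')
    then have "Cmp C (Cmp C e' e) u = Cmp C (Cmp C e' e) v"
      using uv by (simp add: Cmp_assoc' del: e(7))
    with uv show "u = v"
      by simp
  qed auto
qed

lemma pullback_comparison:
  assumes C: "category C" and 1: "is_pullback C p q f g" and 2: "is_pullback C p' q' f g"
  obtains e e' where "e \<in> Ar C" "e' \<in> Ar C" "Dom C e = Dom C p'" "Cod C e = Dom C p"
    "Dom C e' = Dom C p" "Cod C e' = Dom C p'" "Cmp C e e' = Ide C (Cod C e)"
    "Cmp C e' e = Ide C (Dom C e)" "Cmp C p e = p'" "Cmp C q e = q'"
proof -
  note [simp] = C is_pullbackD(1-4,6-8)[OF 1] is_pullbackD(1-4,6-8)[OF 2]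
  note [simp] = is_pullbackD(5)[OF 1, symmetric] is_pullbackD(5)[OF 2, symmetric]
  obtain e where e [simp]: "e \<in> Ar C" "Dom C e = Dom C p'" "Cod C e = Dom C p" "Cmp C p e = p'" "Cmp C q e = q'"
    using pullback_lift[OF 1, of p' q'] is_pullbackD(9)[OF 2] by auto
  obtain e' where e' [simp]: "e' \<in> Ar C" "Dom C e' = Dom C p" "Cod C e' = Dom C p'" "Cmp C p' e' = p" "Cmp C q' e' = q"
    using pullback_lift[OF 2, of p q] is_pullbackD(9)[OF 1] by auto
  have "Cmp C e e' = Ide C (Cod C e)"
    by - (rule pullback_unique[OF C 1], simp_all add: Cmp_assoc'[symmetric])
  moreover have "Cmp C e' e = Ide C (Dom C e)"
    by - (rule pullback_unique[OF C 2], simp_all add: Cmp_assoc'[symmetric])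
  ultimately show ?thesis
    using that e e' by blast
qed

lemma pullback_id:
  assumes C: "category C" and f: "f \<in> Ar C"
  shows "is_pullback C f (Ide C (Dom C f)) (Ide C (Cod C f)) f"
proof (rule is_pullbackI)
  fix h k
  assume "h \<in> Ar C" "k \<in> Ar C" "Dom C h = Dom C k" "Cod C h = Dom C (Ide C (Cod C f))"
    "Cod C k = Dom C f" "Cmp C (Ide C (Cod C f)) h = Cmp C f k"
  then show "\<exists>u. u \<in> Ar C \<and> Dom C u = Dom C h \<and> Cod C u = Dom C f \<and> Cmp C f u = h \<and>
      Cmp C (Ide C (Dom C f)) u = k"
    using assms by (intro exI[of _ k]) auto
qed (use assms in auto)

section \<open>Pullback-preserving functors and products\<close>

lemma pb_functorD:
  assumes "pb_functor F"
  shows "is_functor F" "has_pullbacks (Src F)" "has_pullbacks (Tgt F)"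
    "is_pullback (Src F) p q f g \<Longrightarrow> is_pullback (Tgt F) (FAr F p) (FAr F q) (FAr F f) (FAr F g)"
  using assms by (auto simp: pb_functor_def preserves_pullbacks_def)

lemma pb_functorI:
  assumes "is_functor F" "has_pullbacks (Src F)" "has_pullbacks (Tgt F)"
    and "\<And>p q f g. is_pullback (Src F) p q f g \<Longrightarrow>
      is_pullback (Tgt F) (FAr F p) (FAr F q) (FAr F f) (FAr F g)"
  shows "pb_functor F"
  using assms by (auto simp: pb_functor_def preserves_pullbacks_def)

lemma has_pullbacksE:
  assumes "has_pullbacks C" "f \<in> Ar C" "g \<in> Ar C" "Cod C f = Cod C g"
  obtains p q where "is_pullback C p q f g"
  using assms unfolding has_pullbacks_def by blast

lemma pb_functor_id_func [simp]:
  assumes "category C" "has_pullbacks C"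
  shows "pb_functor (id_func C)"
  using assms by (intro pb_functorI) (auto simp: is_pullbackD)

lemma pb_functor_comp_func [simp]:
  assumes "pb_functor F" "pb_functor G" "Src G = Tgt F"
  shows "pb_functor (G \<circ>\<^sub>F F)"
proof (rule pb_functorI)
  fix p q f g
  assume *: "is_pullback (Src (G \<circ>\<^sub>F F)) p q f g"
  then have "is_pullback (Src G) (FAr F p) (FAr F q) (FAr F f) (FAr F g)"
    using pb_functorD(4)[OF assms(1)] assms(3) by simp
  from pb_functorD(4)[OF assms(2) this]
  show "is_pullback (Tgt (G \<circ>\<^sub>F F)) (FAr (G \<circ>\<^sub>F F) p) (FAr (G \<circ>\<^sub>F F) q) (FAr (G \<circ>\<^sub>F F) f) (FAr (G \<circ>\<^sub>F F) g)"
    using is_pullbackD(1-4)[OF *] by simp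
qed (use assms pb_functorD(1-3)[OF assms(1)] pb_functorD(1-3)[OF assms(2)] in auto)

lemma prod_cat_simps [simp]:
  "Ob (prod_cat C D) = Ob C \<times> Ob D"
  "Ar (prod_cat C D) = Ar C \<times> Ar D"
  "f \<in> Ar C \<Longrightarrow> g \<in> Ar D \<Longrightarrow> Dom (prod_cat C D) (f, g) = (Dom C f, Dom D g)"
  "f \<in> Ar C \<Longrightarrow> g \<in> Ar D \<Longrightarrow> Cod (prod_cat C D) (f, g) = (Cod C f, Cod D g)"
  "x \<in> Ob C \<Longrightarrow> y \<in> Ob D \<Longrightarrow> Ide (prod_cat C D) (x, y) = (Ide C x, Ide D y)"
  "f' \<in> Ar C \<Longrightarrow> g' \<in> Ar D \<Longrightarrow> f \<in> Ar C \<Longrightarrow> g \<in> Ar D \<Longrightarrow> Dom C f' = Cod C f \<Longrightarrow>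
    Dom D g' = Cod D g \<Longrightarrow> Cmp (prod_cat C D) (f', g') (f, g) = (Cmp C f' f, Cmp D g' g)"
  by (auto simp: prod_cat_def)

lemma category_prod_cat [simp]:
  assumes "category C" "category D"
  shows "category (prod_cat C D)"
  unfolding prod_cat_def using assms
  by (intro category_build_cat) (auto simp: Cmp_assoc')

lemma is_pullback_prod_catI:
  assumes C: "category C" and D: "category D"
    and 1: "is_pullback C p q f g" and 2: "is_pullback D p' q' f' g'"
  shows "is_pullback (prod_cat C D) (p, p') (q, q') (f, f') (g, g')"
proof -
  note [simp] = C D is_pullbackD[OF 1] is_pullbackD[OF 2]
  show ?thesis
  proof (rule is_pullbackI)
    fix h k
    assume hk: "h \<in> Ar (prod_cat C D)" "k \<in> Ar (prod_cat C D)"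
      "Dom (prod_cat C D) h = Dom (prod_cat C D) k"
      "Cod (prod_cat C D) h = Dom (prod_cat C D) (f, f')"
      "Cod (prod_cat C D) k = Dom (prod_cat C D) (g, g')"
      "Cmp (prod_cat C D) (f, f') h = Cmp (prod_cat C D) (g, g') k"
    obtain h1 h2 k1 k2 where eq: "h = (h1, h2)" "k = (k1, k2)"
      by (cases h, cases k)
    obtain u1 where u1: "u1 \<in> Ar C" "Dom C u1 = Dom C h1" "Cod C u1 = Dom C p" "Cmp C p u1 = h1" "Cmp C q u1 = k1"
      by (rule pullback_lift[OF 1, of h1 k1]) (use hk eq in auto)
    obtain u2 where u2: "u2 \<in> Ar D" "Dom D u2 = Dom D h2" "Cod D u2 = Dom D p'" "Cmp D p' u2 = h2" "Cmp D q' u2 = k2"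
      by (rule pullback_lift[OF 2, of h2 k2]) (use hk eq in auto)
    show "\<exists>u. u \<in> Ar (prod_cat C D) \<and> Dom (prod_cat C D) u = Dom (prod_cat C D) h \<and>
      Cod (prod_cat C D) u = Dom (prod_cat C D) (p, p') \<and> Cmp (prod_cat C D) (p, p') u = h \<and>
      Cmp (prod_cat C D) (q, q') u = k"
      using u1 u2 hk eq by (intro exI[of _ "(u1, u2)"]) auto
  next
    fix u v
    assume uv: "u \<in> Ar (prod_cat C D)" "v \<in> Ar (prod_cat C D)"
      "Dom (prod_cat C D) u = Dom (prod_cat C D) v"
      "Cod (prod_cat C D) u = Dom (prod_cat C D) (p, p')"
      "Cod (prod_cat C D) v = Dom (prod_cat C D) (p, p')"
      "Cmp (prod_cat C D) (p, p') u = Cmp (prod_cat C D) (p, p') v"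
      "Cmp (prod_cat C D) (q, q') u = Cmp (prod_cat C D) (q, q') v"
    obtain u1 u2 v1 v2 where eq: "u = (u1, u2)" "v = (v1, v2)"
      by (cases u, cases v)
    have "u1 = v1"
      by (rule pullback_unique[OF C 1]) (use uv eq in auto)
    moreover have "u2 = v2"
      by (rule pullback_unique[OF D 2]) (use uv eq in auto)
    ultimately show "u = v"
      by (simp add: eq)
  qed auto
qed

lemma is_pullback_prod_catD:
  assumes C: "category C" and D: "category D"
    and pb: "is_pullback (prod_cat C D) (p, p') (q, q') (f, f') (g, g')"
  shows "is_pullback C p q f g" "is_pullback D p' q' f' g'"
proof -
  have ar: "p \<in> Ar C" "q \<in> Ar C" "f \<in> Ar C" "g \<in> Ar C" "p' \<in> Ar D" "q' \<in> Ar D" "f' \<in> Ar D" "g' \<in> Ar D"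
    using is_pullbackD(1-4)[OF pb] by auto
  then have sq: "Dom C p = Dom C q" "Cod C p = Dom C f" "Cod C q = Dom C g" "Cod C f = Cod C g"
    "Dom D p' = Dom D q'" "Cod D p' = Dom D f'" "Cod D q' = Dom D g'" "Cod D f' = Cod D g'"
    using is_pullbackD(5-8)[OF pb] by auto
  have cmp: "Cmp C f p = Cmp C g q" "Cmp D f' p' = Cmp D g' q'"
    using is_pullbackD(9)[OF pb] ar sq by auto
  note [simp] = C D ar sq
  show "is_pullback C p q f g"
  proof (rule is_pullbackI)
    fix h k
    assume hk: "h \<in> Ar C" "k \<in> Ar C" "Dom C h = Dom C k" "Cod C h = Dom C f" "Cod C k = Dom C g"
      "Cmp C f h = Cmp C g k"
    obtain u where "u \<in> Ar (prod_cat C D)" "Dom (prod_cat C D) u = Dom (prod_cat C D) (h, p')"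
      "Cod (prod_cat C D) u = Dom (prod_cat C D) (p, p')" "Cmp (prod_cat C D) (p, p') u = (h, p')"
      "Cmp (prod_cat C D) (q, q') u = (k, q')"
      by (rule pullback_lift[OF pb, of "(h, p')" "(k, q')"]) (use hk cmp in auto)
    then show "\<exists>u. u \<in> Ar C \<and> Dom C u = Dom C h \<and> Cod C u = Dom C p \<and> Cmp C p u = h \<and> Cmp C q u = k"
      using hk by (intro exI[of _ "fst u"]) auto
  next
    fix u v
    assume "u \<in> Ar C" "v \<in> Ar C" "Dom C u = Dom C v" "Cod C u = Dom C p"
      "Cod C v = Dom C p" "Cmp C p u = Cmp C p v" "Cmp C q u = Cmp C q v"
    then have "(u, Ide D (Dom D p')) = (v, Ide D (Dom D p'))"
      by - (rule pullback_unique[OF _ pb], auto)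
    then show "u = v" by simp
  qed (use cmp in auto)
  show "is_pullback D p' q' f' g'"
  proof (rule is_pullbackI)
    fix h k
    assume hk: "h \<in> Ar D" "k \<in> Ar D" "Dom D h = Dom D k" "Cod D h = Dom D f'" "Cod D k = Dom D g'"
      "Cmp D f' h = Cmp D g' k"
    obtain u where "u \<in> Ar (prod_cat C D)" "Dom (prod_cat C D) u = Dom (prod_cat C D) (p, h)"
      "Cod (prod_cat C D) u = Dom (prod_cat C D) (p, p')" "Cmp (prod_cat C D) (p, p') u = (p, h)"
      "Cmp (prod_cat C D) (q, q') u = (q, k)"
      by (rule pullback_lift[OF pb, of "(p, h)" "(q, k)"]) (use hk cmp in auto)
    then show "\<exists>u. u \<in> Ar D \<and> Dom D u = Dom D h \<and> Cod D u = Dom D p' \<and> Cmp D p' u = h \<and> Cmp D q' u = k"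
      using hk by (intro exI[of _ "snd u"]) auto
  next
    fix u v
    assume "u \<in> Ar D" "v \<in> Ar D" "Dom D u = Dom D v" "Cod D u = Dom D p'"
      "Cod D v = Dom D p'" "Cmp D p' u = Cmp D p' v" "Cmp D q' u = Cmp D q' v"
    then have "(Ide C (Dom C p), u) = (Ide C (Dom C p), v)"
      by - (rule pullback_unique[OF _ pb], auto)
    then show "u = v" by simp
  qed (use cmp in auto)
qed

lemma has_pullbacks_prod_cat [simp]:
  assumes "category C" "category D" "has_pullbacks C" "has_pullbacks D"
  shows "has_pullbacks (prod_cat C D)"
  unfolding has_pullbacks_def
proof (intro ballI impI)
  fix f g
  assume *: "f \<in> Ar (prod_cat C D)" "g \<in> Ar (prod_cat C D)" "Cod (prod_cat C D) f = Cod (prod_cat C D) g"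
  obtain f1 f2 g1 g2 where eq: "f = (f1, f2)" "g = (g1, g2)"
    by (cases f, cases g)
  obtain p1 q1 where 1: "is_pullback C p1 q1 f1 g1"
    by (rule has_pullbacksE[OF assms(3), of f1 g1]) (use * eq in auto)
  obtain p2 q2 where 2: "is_pullback D p2 q2 f2 g2"
    by (rule has_pullbacksE[OF assms(4), of f2 g2]) (use * eq in auto)
  show "\<exists>p q. is_pullback (prod_cat C D) p q f g"
    using is_pullback_prod_catI[OF assms(1,2) 1 2] eq by blast
qed

lemma fst_func_simps [simp]:
  "Src (fst_func C D) = prod_cat C D" "Tgt (fst_func C D) = C"
  "x \<in> Ob C \<Longrightarrow> y \<in> Ob D \<Longrightarrow> FOb (fst_func C D) (x, y) = x"
  "f \<in> Ar C \<Longrightarrow> g \<in> Ar D \<Longrightarrow> FAr (fst_func C D) (f, g) = f"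
  by (auto simp: fst_func_def)

lemma snd_func_simps [simp]:
  "Src (snd_func C D) = prod_cat C D" "Tgt (snd_func C D) = D"
  "x \<in> Ob C \<Longrightarrow> y \<in> Ob D \<Longrightarrow> FOb (snd_func C D) (x, y) = y"
  "f \<in> Ar C \<Longrightarrow> g \<in> Ar D \<Longrightarrow> FAr (snd_func C D) (f, g) = g"
  by (auto simp: snd_func_def)

lemma prod_func_simps [simp]:
  "Src (prod_func F G) = prod_cat (Src F) (Src G)" "Tgt (prod_func F G) = prod_cat (Tgt F) (Tgt G)"
  "x \<in> Ob (Src F) \<Longrightarrow> y \<in> Ob (Src G) \<Longrightarrow> FOb (prod_func F G) (x, y) = (FOb F x, FOb G y)"
  "f \<in> Ar (Src F) \<Longrightarrow> g \<in> Ar (Src G) \<Longrightarrow> FAr (prod_func F G) (f, g) = (FAr F f, FAr G g)"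
  by (auto simp: prod_func_def)

lemma pb_functor_fst_func [simp]:
  assumes "category C" "category D" "has_pullbacks C" "has_pullbacks D"
  shows "pb_functor (fst_func C D)"
proof (rule pb_functorI)
  show "is_functor (fst_func C D)"
    unfolding fst_func_def using assms by (intro functor_build_func) auto
  fix p q f g
  assume *: "is_pullback (Src (fst_func C D)) p q f g"
  obtain p1 p2 q1 q2 f1 f2 g1 g2 where eq: "p = (p1, p2)" "q = (q1, q2)" "f = (f1, f2)" "g = (g1, g2)"
    by (cases p, cases q, cases f, cases g)
  show "is_pullback (Tgt (fst_func C D)) (FAr (fst_func C D) p) (FAr (fst_func C D) q)
      (FAr (fst_func C D) f) (FAr (fst_func C D) g)"
    using is_pullback_prod_catD[OF assms(1,2), of p1 p2 q1 q2 f1 f2 g1 g2] * eq is_pullbackD(1-4)[OF *] by auto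
qed (use assms in auto)

lemma pb_functor_snd_func [simp]:
  assumes "category C" "category D" "has_pullbacks C" "has_pullbacks D"
  shows "pb_functor (snd_func C D)"
proof (rule pb_functorI)
  show "is_functor (snd_func C D)"
    unfolding snd_func_def using assms by (intro functor_build_func) auto
  fix p q f g
  assume *: "is_pullback (Src (snd_func C D)) p q f g"
  obtain p1 p2 q1 q2 f1 f2 g1 g2 where eq: "p = (p1, p2)" "q = (q1, q2)" "f = (f1, f2)" "g = (g1, g2)"
    by (cases p, cases q, cases f, cases g)
  show "is_pullback (Tgt (snd_func C D)) (FAr (snd_func C D) p) (FAr (snd_func C D) q)
      (FAr (snd_func C D) f) (FAr (snd_func C D) g)"
    using is_pullback_prod_catD[OF assms(1,2), of p1 p2 q1 q2 f1 f2 g1 g2] * eq is_pullbackD(1-4)[OF *] by auto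
qed (use assms in auto)

lemma pb_functor_prod_func [simp]:
  assumes "pb_functor F" "pb_functor G"
  shows "pb_functor (prod_func F G)"
proof (rule pb_functorI)
  note FG [simp] = pb_functorD(1-3)[OF assms(1)] pb_functorD(1-3)[OF assms(2)]
  show "is_functor (prod_func F G)"
    unfolding prod_func_def by (intro functor_build_func) auto
  fix p q f g
  assume *: "is_pullback (Src (prod_func F G)) p q f g"
  obtain p1 p2 q1 q2 f1 f2 g1 g2 where eq: "p = (p1, p2)" "q = (q1, q2)" "f = (f1, f2)" "g = (g1, g2)"
    by (cases p, cases q, cases f, cases g)
  have "is_pullback (Src F) p1 q1 f1 g1" "is_pullback (Src G) p2 q2 f2 g2"
    using is_pullback_prod_catD[of "Src F" "Src G" p1 p2 q1 q2 f1 f2 g1 g2] * eq by auto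
  then show "is_pullback (Tgt (prod_func F G)) (FAr (prod_func F G) p) (FAr (prod_func F G) q)
      (FAr (prod_func F G) f) (FAr (prod_func F G) g)"
    using is_pullback_prod_catI[of "Tgt F" "Tgt G"] pb_functorD(4)[OF assms(1)] pb_functorD(4)[OF assms(2)]
      is_pullbackD(1-4)[OF *] eq by auto
next
  show "has_pullbacks (Src (prod_func F G))" "has_pullbacks (Tgt (prod_func F G))"
    using assms by (auto simp: pb_functorD)
qed

text \<open>
  The pairing \<open>\<langle>F, G\<rangle>\<close>, the mediating functor into a binary product. It is meant for functors with the
  same source, which is taken from \<open>F\<close>.
\<close>

definition tuple_func ::
  "('o, 'a, 'p, 'b) func \<Rightarrow> ('o, 'a, 'q, 'c) func \<Rightarrow> ('o, 'a, 'p \<times> 'q, 'b \<times> 'c) func"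
  where "tuple_func F G = build_func (Src F) (prod_cat (Tgt F) (Tgt G))
    (\<lambda>x. (FOb F x, FOb G x)) (\<lambda>f. (FAr F f, FAr G f))"

lemma tuple_func_simps [simp]:
  "Src (tuple_func F G) = Src F" "Tgt (tuple_func F G) = prod_cat (Tgt F) (Tgt G)"
  "x \<in> Ob (Src F) \<Longrightarrow> FOb (tuple_func F G) x = (FOb F x, FOb G x)"
  "f \<in> Ar (Src F) \<Longrightarrow> FAr (tuple_func F G) f = (FAr F f, FAr G f)"
  by (auto simp: tuple_func_def)

lemma pb_functor_tuple_func [simp]:
  assumes "pb_functor F" "pb_functor G" "Src F = Src G"
  shows "pb_functor (tuple_func F G)"
proof (rule pb_functorI)
  note FG [simp] = pb_functorD(1-3)[OF assms(1)] pb_functorD(1-3)[OF assms(2)]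
  show "is_functor (tuple_func F G)"
    unfolding tuple_func_def using assms(3) by (intro functor_build_func) auto
  fix p q f g
  assume *: "is_pullback (Src (tuple_func F G)) p q f g"
  then show "is_pullback (Tgt (tuple_func F G)) (FAr (tuple_func F G) p) (FAr (tuple_func F G) q)
      (FAr (tuple_func F G) f) (FAr (tuple_func F G) g)"
    using is_pullback_prod_catI[of "Tgt F" "Tgt G"] pb_functorD(4)[OF assms(1)] pb_functorD(4)[OF assms(2)]
      is_pullbackD(1-4)[OF *] assms(3) by auto
next
  show "has_pullbacks (Src (tuple_func F G))" "has_pullbacks (Tgt (tuple_func F G))"
    using assms by (auto simp: pb_functorD)
qed

lemma pair_func_simps [simp]:
  "Src (pair_func A B b) = A" "Tgt (pair_func A B b) = prod_cat B A"
  "x \<in> Ob A \<Longrightarrow> FOb (pair_func A B b) x = (b, x)"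
  "f \<in> Ar A \<Longrightarrow> FAr (pair_func A B b) f = (Ide B b, f)"
  by (auto simp: pair_func_def)

lemma pb_functor_pair_func [simp]:
  assumes "category A" "category B" "has_pullbacks A" "has_pullbacks B" "b \<in> Ob B"
  shows "pb_functor (pair_func A B b)"
proof (rule pb_functorI)
  show "is_functor (pair_func A B b)"
    unfolding pair_func_def using assms by (intro functor_build_func) auto
  fix p q f g
  assume *: "is_pullback (Src (pair_func A B b)) p q f g"
  have "is_pullback B (Ide B b) (Ide B b) (Ide B b) (Ide B b)"
    using pullback_id[of B "Ide B b"] assms by simp
  then show "is_pullback (Tgt (pair_func A B b)) (FAr (pair_func A B b) p) (FAr (pair_func A B b) q)
      (FAr (pair_func A B b) f) (FAr (pair_func A B b) g)"
    using is_pullback_prod_catI[of B A] * assms is_pullbackD(1-4)[OF *] by auto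
qed (use assms in auto)

section \<open>The category of pullback-preserving functors\<close>

lemma cartesian_square:
  assumes "cartesian_ntrans \<tau>" "Src (NSrc \<tau>) = A" "Tgt (NSrc \<tau>) = B" "f \<in> Ar A"
  shows "is_pullback B (FAr (NSrc \<tau>) f) (Component \<tau> (Dom A f)) (Component \<tau> (Cod A f)) (FAr (NTgt \<tau>) f)"
  using assms unfolding cartesian_ntrans_def hom_def by auto

lemma cartesian_ntransI:
  assumes "is_ntrans \<tau>" "Src (NSrc \<tau>) = A" "Tgt (NSrc \<tau>) = B"
    and "\<And>f. f \<in> Ar A \<Longrightarrow>
      is_pullback B (FAr (NSrc \<tau>) f) (Component \<tau> (Dom A f)) (Component \<tau> (Cod A f)) (FAr (NTgt \<tau>) f)"
  shows "cartesian_ntrans \<tau>"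
  using assms unfolding cartesian_ntrans_def hom_def by auto

lemma pb_functorsD:
  assumes "F \<in> pb_functors A B"
  shows "pb_functor F" "is_functor F" "Src F = A" "Tgt F = B"
  using assms by (auto simp: pb_functors_def pb_functor_def)

lemma pb_functorsD':
  assumes "F \<in> pb_functors A B"
  shows "category A" "category B" "has_pullbacks A" "has_pullbacks B"
  using assms functor_category[OF pb_functorsD(2)[OF assms]] pb_functorD(2,3)[OF pb_functorsD(1)[OF assms]]
  by (auto simp: pb_functorsD)

lemma pb_functorsI: "pb_functor F \<Longrightarrow> Src F = A \<Longrightarrow> Tgt F = B \<Longrightarrow> F \<in> pb_functors A B"
  by (auto simp: pb_functors_def)

lemma pb_hom_cat_simps:
  "Ob (pb_hom_cat A B) = pb_functors A B"
  "\<tau> \<in> Ar (pb_hom_cat A B) \<longleftrightarrow>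
    cartesian_ntrans \<tau> \<and> NSrc \<tau> \<in> pb_functors A B \<and> NTgt \<tau> \<in> pb_functors A B"
  by (auto simp: pb_hom_cat_def)

lemma Ob_pb_hom_cat [simp]: "Ob (pb_hom_cat A B) = pb_functors A B"
  by (rule pb_hom_cat_simps)

lemma pb_hom_cat_arrowD:
  assumes "\<tau> \<in> Ar (pb_hom_cat A B)"
  shows "is_ntrans \<tau>" "cartesian_ntrans \<tau>" "NSrc \<tau> \<in> pb_functors A B" "NTgt \<tau> \<in> pb_functors A B"
    "Src (NSrc \<tau>) = A" "Tgt (NSrc \<tau>) = B" "Src (NTgt \<tau>) = A" "Tgt (NTgt \<tau>) = B"
    "is_functor (NSrc \<tau>)" "is_functor (NTgt \<tau>)" "category A" "category B"
proof -
  have *: "NSrc \<tau> \<in> pb_functors A B" "NTgt \<tau> \<in> pb_functors A B" "cartesian_ntrans \<tau>"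
    using assms by (auto simp: pb_hom_cat_simps)
  show "is_ntrans \<tau>" "cartesian_ntrans \<tau>" "NSrc \<tau> \<in> pb_functors A B" "NTgt \<tau> \<in> pb_functors A B"
    "Src (NSrc \<tau>) = A" "Tgt (NSrc \<tau>) = B" "Src (NTgt \<tau>) = A" "Tgt (NTgt \<tau>) = B"
    "is_functor (NSrc \<tau>)" "is_functor (NTgt \<tau>)" "category A" "category B"
    using * pb_functorsD[OF *(1)] pb_functorsD[OF *(2)] pb_functorsD'[OF *(1)]
    by (auto simp: cartesian_ntrans_def)
qed

lemma pb_hom_cat_Dom_Cod [simp]:
  assumes "\<tau> \<in> Ar (pb_hom_cat A B)"
  shows "Dom (pb_hom_cat A B) \<tau> = NSrc \<tau>" "Cod (pb_hom_cat A B) \<tau> = NTgt \<tau>"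
  using assms by (auto simp: pb_hom_cat_def)

lemma pb_hom_cat_arrowI:
  assumes "is_ntrans \<tau>" "NSrc \<tau> \<in> pb_functors A B" "NTgt \<tau> \<in> pb_functors A B"
    and "\<And>f. f \<in> Ar A \<Longrightarrow>
      is_pullback B (FAr (NSrc \<tau>) f) (Component \<tau> (Dom A f)) (Component \<tau> (Cod A f)) (FAr (NTgt \<tau>) f)"
  shows "\<tau> \<in> Ar (pb_hom_cat A B)"
  using assms cartesian_ntransI[OF assms(1) pb_functorsD(3,4)[OF assms(2)]]
  by (auto simp: pb_hom_cat_simps)

lemma pb_hom_cat_square:
  assumes "\<tau> \<in> Ar (pb_hom_cat A B)" "f \<in> Ar A" "x = Dom A f" "y = Cod A f"
  shows "is_pullback B (FAr (NSrc \<tau>) f) (Component \<tau> x) (Component \<tau> y) (FAr (NTgt \<tau>) f)"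
  using assms cartesian_square[OF pb_hom_cat_arrowD(2,5,6)[OF assms(1)]] by auto

lemma pb_hom_cat_naturality:
  assumes "\<tau> \<in> Ar (pb_hom_cat A B)" "f \<in> Ar A"
  shows "Cmp B (Component \<tau> (Cod A f)) (FAr (NSrc \<tau>) f) = Cmp B (FAr (NTgt \<tau>) f) (Component \<tau> (Dom A f))"
  using assms by (intro ntrans_naturality) (auto simp: pb_hom_cat_arrowD)

lemma id_ntrans_simps [simp]:
  "NSrc (id_ntrans F) = F" "NTgt (id_ntrans F) = F"
  "x \<in> Ob (Src F) \<Longrightarrow> Component (id_ntrans F) x = Ide (Tgt F) (FOb F x)"
  by (auto simp: id_ntrans_def)

lemma comp_ntrans_simps [simp]:
  "NSrc (comp_ntrans \<tau> \<sigma>) = NSrc \<sigma>" "NTgt (comp_ntrans \<tau> \<sigma>) = NTgt \<tau>"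
  "x \<in> Ob (Src (NSrc \<sigma>)) \<Longrightarrow> Tgt (NSrc \<sigma>) = B \<Longrightarrow>
    Component (comp_ntrans \<tau> \<sigma>) x = Cmp B (Component \<tau> x) (Component \<sigma> x)"
  by (auto simp: comp_ntrans_def)

lemma id_ntrans_arrow:
  assumes "F \<in> pb_functors A B"
  shows "id_ntrans F \<in> Ar (pb_hom_cat A B)"
proof (rule pb_hom_cat_arrowI)
  note [simp] = assms pb_functorsD'[OF assms] pb_functorsD[OF assms]
  show "is_ntrans (id_ntrans F)"
    unfolding id_ntrans_def using assms by (intro ntrans_build_ntrans) auto
  fix f
  assume "f \<in> Ar A"
  then show "is_pullback B (FAr (NSrc (id_ntrans F)) f) (Component (id_ntrans F) (Dom A f))
      (Component (id_ntrans F) (Cod A f)) (FAr (NTgt (id_ntrans F)) f)"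
    using pullback_id[of B "FAr F f"] by simp
qed (use assms in auto)

lemma comp_ntrans_is_ntrans:
  assumes "is_ntrans \<tau>" "is_ntrans \<sigma>" "NSrc \<tau> = NTgt \<sigma>"
  shows "is_ntrans (comp_ntrans \<tau> \<sigma>)"
  unfolding comp_ntrans_def
proof (rule ntrans_build_ntrans)
  let ?A = "Src (NSrc \<sigma>)" and ?B = "Tgt (NSrc \<sigma>)"
  have [simp]: "Src (NTgt \<sigma>) = ?A" "Tgt (NTgt \<sigma>) = ?B" "Src (NTgt \<tau>) = ?A" "Tgt (NTgt \<tau>) = ?B"
    using is_ntrans.Src_eq[OF assms(2)] is_ntrans.Tgt_eq[OF assms(2)]
      is_ntrans.Src_eq[OF assms(1)] is_ntrans.Tgt_eq[OF assms(1)] assms(3) by auto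
  note [simp] = assms functor_category[OF NSrc_functor'[OF assms(2)]]
  show "is_functor (NSrc \<sigma>)" "is_functor (NTgt \<tau>)" "?A = Src (NTgt \<tau>)" "?B = Tgt (NTgt \<tau>)"
    using assms by auto
  fix f
  assume f: "f \<in> Ar ?A"
  let ?x = "Dom ?A f" and ?y = "Cod ?A f"
  have "Cmp ?B (Cmp ?B (Component \<tau> ?y) (Component \<sigma> ?y)) (FAr (NSrc \<sigma>) f)
    = Cmp ?B (Component \<tau> ?y) (Cmp ?B (FAr (NTgt \<sigma>) f) (Component \<sigma> ?x))"
    using f ntrans_naturality[of \<sigma> ?A ?B f] by (simp add: Cmp_assoc')
  also have "\<dots> = Cmp ?B (Cmp ?B (Component \<tau> ?y) (FAr (NTgt \<sigma>) f)) (Component \<sigma> ?x)"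
    using f by (simp add: Cmp_assoc')
  also have "\<dots> = Cmp ?B (FAr (NTgt \<tau>) f) (Cmp ?B (Component \<tau> ?x) (Component \<sigma> ?x))"
    using f ntrans_naturality[of \<tau> ?A ?B f] by (simp add: Cmp_assoc')
  finally show "Cmp ?B (Cmp ?B (Component \<tau> ?y) (Component \<sigma> ?y)) (FAr (NSrc \<sigma>) f)
    = Cmp ?B (FAr (NTgt \<tau>) f) (Cmp ?B (Component \<tau> ?x) (Component \<sigma> ?x))" .
next
  fix x
  assume "x \<in> Ob (Src (NSrc \<sigma>))"
  moreover have "Src (NTgt \<sigma>) = Src (NSrc \<sigma>)" "Tgt (NTgt \<sigma>) = Tgt (NSrc \<sigma>)"
    using is_ntrans.Src_eq[OF assms(2)] is_ntrans.Tgt_eq[OF assms(2)] by auto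
  ultimately show "Cmp (Tgt (NSrc \<sigma>)) (Component \<tau> x) (Component \<sigma> x) \<in> Ar (Tgt (NSrc \<sigma>))"
    "Dom (Tgt (NSrc \<sigma>)) (Cmp (Tgt (NSrc \<sigma>)) (Component \<tau> x) (Component \<sigma> x)) = FOb (NSrc \<sigma>) x"
    "Cod (Tgt (NSrc \<sigma>)) (Cmp (Tgt (NSrc \<sigma>)) (Component \<tau> x) (Component \<sigma> x)) = FOb (NTgt \<tau>) x"
    using assms functor_category[OF NSrc_functor'[OF assms(2)]] by auto
qed

lemma comp_ntrans_arrow:
  assumes "\<tau> \<in> Ar (pb_hom_cat A B)" "\<sigma> \<in> Ar (pb_hom_cat A B)" "NSrc \<tau> = NTgt \<sigma>"
  shows "comp_ntrans \<tau> \<sigma> \<in> Ar (pb_hom_cat A B)"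
proof (rule pb_hom_cat_arrowI)
  note [simp] = pb_hom_cat_arrowD[OF assms(1)] pb_hom_cat_arrowD[OF assms(2)] assms(3)
  show "is_ntrans (comp_ntrans \<tau> \<sigma>)"
    using assms by (intro comp_ntrans_is_ntrans) auto
  fix f
  assume f: "f \<in> Ar A"
  have "is_pullback B (FAr (NSrc \<sigma>) f) (Cmp B (Component \<tau> (Dom A f)) (Component \<sigma> (Dom A f)))
      (Cmp B (Component \<tau> (Cod A f)) (Component \<sigma> (Cod A f))) (FAr (NTgt \<tau>) f)"
    using pullback_paste[OF _ pb_hom_cat_square[OF assms(1) f refl refl], of "FAr (NSrc \<sigma>) f"
        "Component \<sigma> (Dom A f)" "Component \<sigma> (Cod A f)"]
      pb_hom_cat_square[OF assms(2) f refl refl] assms(3) by simp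
  then show "is_pullback B (FAr (NSrc (comp_ntrans \<tau> \<sigma>)) f) (Component (comp_ntrans \<tau> \<sigma>) (Dom A f))
      (Component (comp_ntrans \<tau> \<sigma>) (Cod A f)) (FAr (NTgt (comp_ntrans \<tau> \<sigma>)) f)"
    using assms f by simp
qed (use assms pb_hom_cat_arrowD[OF assms(1)] pb_hom_cat_arrowD[OF assms(2)] in auto)

lemma pb_hom_cat_Cmp [simp]:
  "\<tau> \<in> Ar (pb_hom_cat A B) \<Longrightarrow> \<sigma> \<in> Ar (pb_hom_cat A B) \<Longrightarrow> NSrc \<tau> = NTgt \<sigma> \<Longrightarrow>
    Cmp (pb_hom_cat A B) \<tau> \<sigma> = comp_ntrans \<tau> \<sigma>"
  by (auto simp: pb_hom_cat_def)

lemma pb_hom_cat_Ide [simp]: "F \<in> pb_functors A B \<Longrightarrow> Ide (pb_hom_cat A B) F = id_ntrans F"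
  by (auto simp: pb_hom_cat_def)

lemma pb_hom_cat_eqI:
  assumes "\<sigma> \<in> Ar (pb_hom_cat A B)" "\<tau> \<in> Ar (pb_hom_cat A B)" "NSrc \<sigma> = NSrc \<tau>" "NTgt \<sigma> = NTgt \<tau>"
    and "\<And>x. x \<in> Ob A \<Longrightarrow> Component \<sigma> x = Component \<tau> x"
  shows "\<sigma> = \<tau>"
  using assms pb_hom_cat_arrowD[OF assms(1)] pb_hom_cat_arrowD[OF assms(2)]
  by (intro ntrans_eqI) auto

lemma category_pb_hom_cat [simp]: "category (pb_hom_cat A B)"
proof -
  have eq: "{\<tau>. cartesian_ntrans \<tau> \<and> NSrc \<tau> \<in> pb_functors A B \<and> NTgt \<tau> \<in> pb_functors A B} =
    Ar (pb_hom_cat A B)"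
    by (auto simp: pb_hom_cat_simps)
  show ?thesis
  proof (subst pb_hom_cat_def, unfold eq, rule category_build_cat)
    fix \<tau>
    assume t: "\<tau> \<in> Ar (pb_hom_cat A B)"
    note [simp] = t pb_hom_cat_arrowD[OF t]
    show "comp_ntrans \<tau> (id_ntrans (NSrc \<tau>)) = \<tau>"
      by (rule pb_hom_cat_eqI[of _ A B]) (auto intro!: comp_ntrans_arrow id_ntrans_arrow)
    show "comp_ntrans (id_ntrans (NTgt \<tau>)) \<tau> = \<tau>"
      by (rule pb_hom_cat_eqI[of _ A B]) (auto intro!: comp_ntrans_arrow id_ntrans_arrow)
  next
    fix \<rho> \<tau> \<sigma>
    assume t: "\<rho> \<in> Ar (pb_hom_cat A B)" "\<tau> \<in> Ar (pb_hom_cat A B)" "\<sigma> \<in> Ar (pb_hom_cat A B)"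
      "NSrc \<tau> = NTgt \<sigma>" "NSrc \<rho> = NTgt \<tau>"
    note [simp] = t pb_hom_cat_arrowD[OF t(1)] pb_hom_cat_arrowD[OF t(2)] pb_hom_cat_arrowD[OF t(3)]
    show "comp_ntrans \<rho> (comp_ntrans \<tau> \<sigma>) = comp_ntrans (comp_ntrans \<rho> \<tau>) \<sigma>"
      by (rule pb_hom_cat_eqI[of _ A B]) (auto intro!: comp_ntrans_arrow simp: Cmp_assoc')
  qed (auto intro!: comp_ntrans_arrow id_ntrans_arrow simp: pb_hom_cat_arrowD)
qed

section \<open>Pullbacks of cartesian transformations are computed pointwise\<close>

text \<open>
  Preservation of pullbacks descends along a cartesian transformation from its target to its source:
  paste the preserved square with the naturality square over \<open>q\<close>, and cancel the one over \<open>f\<close>.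
\<close>

lemma preserves_pullbacks_along_cartesian:
  assumes \<tau>: "cartesian_ntrans \<tau>" and A: "Src (NSrc \<tau>) = A" and B: "Tgt (NSrc \<tau>) = B"
    and pres: "preserves_pullbacks (NTgt \<tau>)"
  shows "preserves_pullbacks (NSrc \<tau>)"
  unfolding preserves_pullbacks_def A B
proof (intro allI impI)
  fix p q f g
  assume pb: "is_pullback A p q f g"
  let ?P = "NSrc \<tau>" and ?F = "NTgt \<tau>" and ?t = "Component \<tau>"
  have nt: "is_ntrans \<tau>"
    using \<tau> by (simp add: cartesian_ntrans_def)
  have A': "Src ?F = A" "Tgt ?F = B"
    using is_ntrans.Src_eq[OF nt] is_ntrans.Tgt_eq[OF nt] A B by auto
  have cat: "category A" "category B"
    using functor_category[OF NSrc_functor'[OF nt]] A B by auto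
  note [simp] = nt A B A' cat is_pullbackD(1-8)[OF pb]
  have F: "is_pullback B (FAr ?F p) (FAr ?F q) (FAr ?F f) (FAr ?F g)"
    using pres pb A' unfolding preserves_pullbacks_def by auto
  have sq: "is_pullback B (FAr ?P a) (?t (Dom A a)) (?t (Cod A a)) (FAr ?F a)" if "a \<in> Ar A" for a
    using cartesian_square[OF \<tau> A B that] .
  have nat: "Cmp B (?t (Cod A a)) (FAr ?P a) = Cmp B (FAr ?F a) (?t (Dom A a))" if "a \<in> Ar A" for a
    using ntrans_naturality[OF nt A B that] .
  have "is_pullback B (FAr ?P q) (Cmp B (FAr ?F p) (?t (Dom A q))) (Cmp B (FAr ?F g) (?t (Cod A q))) (FAr ?F f)"
    using sq[of q] by - (rule pullback_paste[OF _ is_pullback_swap[OF F]], auto)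
  then have "is_pullback B (FAr ?P q) (Cmp B (?t (Dom A f)) (FAr ?P p)) (Cmp B (?t (Cod A f)) (FAr ?P g)) (FAr ?F f)"
    using nat[of p] nat[of g] by simp
  moreover have "Cmp B (FAr ?P g) (FAr ?P q) = Cmp B (FAr ?P f) (FAr ?P p)"
    using arg_cong[OF is_pullbackD(9)[OF pb], of "FAr ?P"] by simp
  ultimately have "is_pullback B (FAr ?P q) (FAr ?P p) (FAr ?P g) (FAr ?P f)"
    using sq[of f] by - (rule pullback_cancel[of B _ "?t (Dom A f)" "?t (Cod A f)" "FAr ?F f"], auto)
  then show "is_pullback B (FAr ?P p) (FAr ?P q) (FAr ?P f) (FAr ?P g)"
    by (rule is_pullback_swap)
qed

text \<open>A square that is pointwise a pullback is a pullback.\<close>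

lemma pb_hom_cat_pullbackI:
  assumes ar: "\<pi> \<in> Ar (pb_hom_cat A B)" "\<rho> \<in> Ar (pb_hom_cat A B)" "\<sigma> \<in> Ar (pb_hom_cat A B)"
      "\<tau> \<in> Ar (pb_hom_cat A B)"
    and sq: "NSrc \<pi> = NSrc \<rho>" "NTgt \<pi> = NSrc \<sigma>" "NTgt \<rho> = NSrc \<tau>" "NTgt \<sigma> = NTgt \<tau>"
    and pt: "\<And>a. a \<in> Ob A \<Longrightarrow>
      is_pullback B (Component \<pi> a) (Component \<rho> a) (Component \<sigma> a) (Component \<tau> a)"
  shows "is_pullback (pb_hom_cat A B) \<pi> \<rho> \<sigma> \<tau>"
proof (rule is_pullbackI)
  note cat = pb_hom_cat_arrowD(11,12)[OF ar(1)]
  note [simp] = ar sq pb_hom_cat_arrowD[OF ar(1)] pb_hom_cat_arrowD[OF ar(2)]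
    pb_hom_cat_arrowD[OF ar(3)] pb_hom_cat_arrowD[OF ar(4)]
  have cmp: "comp_ntrans \<sigma> \<pi> = comp_ntrans \<tau> \<rho>"
    by (rule pb_hom_cat_eqI[of _ A B]) (auto intro!: comp_ntrans_arrow simp: is_pullbackD(9)[OF pt])
  then show "Cmp (pb_hom_cat A B) \<sigma> \<pi> = Cmp (pb_hom_cat A B) \<tau> \<rho>"
    by simp
  fix h k
  assume "h \<in> Ar (pb_hom_cat A B)" "k \<in> Ar (pb_hom_cat A B)"
    "Dom (pb_hom_cat A B) h = Dom (pb_hom_cat A B) k"
    "Cod (pb_hom_cat A B) h = Dom (pb_hom_cat A B) \<sigma>"
    "Cod (pb_hom_cat A B) k = Dom (pb_hom_cat A B) \<tau>"
    "Cmp (pb_hom_cat A B) \<sigma> h = Cmp (pb_hom_cat A B) \<tau> k"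
  then have hk [simp]: "h \<in> Ar (pb_hom_cat A B)" "k \<in> Ar (pb_hom_cat A B)"
    "NSrc k = NSrc h" "NTgt h = NSrc \<sigma>" "NTgt k = NSrc \<tau>"
    and hk_eq: "comp_ntrans \<sigma> h = comp_ntrans \<tau> k"
    by auto
  note [simp] = pb_hom_cat_arrowD[OF hk(1)] pb_hom_cat_arrowD[OF hk(2)]
  then have eq: "Cmp B (Component \<sigma> a) (Component h a) = Cmp B (Component \<tau> a) (Component k a)"
    if "a \<in> Ob A" for a
    using that arg_cong[OF hk_eq, of "\<lambda>\<theta>. Component \<theta> a"] by simp
  have "\<exists>u. u \<in> Ar B \<and> Dom B u = FOb (NSrc h) a \<and> Cod B u = FOb (NSrc \<pi>) a \<and>
      Cmp B (Component \<pi> a) u = Component h a \<and> Cmp B (Component \<rho> a) u = Component k a"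
    if a: "a \<in> Ob A" for a
    by (rule pullback_lift[OF pt[OF a], of "Component h a" "Component k a"])
      (use a eq in auto)
  then obtain u where u: "\<And>a. a \<in> Ob A \<Longrightarrow> u a \<in> Ar B"
    "\<And>a. a \<in> Ob A \<Longrightarrow> Dom B (u a) = FOb (NSrc h) a"
    "\<And>a. a \<in> Ob A \<Longrightarrow> Cod B (u a) = FOb (NSrc \<pi>) a"
    "\<And>a. a \<in> Ob A \<Longrightarrow> Cmp B (Component \<pi> a) (u a) = Component h a"
    "\<And>a. a \<in> Ob A \<Longrightarrow> Cmp B (Component \<rho> a) (u a) = Component k a"
    by metis
  note [simp] = u(1-3)
  have nat: "Cmp B (u (Cod A f)) (FAr (NSrc h) f) = Cmp B (FAr (NSrc \<pi>) f) (u (Dom A f))"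
    if f [simp]: "f \<in> Ar A" for f
  proof -
    have *: "Cmp B (Component \<theta> (Cod A f)) (Cmp B (u (Cod A f)) (FAr (NSrc h) f)) =
        Cmp B (Component \<theta> (Cod A f)) (Cmp B (FAr (NSrc \<pi>) f) (u (Dom A f)))"
      if \<theta> [simp]: "\<theta> \<in> Ar (pb_hom_cat A B)" "NSrc \<theta> = NSrc \<pi>"
        and l [simp]: "l \<in> Ar (pb_hom_cat A B)" "NSrc l = NSrc h" "NTgt l = NTgt \<theta>"
        and lu: "\<And>a. a \<in> Ob A \<Longrightarrow> Cmp B (Component \<theta> a) (u a) = Component l a" for \<theta> l
    proof -
      note [simp] = pb_hom_cat_arrowD[OF \<theta>(1)] pb_hom_cat_arrowD[OF l(1)]
      have "Cmp B (Component \<theta> (Cod A f)) (Cmp B (u (Cod A f)) (FAr (NSrc h) f)) =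
          Cmp B (Component l (Cod A f)) (FAr (NSrc l) f)"
        using lu[of "Cod A f"] by (simp add: Cmp_assoc'[symmetric])
      also have "\<dots> = Cmp B (FAr (NTgt \<theta>) f) (Cmp B (Component \<theta> (Dom A f)) (u (Dom A f)))"
        using pb_hom_cat_naturality[OF l(1) f] lu[of "Dom A f"] by simp
      also have "\<dots> = Cmp B (Cmp B (Component \<theta> (Cod A f)) (FAr (NSrc \<theta>) f)) (u (Dom A f))"
        using pb_hom_cat_naturality[OF \<theta>(1) f] by (simp add: Cmp_assoc'[symmetric])
      also have "\<dots> = Cmp B (Component \<theta> (Cod A f)) (Cmp B (FAr (NSrc \<pi>) f) (u (Dom A f)))"
        by (simp add: Cmp_assoc')
      finally show ?thesis .
    qed
    show ?thesis
      by (rule pullback_unique[OF cat(2) pt[of "Cod A f"]])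
        (use *[of \<pi> h] *[of \<rho> k] u(4,5) in auto)
  qed
  \<comment> \<open>The pointwise mediating arrows form a cartesian transformation by cancellation against \<open>\<pi>\<close>.\<close>
  define \<mu> where "\<mu> = build_ntrans (NSrc h) (NSrc \<pi>) u"
  have \<mu>_simps [simp]: "NSrc \<mu> = NSrc h" "NTgt \<mu> = NSrc \<pi>" "\<And>a. a \<in> Ob A \<Longrightarrow> Component \<mu> a = u a"
    by (auto simp: \<mu>_def)
  have \<mu> [simp]: "\<mu> \<in> Ar (pb_hom_cat A B)"
  proof (rule pb_hom_cat_arrowI)
    show "is_ntrans \<mu>"
      unfolding \<mu>_def by (intro ntrans_build_ntrans) (auto simp: nat)
    fix f
    assume f [simp]: "f \<in> Ar A"
    have "is_pullback B (FAr (NSrc h) f) (u (Dom A f)) (u (Cod A f)) (FAr (NSrc \<pi>) f)"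
      by (rule pullback_cancel[OF cat(2) pb_hom_cat_square[OF ar(1) f refl refl]])
        (use pb_hom_cat_square[OF hk(1) f refl refl] nat in \<open>auto simp: u(4)\<close>)
    then show "is_pullback B (FAr (NSrc \<mu>) f) (Component \<mu> (Dom A f)) (Component \<mu> (Cod A f)) (FAr (NTgt \<mu>) f)"
      by simp
  qed auto
  note [simp] = pb_hom_cat_arrowD[OF \<mu>]
  have "comp_ntrans \<pi> \<mu> = h" "comp_ntrans \<rho> \<mu> = k"
    by (rule pb_hom_cat_eqI[of _ A B]; auto intro!: comp_ntrans_arrow simp: u(4,5))+
  then show "\<exists>u. u \<in> Ar (pb_hom_cat A B) \<and> Dom (pb_hom_cat A B) u = Dom (pb_hom_cat A B) h \<and>
      Cod (pb_hom_cat A B) u = Dom (pb_hom_cat A B) \<pi> \<and> Cmp (pb_hom_cat A B) \<pi> u = h \<and>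
      Cmp (pb_hom_cat A B) \<rho> u = k"
    by (intro exI[of _ \<mu>]) auto
next
  fix u v
  assume "u \<in> Ar (pb_hom_cat A B)" "v \<in> Ar (pb_hom_cat A B)"
    "Dom (pb_hom_cat A B) u = Dom (pb_hom_cat A B) v"
    "Cod (pb_hom_cat A B) u = Dom (pb_hom_cat A B) \<pi>"
    "Cod (pb_hom_cat A B) v = Dom (pb_hom_cat A B) \<pi>"
    "Cmp (pb_hom_cat A B) \<pi> u = Cmp (pb_hom_cat A B) \<pi> v"
    "Cmp (pb_hom_cat A B) \<rho> u = Cmp (pb_hom_cat A B) \<rho> v"
  then have uv: "u \<in> Ar (pb_hom_cat A B)" "v \<in> Ar (pb_hom_cat A B)"
    "NSrc v = NSrc u" "NTgt u = NSrc \<pi>" "NTgt v = NSrc \<pi>"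
    "comp_ntrans \<pi> u = comp_ntrans \<pi> v" "comp_ntrans \<rho> u = comp_ntrans \<rho> v"
    using ar sq by auto
  note cat = pb_hom_cat_arrowD(11,12)[OF ar(1)]
  note [simp] = pb_hom_cat_arrowD[OF ar(1)] pb_hom_cat_arrowD[OF ar(2)]
    pb_hom_cat_arrowD[OF uv(1)] pb_hom_cat_arrowD[OF uv(2)]
  have "Component u a = Component v a" if a: "a \<in> Ob A" for a
  proof (rule pullback_unique[OF cat(2) pt[OF a]])
    show "Cmp B (Component \<pi> a) (Component u a) = Cmp B (Component \<pi> a) (Component v a)"
      using arg_cong[OF uv(6), of "\<lambda>\<theta>. Component \<theta> a"] a uv(1,2) by simp
    show "Cmp B (Component \<rho> a) (Component u a) = Cmp B (Component \<rho> a) (Component v a)"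
      using arg_cong[OF uv(7), of "\<lambda>\<theta>. Component \<theta> a"] a uv(1,2) by simp
  qed (use uv ar a in auto)
  then show "u = v"
    using uv by (intro pb_hom_cat_eqI) auto
qed (use ar sq in auto)

text \<open>
  A commuting cube between two pullback squares, over \<open>x\<close> and over \<open>y\<close>: if the face joining \<open>tx\<close> to \<open>ty\<close>
  is a pullback, then so is the opposite face, which joins \<open>px\<close> to \<open>py\<close>. So the projections of a
  pointwise pullback of cartesian transformations are cartesian.
\<close>

lemma pullback_cube:
  assumes C: "category C"
    and x: "is_pullback C px qx sx tx" and y: "is_pullback C py qy sy ty"
    and t: "is_pullback C Gf tx ty Hf"
    and ar: "Pf \<in> Ar C" "Ff \<in> Ar C" "Dom C Pf = Dom C px" "Cod C Pf = Dom C py"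
      "Dom C Ff = Cod C px" "Cod C Ff = Cod C py"
    and s: "Cmp C sy Ff = Cmp C Hf sx"
    and p: "Cmp C py Pf = Cmp C Ff px" and q: "Cmp C qy Pf = Cmp C Gf qx"
  shows "is_pullback C Pf px py Ff"
proof -
  \<comment> \<open>\<open>px\<close> is the pullback of \<open>ty\<close> along \<open>Hf \<circ> sx = sy \<circ> Ff\<close>, and \<open>py\<close> the pullback of \<open>ty\<close> along \<open>sy\<close>.\<close>
  have "is_pullback C px (Cmp C Gf qx) (Cmp C Hf sx) ty"
    by (rule pullback_paste[OF C is_pullback_swap[OF t] x])
  then have "is_pullback C px (Cmp C qy Pf) (Cmp C sy Ff) ty"
    using s q by simp
  then have "is_pullback C px Pf Ff py"
    by (rule pullback_cancel[OF C y]) (use ar p is_pullbackD[OF y] in auto)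
  then show ?thesis
    by (rule is_pullback_swap)
qed

lemma pb_hom_cat_pullback_exists:
  assumes \<sigma>: "\<sigma> \<in> Ar (pb_hom_cat A B)" and \<tau>: "\<tau> \<in> Ar (pb_hom_cat A B)" and eq: "NTgt \<sigma> = NTgt \<tau>"
  obtains \<pi> \<rho> where "is_pullback (pb_hom_cat A B) \<pi> \<rho> \<sigma> \<tau>"
    "\<And>a. a \<in> Ob A \<Longrightarrow> is_pullback B (Component \<pi> a) (Component \<rho> a) (Component \<sigma> a) (Component \<tau> a)"
proof -
  let ?F = "NSrc \<sigma>" and ?G = "NSrc \<tau>" and ?H = "NTgt \<sigma>"
  let ?s = "Component \<sigma>" and ?t = "Component \<tau>"
  have cat: "category A" "category B" "has_pullbacks A" "has_pullbacks B"
    using pb_functorsD'[OF pb_hom_cat_arrowD(3)[OF \<sigma>]] by auto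
  note [simp] = \<sigma> \<tau> eq[symmetric] cat pb_hom_cat_arrowD[OF \<sigma>] pb_hom_cat_arrowD[OF \<tau>]
  have "\<exists>p q. is_pullback B p q (?s a) (?t a)" if "a \<in> Ob A" for a
    using has_pullbacksE[OF cat(4), of "?s a" "?t a"] that by auto metis
  then obtain p q where pq: "\<And>a. a \<in> Ob A \<Longrightarrow> is_pullback B (p a) (q a) (?s a) (?t a)"
    by metis
  have [simp]: "p a \<in> Ar B" "q a \<in> Ar B" "Cod B (p a) = FOb ?F a" "Cod B (q a) = FOb ?G a"
    "Dom B (q a) = Dom B (p a)" if "a \<in> Ob A" for a
    using is_pullbackD[OF pq[OF that]] that by auto
  have "\<exists>u. u \<in> Ar B \<and> Dom B u = Dom B (p (Dom A f)) \<and> Cod B u = Dom B (p (Cod A f)) \<and>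
      Cmp B (p (Cod A f)) u = Cmp B (FAr ?F f) (p (Dom A f)) \<and>
      Cmp B (q (Cod A f)) u = Cmp B (FAr ?G f) (q (Dom A f))" if f [simp]: "f \<in> Ar A" for f
  proof -
    have "Cmp B (?s (Cod A f)) (Cmp B (FAr ?F f) (p (Dom A f))) =
        Cmp B (FAr ?H f) (Cmp B (?s (Dom A f)) (p (Dom A f)))"
      using pb_hom_cat_naturality[OF \<sigma> f] by (simp add: Cmp_assoc'[symmetric])
    also have "\<dots> = Cmp B (Cmp B (FAr ?H f) (?t (Dom A f))) (q (Dom A f))"
      using is_pullbackD(9)[OF pq[of "Dom A f"]] by (simp add: Cmp_assoc')
    also have "\<dots> = Cmp B (?t (Cod A f)) (Cmp B (FAr ?G f) (q (Dom A f)))"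
      using pb_hom_cat_naturality[OF \<tau> f] by (simp add: Cmp_assoc'[symmetric])
    finally show ?thesis
      using pullback_lift[OF pq[of "Cod A f"], of "Cmp B (FAr ?F f) (p (Dom A f))"
          "Cmp B (FAr ?G f) (q (Dom A f))"] by auto
  qed
  then obtain u where u: "\<And>f. f \<in> Ar A \<Longrightarrow> u f \<in> Ar B"
    "\<And>f. f \<in> Ar A \<Longrightarrow> Dom B (u f) = Dom B (p (Dom A f))"
    "\<And>f. f \<in> Ar A \<Longrightarrow> Cod B (u f) = Dom B (p (Cod A f))"
    "\<And>f. f \<in> Ar A \<Longrightarrow> Cmp B (p (Cod A f)) (u f) = Cmp B (FAr ?F f) (p (Dom A f))"
    "\<And>f. f \<in> Ar A \<Longrightarrow> Cmp B (q (Cod A f)) (u f) = Cmp B (FAr ?G f) (q (Dom A f))"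
    by metis
  note [simp] = u(1-3)
  define P where "P = build_func A B (\<lambda>a. Dom B (p a)) u"
  have P [simp]: "Src P = A" "Tgt P = B" "\<And>a. a \<in> Ob A \<Longrightarrow> FOb P a = Dom B (p a)"
    "\<And>f. f \<in> Ar A \<Longrightarrow> FAr P f = u f"
    by (auto simp: P_def)
  have P_functor [simp]: "is_functor P"
    unfolding P_def
  proof (rule functor_build_func)
    fix x
    assume x [simp]: "x \<in> Ob A"
    show "u (Ide A x) = Ide B (Dom B (p x))"
      by (rule pullback_unique[OF cat(2) pq[OF x]])
        (use u(4)[of "Ide A x"] u(5)[of "Ide A x"] in auto)
  next
    fix g f
    assume f [simp]: "f \<in> Ar A" "g \<in> Ar A" "Dom A g = Cod A f"
    have "Cmp B (p (Cod A g)) (Cmp B (u g) (u f)) = Cmp B (FAr ?F g) (Cmp B (p (Dom A g)) (u f))"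
      using u(4)[of g] by (simp add: Cmp_assoc'[symmetric])
    also have "\<dots> = Cmp B (p (Cod A g)) (u (Cmp A g f))"
      using u(4)[of f] u(4)[of "Cmp A g f"] by (simp add: Cmp_assoc')
    finally have 1: "Cmp B (p (Cod A g)) (Cmp B (u g) (u f)) = Cmp B (p (Cod A g)) (u (Cmp A g f))" .
    have "Cmp B (q (Cod A g)) (Cmp B (u g) (u f)) = Cmp B (FAr ?G g) (Cmp B (q (Dom A g)) (u f))"
      using u(5)[of g] by (simp add: Cmp_assoc'[symmetric])
    also have "\<dots> = Cmp B (q (Cod A g)) (u (Cmp A g f))"
      using u(5)[of f] u(5)[of "Cmp A g f"] by (simp add: Cmp_assoc')
    finally have 2: "Cmp B (q (Cod A g)) (Cmp B (u g) (u f)) = Cmp B (q (Cod A g)) (u (Cmp A g f))" .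
    show "u (Cmp A g f) = Cmp B (u g) (u f)"
      by (rule pullback_unique[OF cat(2) pq[of "Cod A g"]]) (use 1 2 in auto)
  qed auto
  define \<pi> where "\<pi> = build_ntrans P ?F p"
  define \<rho> where "\<rho> = build_ntrans P ?G q"
  have \<pi>_simps [simp]: "NSrc \<pi> = P" "NTgt \<pi> = ?F" "\<And>a. a \<in> Ob A \<Longrightarrow> Component \<pi> a = p a"
    by (auto simp: \<pi>_def)
  have \<rho>_simps [simp]: "NSrc \<rho> = P" "NTgt \<rho> = ?G" "\<And>a. a \<in> Ob A \<Longrightarrow> Component \<rho> a = q a"
    by (auto simp: \<rho>_def)
  have nt: "is_ntrans \<pi>" "is_ntrans \<rho>"
    unfolding \<pi>_def \<rho>_def by (intro ntrans_build_ntrans; simp add: u(4,5))+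
  have sq1: "is_pullback B (u f) (p (Dom A f)) (p (Cod A f)) (FAr ?F f)" if f: "f \<in> Ar A" for f
    using f u(4,5)[OF f] pb_hom_cat_square[OF \<tau> f refl refl] pb_hom_cat_naturality[OF \<sigma> f]
    by - (rule pullback_cube[OF cat(2) pq[of "Dom A f"] pq[of "Cod A f"], of "FAr ?G f" "FAr ?H f"], auto)
  have sq2: "is_pullback B (u f) (q (Dom A f)) (q (Cod A f)) (FAr ?G f)" if f: "f \<in> Ar A" for f
    using f u(4,5)[OF f] pb_hom_cat_square[OF \<sigma> f refl refl] pb_hom_cat_naturality[OF \<tau> f]
    by - (rule pullback_cube[OF cat(2) is_pullback_swap[OF pq[of "Dom A f"]]
          is_pullback_swap[OF pq[of "Cod A f"]], of "FAr ?F f" "FAr ?H f"],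
        auto intro: is_pullback_swap)
  have "cartesian_ntrans \<pi>"
    using nt sq1 by (intro cartesian_ntransI[of \<pi> A B]) auto
  then have "preserves_pullbacks P"
    using preserves_pullbacks_along_cartesian[of \<pi> A B] pb_functorsD(1)[OF pb_hom_cat_arrowD(3)[OF \<sigma>]]
    by (auto simp: pb_functor_def)
  then have PP [simp]: "P \<in> pb_functors A B"
    by (auto simp: pb_functors_def pb_functor_def)
  have "\<pi> \<in> Ar (pb_hom_cat A B)" "\<rho> \<in> Ar (pb_hom_cat A B)"
    using nt sq1 sq2 by (auto intro!: pb_hom_cat_arrowI)
  then have "is_pullback (pb_hom_cat A B) \<pi> \<rho> \<sigma> \<tau>"
    using pq by (intro pb_hom_cat_pullbackI) auto
  then show ?thesis
    by (rule that) (use pq in auto)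
qed

text \<open>A pullback in \<open>[A,B]\<^sub>p\<^sub>b\<close> is pointwise, being isomorphic to the pointwise one.\<close>

lemma pb_hom_cat_pullbackD:
  assumes pb: "is_pullback (pb_hom_cat A B) \<pi> \<rho> \<sigma> \<tau>" and a: "a \<in> Ob A"
  shows "is_pullback B (Component \<pi> a) (Component \<rho> a) (Component \<sigma> a) (Component \<tau> a)"
proof -
  note ar [simp] = is_pullbackD(1-4)[OF pb]
  have eq: "NTgt \<sigma> = NTgt \<tau>"
    using is_pullbackD(8)[OF pb] by simp
  obtain \<pi>' \<rho>' where pb': "is_pullback (pb_hom_cat A B) \<pi>' \<rho>' \<sigma> \<tau>"
    "is_pullback B (Component \<pi>' a) (Component \<rho>' a) (Component \<sigma> a) (Component \<tau> a)"
    using pb_hom_cat_pullback_exists[OF ar(3,4) eq] a by metis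
  have cat: "category A" "category B"
    using pb_functorsD'[OF pb_hom_cat_arrowD(3)[OF ar(1)]] by auto
  note ar' [simp] = is_pullbackD(1,2)[OF pb'(1)]
  note [simp] = cat a pb_hom_cat_arrowD[OF ar(1)] pb_hom_cat_arrowD[OF ar(2)]
    pb_hom_cat_arrowD[OF ar'(1)] pb_hom_cat_arrowD[OF ar'(2)]
  obtain e e' where e: "e \<in> Ar (pb_hom_cat A B)" "e' \<in> Ar (pb_hom_cat A B)"
    "NSrc e = NSrc \<pi>" "NTgt e = NSrc \<pi>'" "NSrc e' = NSrc \<pi>'" "NTgt e' = NSrc \<pi>"
    "comp_ntrans e e' = id_ntrans (NTgt e)" "comp_ntrans e' e = id_ntrans (NSrc e)"
    "comp_ntrans \<pi>' e = \<pi>" "comp_ntrans \<rho>' e = \<rho>"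
    using is_pullbackD(5)[OF pb'(1)]
    by - (rule pullback_comparison[OF category_pb_hom_cat pb'(1) pb], auto)
  note [simp] = e(1-6) pb_hom_cat_arrowD[OF e(1)] pb_hom_cat_arrowD[OF e(2)]
  have "is_pullback B (Cmp B (Component \<pi>' a) (Component e a)) (Cmp B (Component \<rho>' a) (Component e a))
      (Component \<sigma> a) (Component \<tau> a)"
  proof (rule pullback_iso[OF cat(2) pb'(2), of _ "Component e' a"])
    show "Cmp B (Component e a) (Component e' a) = Ide B (Cod B (Component e a))"
      using arg_cong[OF e(7), of "\<lambda>\<theta>. Component \<theta> a"] by simp
    show "Cmp B (Component e' a) (Component e a) = Ide B (Dom B (Component e a))"
      using arg_cong[OF e(8), of "\<lambda>\<theta>. Component \<theta> a"] by simp
  qed auto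
  moreover have "Cmp B (Component \<pi>' a) (Component e a) = Component \<pi> a"
    using arg_cong[OF e(9), of "\<lambda>\<theta>. Component \<theta> a"] by simp
  moreover have "Cmp B (Component \<rho>' a) (Component e a) = Component \<rho> a"
    using arg_cong[OF e(10), of "\<lambda>\<theta>. Component \<theta> a"] by simp
  ultimately show ?thesis
    by simp
qed

lemma has_pullbacks_pb_hom_cat [simp]: "has_pullbacks (pb_hom_cat A B)"
  unfolding has_pullbacks_def
proof (intro ballI impI)
  fix \<sigma> \<tau>
  assume *: "\<sigma> \<in> Ar (pb_hom_cat A B)" "\<tau> \<in> Ar (pb_hom_cat A B)"
    "Cod (pb_hom_cat A B) \<sigma> = Cod (pb_hom_cat A B) \<tau>"
  show "\<exists>\<pi> \<rho>. is_pullback (pb_hom_cat A B) \<pi> \<rho> \<sigma> \<tau>"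
    by (rule pb_hom_cat_pullback_exists[OF *(1,2)]) (use * in auto)
qed

section \<open>Evaluation, coevaluation and postcomposition\<close>

lemma eval_func_simps [simp]:
  "Src (eval_func A B) = prod_cat (pb_hom_cat A B) A" "Tgt (eval_func A B) = B"
  "F \<in> pb_functors A B \<Longrightarrow> x \<in> Ob A \<Longrightarrow> FOb (eval_func A B) (F, x) = FOb F x"
  "\<tau> \<in> Ar (pb_hom_cat A B) \<Longrightarrow> f \<in> Ar A \<Longrightarrow>
    FAr (eval_func A B) (\<tau>, f) = Cmp B (FAr (NTgt \<tau>) f) (Component \<tau> (Dom A f))"
  by (auto simp: eval_func_def)

lemma functor_eval_func:
  assumes cat [simp]: "category A" "category B"
  shows "is_functor (eval_func A B)"
  unfolding eval_func_def
proof (rule functor_build_func)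
  fix a b
  assume ab: "a \<in> Ar (prod_cat (pb_hom_cat A B) A)" "b \<in> Ar (prod_cat (pb_hom_cat A B) A)"
    "Dom (prod_cat (pb_hom_cat A B) A) b = Cod (prod_cat (pb_hom_cat A B) A) a"
  obtain \<sigma> f \<tau> g where eq: "a = (\<sigma>, f)" "b = (\<tau>, g)"
    by (cases a, cases b)
  have [simp]: "\<sigma> \<in> Ar (pb_hom_cat A B)" "\<tau> \<in> Ar (pb_hom_cat A B)" "f \<in> Ar A" "g \<in> Ar A"
    using ab eq by auto
  have [simp]: "NSrc \<tau> = NTgt \<sigma>" "Dom A g = Cod A f"
    using ab eq by auto
  note [simp] = pb_hom_cat_arrowD[of \<sigma> A B] pb_hom_cat_arrowD[of \<tau> A B]
  let ?x = "Dom A f" and ?y = "Cod A f" and ?H = "NTgt \<tau>" and ?G = "NTgt \<sigma>"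
  have "Cmp B (FAr ?H (Cmp A g f)) (Cmp B (Component \<tau> ?x) (Component \<sigma> ?x)) =
      Cmp B (FAr ?H g) (Cmp B (Cmp B (FAr ?H f) (Component \<tau> ?x)) (Component \<sigma> ?x))"
    by (simp add: Cmp_assoc')
  also have "\<dots> = Cmp B (Cmp B (FAr ?H g) (Component \<tau> ?y)) (Cmp B (FAr ?G f) (Component \<sigma> ?x))"
    using pb_hom_cat_naturality[of \<tau> A B f, symmetric] by (simp add: Cmp_assoc')
  finally show "(case Cmp (prod_cat (pb_hom_cat A B) A) b a of
        (\<tau>, f) \<Rightarrow> Cmp B (FAr (NTgt \<tau>) f) (Component \<tau> (Dom A f))) =
      Cmp B (case b of (\<tau>, f) \<Rightarrow> Cmp B (FAr (NTgt \<tau>) f) (Component \<tau> (Dom A f)))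
        (case a of (\<tau>, f) \<Rightarrow> Cmp B (FAr (NTgt \<tau>) f) (Component \<tau> (Dom A f)))"
    by (simp add: eq)
next
  fix a
  assume "a \<in> Ar (prod_cat (pb_hom_cat A B) A)"
  then obtain \<sigma> f where eq: "a = (\<sigma>, f)" "\<sigma> \<in> Ar (pb_hom_cat A B)" "f \<in> Ar A"
    by auto
  note [simp] = eq pb_hom_cat_arrowD[OF eq(2)]
  show "(case a of (\<tau>, f) \<Rightarrow> Cmp B (FAr (NTgt \<tau>) f) (Component \<tau> (Dom A f))) \<in> Ar B"
    "Dom B (case a of (\<tau>, f) \<Rightarrow> Cmp B (FAr (NTgt \<tau>) f) (Component \<tau> (Dom A f))) =
      (case Dom (prod_cat (pb_hom_cat A B) A) a of (F, x) \<Rightarrow> FOb F x)"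
    "Cod B (case a of (\<tau>, f) \<Rightarrow> Cmp B (FAr (NTgt \<tau>) f) (Component \<tau> (Dom A f))) =
      (case Cod (prod_cat (pb_hom_cat A B) A) a of (F, x) \<Rightarrow> FOb F x)"
    by auto
qed (auto simp: pb_functorsD)

lemma pb_functor_eval_func:
  assumes cat: "category A" "category B" and hp: "has_pullbacks A" "has_pullbacks B"
  shows "pb_functor (eval_func A B)"
proof (rule pb_functorI)
  show "is_functor (eval_func A B)"
    by (rule functor_eval_func[OF cat])
  fix p q f g
  assume pb: "is_pullback (Src (eval_func A B)) p q f g"
  obtain \<pi> p' \<rho> q' \<sigma> s' \<tau> t' where eq: "p = (\<pi>, p')" "q = (\<rho>, q')" "f = (\<sigma>, s')" "g = (\<tau>, t')"
    by (cases p, cases q, cases f, cases g)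
  have 1: "is_pullback (pb_hom_cat A B) \<pi> \<rho> \<sigma> \<tau>" and 2: "is_pullback A p' q' s' t'"
    using is_pullback_prod_catD[of "pb_hom_cat A B" A \<pi> p' \<rho> q' \<sigma> s' \<tau> t'] pb eq cat by auto
  note ar [simp] = is_pullbackD(1-4)[OF 1]
  note [simp] = cat pb_hom_cat_arrowD[OF ar(1)] pb_hom_cat_arrowD[OF ar(2)]
    pb_hom_cat_arrowD[OF ar(3)] pb_hom_cat_arrowD[OF ar(4)] is_pullbackD(1-8)[OF 2]
  have [simp]: "NSrc \<pi> = NSrc \<rho>" "NTgt \<pi> = NSrc \<sigma>" "NTgt \<rho> = NSrc \<tau>" "NTgt \<sigma> = NTgt \<tau>"
    using is_pullbackD(5-8)[OF 1] by auto
  let ?F = "NSrc \<sigma>" and ?G = "NSrc \<tau>" and ?H = "NTgt \<tau>"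
  let ?w = "Dom A q'" and ?x = "Dom A s'" and ?y = "Dom A t'"
  \<comment> \<open>The square is pasted from four: a pointwise pullback, two cartesian naturality squares and the
     image of a pullback in \<open>A\<close> under the common target of \<open>\<sigma>\<close> and \<open>\<tau>\<close>.\<close>
  have H: "is_pullback B (FAr ?H p') (FAr ?H q') (FAr ?H s') (FAr ?H t')"
    using pb_functorD(4)[OF pb_functorsD(1)[OF pb_hom_cat_arrowD(4)[OF ar(4)]], of p' q' s' t'] 2 by simp
  have s: "is_pullback B (FAr ?F p') (Component \<sigma> ?w) (Component \<sigma> ?x) (FAr ?H p')"
    using pb_hom_cat_square[OF ar(3), of p' ?w ?x] by simp
  have t: "is_pullback B (FAr ?G q') (Component \<tau> ?w) (Component \<tau> ?y) (FAr ?H q')"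
    using pb_hom_cat_square[OF ar(4), of q' ?w ?y] by simp
  have w: "is_pullback B (Component \<pi> ?w) (Component \<rho> ?w) (Component \<sigma> ?w) (Component \<tau> ?w)"
    by (rule pb_hom_cat_pullbackD[OF 1]) auto
  have a: "is_pullback B (Cmp B (FAr ?H q') (Component \<sigma> ?w)) (FAr ?F p')
      (FAr ?H t') (Cmp B (FAr ?H s') (Component \<sigma> ?x))"
    by (rule is_pullback_swap[OF pullback_paste[OF cat(2) H s]])
  have b: "is_pullback B (Cmp B (FAr ?G q') (Component \<rho> ?w)) (Component \<pi> ?w)
      (Component \<tau> ?y) (Cmp B (FAr ?H q') (Component \<sigma> ?w))"
    by (rule is_pullback_swap[OF pullback_paste[OF cat(2) is_pullback_swap[OF t] w]])
  have "is_pullback B (Cmp B (FAr ?F p') (Component \<pi> ?w)) (Cmp B (FAr ?G q') (Component \<rho> ?w))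
      (Cmp B (FAr ?H s') (Component \<sigma> ?x)) (Cmp B (FAr ?H t') (Component \<tau> ?y))"
    by (rule is_pullback_swap[OF pullback_paste[OF cat(2) a b]])
  then show "is_pullback (Tgt (eval_func A B)) (FAr (eval_func A B) p) (FAr (eval_func A B) q)
      (FAr (eval_func A B) f) (FAr (eval_func A B) g)"
    by (simp add: eq)
qed (use cat hp in auto)

text \<open>The natural transformation \<open>(b, -) \<Rightarrow> (b', -)\<close> induced by \<open>f : b \<rightarrow> b'\<close>.\<close>

definition pair_ntrans ::
  "('o, 'a) cat \<Rightarrow> ('p, 'b) cat \<Rightarrow> 'b \<Rightarrow> ('o, 'a, 'p \<times> 'o, 'b \<times> 'a) ntrans"
  where "pair_ntrans A B f =
    build_ntrans (pair_func A B (Dom B f)) (pair_func A B (Cod B f)) (\<lambda>x. (f, Ide A x))"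

lemma pair_ntrans_simps [simp]:
  "NSrc (pair_ntrans A B f) = pair_func A B (Dom B f)"
  "NTgt (pair_ntrans A B f) = pair_func A B (Cod B f)"
  "x \<in> Ob A \<Longrightarrow> Component (pair_ntrans A B f) x = (f, Ide A x)"
  by (auto simp: pair_ntrans_def)

lemma pair_func_pb_functors:
  assumes "category A" "category B" "has_pullbacks A" "has_pullbacks B" "b \<in> Ob B"
  shows "pair_func A B b \<in> pb_functors A (prod_cat B A)"
  using assms by (intro pb_functorsI) auto

lemma pair_ntrans_arrow:
  assumes "category A" "category B" "has_pullbacks A" "has_pullbacks B" "f \<in> Ar B"
  shows "pair_ntrans A B f \<in> Ar (pb_hom_cat A (prod_cat B A))"
proof (rule pb_hom_cat_arrowI)
  have [simp]: "is_functor (pair_func A B b)" if "b \<in> Ob B" for b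
    using pb_functorD(1)[of "pair_func A B b"] that assms by auto
  show "is_ntrans (pair_ntrans A B f)"
    unfolding pair_ntrans_def using assms by (intro ntrans_build_ntrans) auto
  show "NSrc (pair_ntrans A B f) \<in> pb_functors A (prod_cat B A)"
    "NTgt (pair_ntrans A B f) \<in> pb_functors A (prod_cat B A)"
    using assms by (auto intro: pair_func_pb_functors)
  fix g
  assume "g \<in> Ar A"
  then show "is_pullback (prod_cat B A) (FAr (NSrc (pair_ntrans A B f)) g)
      (Component (pair_ntrans A B f) (Dom A g)) (Component (pair_ntrans A B f) (Cod A g))
      (FAr (NTgt (pair_ntrans A B f)) g)"
    using assms is_pullback_prod_catI[OF assms(2,1) is_pullback_swap[OF pullback_id] pullback_id, of f g]
    by simp
qed

lemma coeval_func_simps [simp]: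
  "Src (coeval_func A B) = B" "Tgt (coeval_func A B) = pb_hom_cat A (prod_cat B A)"
  "b \<in> Ob B \<Longrightarrow> FOb (coeval_func A B) b = pair_func A B b"
  "f \<in> Ar B \<Longrightarrow> FAr (coeval_func A B) f = pair_ntrans A B f"
  by (auto simp: coeval_func_def pair_ntrans_def)

lemma pb_functor_coeval_func:
  assumes "category A" "category B" "has_pullbacks A" "has_pullbacks B"
  shows "pb_functor (coeval_func A B)"
proof (rule pb_functorI)
  note [simp] = assms pair_func_pb_functors[OF assms] pair_ntrans_arrow[OF assms]
  have [simp]: "is_functor (pair_func A B b)" if "b \<in> Ob B" for b
    using pb_functorD(1)[of "pair_func A B b"] that assms by auto
  show "is_functor (coeval_func A B)"
    unfolding coeval_func_def pair_ntrans_def[symmetric]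
  proof (rule functor_build_func)
    fix b
    assume "b \<in> Ob B"
    then show "pair_ntrans A B (Ide B b) = Ide (pb_hom_cat A (prod_cat B A)) (pair_func A B b)"
      by simp (rule pb_hom_cat_eqI[of _ A "prod_cat B A"]; auto intro: id_ntrans_arrow)
  next
    fix f g
    assume fg: "f \<in> Ar B" "g \<in> Ar B" "Dom B g = Cod B f"
    then show "pair_ntrans A B (Cmp B g f) =
        Cmp (pb_hom_cat A (prod_cat B A)) (pair_ntrans A B g) (pair_ntrans A B f)"
      by simp (rule pb_hom_cat_eqI[of _ A "prod_cat B A"]; auto intro!: comp_ntrans_arrow)
  qed auto
  fix p q f g
  assume pb: "is_pullback (Src (coeval_func A B)) p q f g"
  then have pb: "is_pullback B p q f g"
    by simp
  have "is_pullback (pb_hom_cat A (prod_cat B A)) (pair_ntrans A B p) (pair_ntrans A B q)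
      (pair_ntrans A B f) (pair_ntrans A B g)"
  proof (rule pb_hom_cat_pullbackI)
    fix a
    assume "a \<in> Ob A"
    moreover from this have "is_pullback A (Ide A a) (Ide A a) (Ide A a) (Ide A a)"
      using pullback_id[of A "Ide A a"] by simp
    ultimately show "is_pullback (prod_cat B A) (Component (pair_ntrans A B p) a)
        (Component (pair_ntrans A B q) a) (Component (pair_ntrans A B f) a) (Component (pair_ntrans A B g) a)"
      using is_pullback_prod_catI[OF assms(2,1) pb] by simp
  qed (use is_pullbackD[OF pb] in auto)
  then show "is_pullback (Tgt (coeval_func A B)) (FAr (coeval_func A B) p) (FAr (coeval_func A B) q)
      (FAr (coeval_func A B) f) (FAr (coeval_func A B) g)"
    using is_pullbackD(1-4)[OF pb] by simp
qed (use assms in auto)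

lemma whisker_simps [simp]:
  "NSrc (whisker F \<tau>) = F \<circ>\<^sub>F NSrc \<tau>" "NTgt (whisker F \<tau>) = F \<circ>\<^sub>F NTgt \<tau>"
  "x \<in> Ob (Src (NSrc \<tau>)) \<Longrightarrow> Component (whisker F \<tau>) x = FAr F (Component \<tau> x)"
  by (auto simp: whisker_def)

lemma postcomp_simps [simp]:
  "Src (postcomp A F) = pb_hom_cat A (Src F)" "Tgt (postcomp A F) = pb_hom_cat A (Tgt F)"
  "G \<in> pb_functors A (Src F) \<Longrightarrow> FOb (postcomp A F) G = F \<circ>\<^sub>F G"
  "\<tau> \<in> Ar (pb_hom_cat A (Src F)) \<Longrightarrow> FAr (postcomp A F) \<tau> = whisker F \<tau>"
  by (auto simp: postcomp_def)

lemma comp_func_pb_functors: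
  assumes "pb_functor F" "G \<in> pb_functors A (Src F)"
  shows "F \<circ>\<^sub>F G \<in> pb_functors A (Tgt F)"
  using assms pb_functorsD[OF assms(2)] by (auto intro!: pb_functorsI)

lemma whisker_arrow:
  assumes F: "pb_functor F" and \<tau>: "\<tau> \<in> Ar (pb_hom_cat A (Src F))"
  shows "whisker F \<tau> \<in> Ar (pb_hom_cat A (Tgt F))"
proof (rule pb_hom_cat_arrowI)
  note [simp] = pb_functorD(1)[OF F] \<tau> pb_hom_cat_arrowD[OF \<tau>]
  show "is_ntrans (whisker F \<tau>)"
    unfolding whisker_def
  proof (rule ntrans_build_ntrans)
    fix f
    assume "f \<in> Ar (Src (F \<circ>\<^sub>F NSrc \<tau>))"
    then have [simp]: "f \<in> Ar A"
      by simp
    show "Cmp (Tgt (F \<circ>\<^sub>F NSrc \<tau>)) (FAr F (Component \<tau> (Cod (Src (F \<circ>\<^sub>F NSrc \<tau>)) f))) (FAr (F \<circ>\<^sub>F NSrc \<tau>) f) =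
        Cmp (Tgt (F \<circ>\<^sub>F NSrc \<tau>)) (FAr (F \<circ>\<^sub>F NTgt \<tau>) f) (FAr F (Component \<tau> (Dom (Src (F \<circ>\<^sub>F NSrc \<tau>)) f)))"
      using arg_cong[OF pb_hom_cat_naturality[OF \<tau>, of f], of "FAr F"] by simp
  qed auto
  show "NSrc (whisker F \<tau>) \<in> pb_functors A (Tgt F)" "NTgt (whisker F \<tau>) \<in> pb_functors A (Tgt F)"
    using F by (auto intro: comp_func_pb_functors)
  fix f
  assume "f \<in> Ar A"
  then show "is_pullback (Tgt F) (FAr (NSrc (whisker F \<tau>)) f) (Component (whisker F \<tau>) (Dom A f))
      (Component (whisker F \<tau>) (Cod A f)) (FAr (NTgt (whisker F \<tau>)) f)"
    using pb_functorD(4)[OF F pb_hom_cat_square[OF \<tau>, of f "Dom A f" "Cod A f"]] by simp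
qed

lemma whisker_id_ntrans:
  assumes F: "pb_functor F" and G: "G \<in> pb_functors A (Src F)"
  shows "whisker F (id_ntrans G) = id_ntrans (F \<circ>\<^sub>F G)"
proof (rule pb_hom_cat_eqI)
  note [simp] = pb_functorD(1)[OF F] pb_functorsD[OF G]
  show "whisker F (id_ntrans G) \<in> Ar (pb_hom_cat A (Tgt F))"
    by (intro whisker_arrow F id_ntrans_arrow G)
  show "id_ntrans (F \<circ>\<^sub>F G) \<in> Ar (pb_hom_cat A (Tgt F))"
    by (intro comp_func_pb_functors F id_ntrans_arrow G)
qed (use pb_functorD(1)[OF F] pb_functorsD[OF G] in auto)

lemma whisker_comp_ntrans:
  assumes F: "pb_functor F" and \<tau>: "\<tau> \<in> Ar (pb_hom_cat A (Src F))"
    and \<sigma>: "\<sigma> \<in> Ar (pb_hom_cat A (Src F))" and eq: "NSrc \<tau> = NTgt \<sigma>"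
  shows "whisker F (comp_ntrans \<tau> \<sigma>) = comp_ntrans (whisker F \<tau>) (whisker F \<sigma>)"
proof (rule pb_hom_cat_eqI)
  show "whisker F (comp_ntrans \<tau> \<sigma>) \<in> Ar (pb_hom_cat A (Tgt F))"
    by (intro whisker_arrow F comp_ntrans_arrow \<tau> \<sigma> eq)
  show "comp_ntrans (whisker F \<tau>) (whisker F \<sigma>) \<in> Ar (pb_hom_cat A (Tgt F))"
    by (intro whisker_arrow F comp_ntrans_arrow \<tau> \<sigma>) (simp add: eq)
qed (use pb_functorD(1)[OF F] pb_hom_cat_arrowD[OF \<tau>] pb_hom_cat_arrowD[OF \<sigma>] eq in auto)

lemma pb_functor_postcomp:
  assumes F: "pb_functor F"
  shows "pb_functor (postcomp A F)"
proof (rule pb_functorI)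
  note [simp] = pb_functorD(1)[OF F] whisker_arrow[OF F] comp_func_pb_functors[OF F]
  show "is_functor (postcomp A F)"
    unfolding postcomp_def
    by (rule functor_build_func) (auto simp: whisker_id_ntrans[OF F] whisker_comp_ntrans[OF F] pb_hom_cat_arrowD)
  fix p q f g
  assume "is_pullback (Src (postcomp A F)) p q f g"
  then have pb: "is_pullback (pb_hom_cat A (Src F)) p q f g"
    by simp
  note ar [simp] = is_pullbackD(1-4)[OF pb]
  note [simp] = pb_hom_cat_arrowD[OF ar(1)] pb_hom_cat_arrowD[OF ar(2)]
    pb_hom_cat_arrowD[OF ar(3)] pb_hom_cat_arrowD[OF ar(4)]
  have "is_pullback (pb_hom_cat A (Tgt F)) (whisker F p) (whisker F q) (whisker F f) (whisker F g)"
    by (rule pb_hom_cat_pullbackI)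
      (use is_pullbackD(5-8)[OF pb] in \<open>auto intro!: pb_functorD(4)[OF F] pb_hom_cat_pullbackD[OF pb]\<close>)
  then show "is_pullback (Tgt (postcomp A F)) (FAr (postcomp A F) p) (FAr (postcomp A F) q)
      (FAr (postcomp A F) f) (FAr (postcomp A F) g)"
    by simp
qed auto

section \<open>Isomorphic copies of categories\<close>

lemma pb_functor_isoI:
  assumes F: "is_functor F" and G: "is_functor G" and st: "Src G = Tgt F" "Tgt G = Src F"
    and GF: "G \<circ>\<^sub>F F = id_func (Src F)" and FG: "F \<circ>\<^sub>F G = id_func (Tgt F)"
    and hp: "has_pullbacks (Src F)"
  shows "pb_functor F"
proof -
  have GF_Ar: "FAr G (FAr F f) = f" if "f \<in> Ar (Src F)" for f
    using comp_func_simps(4)[of f F G] that by (simp add: GF)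
  have GF_Ob: "FOb G (FOb F x) = x" if "x \<in> Ob (Src F)" for x
    using comp_func_simps(3)[of x F G] that by (simp add: GF)
  have FG_Ar: "FAr F (FAr G f) = f" if "f \<in> Ar (Tgt F)" for f
    using comp_func_simps(4)[of f G F] that by (simp add: FG st)
  have FG_Ob: "FOb F (FOb G x) = x" if "x \<in> Ob (Tgt F)" for x
    using comp_func_simps(3)[of x G F] that by (simp add: FG st)
  note [simp] = F G st
  have pres: "is_pullback (Tgt F) (FAr F p) (FAr F q) (FAr F f) (FAr F g)"
    if pb: "is_pullback (Src F) p q f g" for p q f g
  proof (rule is_pullbackI)
    note [simp] = is_pullbackD(1-8)[OF pb]
    fix h k
    assume hk: "h \<in> Ar (Tgt F)" "k \<in> Ar (Tgt F)" "Dom (Tgt F) h = Dom (Tgt F) k"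
      "Cod (Tgt F) h = Dom (Tgt F) (FAr F f)" "Cod (Tgt F) k = Dom (Tgt F) (FAr F g)"
      "Cmp (Tgt F) (FAr F f) h = Cmp (Tgt F) (FAr F g) k"
    have "Cmp (Src F) f (FAr G h) = Cmp (Src F) g (FAr G k)"
      using arg_cong[OF hk(6), of "FAr G"] hk(1-5) by (simp add: GF_Ar)
    then obtain u where u: "u \<in> Ar (Src F)" "Dom (Src F) u = FOb G (Dom (Tgt F) h)"
      "Cod (Src F) u = Dom (Src F) p" "Cmp (Src F) p u = FAr G h" "Cmp (Src F) q u = FAr G k"
      using pullback_lift[OF pb, of "FAr G h" "FAr G k"] hk(1-5) by (auto simp: GF_Ob)
    show "\<exists>u. u \<in> Ar (Tgt F) \<and> Dom (Tgt F) u = Dom (Tgt F) h \<and> Cod (Tgt F) u = Dom (Tgt F) (FAr F p) \<and>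
        Cmp (Tgt F) (FAr F p) u = h \<and> Cmp (Tgt F) (FAr F q) u = k"
      using u(1-3) hk(1-3) arg_cong[OF u(4), of "FAr F"] arg_cong[OF u(5), of "FAr F"]
      by (intro exI[of _ "FAr F u"]) (auto simp: FG_Ar FG_Ob)
  next
    note [simp] = is_pullbackD(1-8)[OF pb]
    fix u v
    assume uv: "u \<in> Ar (Tgt F)" "v \<in> Ar (Tgt F)" "Dom (Tgt F) u = Dom (Tgt F) v"
      "Cod (Tgt F) u = Dom (Tgt F) (FAr F p)" "Cod (Tgt F) v = Dom (Tgt F) (FAr F p)"
      "Cmp (Tgt F) (FAr F p) u = Cmp (Tgt F) (FAr F p) v"
      "Cmp (Tgt F) (FAr F q) u = Cmp (Tgt F) (FAr F q) v"
    have "FAr G u = FAr G v"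
      by (rule pullback_unique[OF _ pb])
        (use uv(1-5) arg_cong[OF uv(6), of "FAr G"] arg_cong[OF uv(7), of "FAr G"] in \<open>auto simp: GF_Ar GF_Ob\<close>)
    then show "u = v"
      using FG_Ar uv(1,2) by metis
  qed (use is_pullbackD(1-8)[OF pb] arg_cong[OF is_pullbackD(9)[OF pb], of "FAr F"] in auto)
  have "has_pullbacks (Tgt F)"
    unfolding has_pullbacks_def
  proof (intro ballI impI)
    fix f g
    assume fg: "f \<in> Ar (Tgt F)" "g \<in> Ar (Tgt F)" "Cod (Tgt F) f = Cod (Tgt F) g"
    obtain p q where "is_pullback (Src F) p q (FAr G f) (FAr G g)"
      by (rule has_pullbacksE[OF hp, of "FAr G f" "FAr G g"]) (use fg in auto)
    from pres[OF this] show "\<exists>p q. is_pullback (Tgt F) p q f g"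
      using fg by (auto simp: FG_Ar)
  qed
  with pres show ?thesis
    using F hp by (intro pb_functorI)
qed

lemma transport_simps:
  assumes "inj_on f (Ob C)" "inj_on g (Ar C)" "category C"
  shows "Ob (transport f g C) = f ` Ob C"
    "Ar (transport f g C) = g ` Ar C"
    "a \<in> Ar C \<Longrightarrow> Dom (transport f g C) (g a) = f (Dom C a)"
    "a \<in> Ar C \<Longrightarrow> Cod (transport f g C) (g a) = f (Cod C a)"
    "x \<in> Ob C \<Longrightarrow> Ide (transport f g C) (f x) = g (Ide C x)"
    "b \<in> Ar C \<Longrightarrow> a \<in> Ar C \<Longrightarrow> Dom C b = Cod C a \<Longrightarrow>
      Cmp (transport f g C) (g b) (g a) = g (Cmp C b a)"
  using assms by (auto simp: transport_def)

lemma transport_iso: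
  assumes f: "inj_on f (Ob C)" and g: "inj_on g (Ar C)" and C: "category C"
  shows category_transport: "category (transport f g C)"
    and functor_encode: "is_functor (encode f g C)"
    and functor_decode: "is_functor (decode f g C)"
    and decode_encode: "decode f g C \<circ>\<^sub>F encode f g C = id_func C"
    and encode_decode: "encode f g C \<circ>\<^sub>F decode f g C = id_func (transport f g C)"
proof -
  note [simp] = C transport_simps[OF f g C] inv_into_f_f[OF f] inv_into_f_f[OF g]
  have [simp]: "f x = f y \<longleftrightarrow> x = y" if "x \<in> Ob C" "y \<in> Ob C" for x y
    using f that by (auto dest: inj_onD)
  show cat [simp]: "category (transport f g C)"
    unfolding transport_def by (rule category_build_cat) (auto simp: Cmp_assoc')
  show en [simp]: "is_functor (encode f g C)"
    unfolding encode_def by (rule functor_build_func) auto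
  show de [simp]: "is_functor (decode f g C)"
    unfolding decode_def by (rule functor_build_func) auto
  show "decode f g C \<circ>\<^sub>F encode f g C = id_func C"
    by (rule functor_eqI) (auto simp: encode_def decode_def intro: functor_comp_func[OF en[unfolded encode_def] de[unfolded decode_def]])
  show "encode f g C \<circ>\<^sub>F decode f g C = id_func (transport f g C)"
    by (rule functor_eqI) (auto simp: encode_def decode_def intro: functor_comp_func[OF de[unfolded decode_def] en[unfolded encode_def]])
qed

lemma encode_simps [simp]:
  "Src (encode f g C) = C" "Tgt (encode f g C) = transport f g C"
  "x \<in> Ob C \<Longrightarrow> FOb (encode f g C) x = f x" "a \<in> Ar C \<Longrightarrow> FAr (encode f g C) a = g a"
  by (auto simp: encode_def)

lemma decode_simps:
  assumes "inj_on f (Ob C)" "inj_on g (Ar C)"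
  shows "x \<in> Ob C \<Longrightarrow> FOb (decode f g C) (f x) = x" "a \<in> Ar C \<Longrightarrow> FAr (decode f g C) (g a) = a"
  using assms by (auto simp: decode_def transport_def)

lemma decode_Src_Tgt [simp]: "Src (decode f g C) = transport f g C" "Tgt (decode f g C) = C"
  by (auto simp: decode_def)

lemma pb_functor_encode:
  assumes "inj_on f (Ob C)" "inj_on g (Ar C)" "category C" "has_pullbacks C"
  shows "pb_functor (encode f g C)"
  by (rule pb_functor_isoI[OF functor_encode functor_decode])
    (use assms in \<open>auto simp: decode_encode encode_decode\<close>)

lemma pb_functor_decode:
  assumes "inj_on f (Ob C)" "inj_on g (Ar C)" "category C" "has_pullbacks C"
  shows "pb_functor (decode f g C)"
  by (rule pb_functor_isoI[OF functor_decode functor_encode])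
    (use assms pb_functorD(3)[OF pb_functor_encode[OF assms]] in \<open>auto simp: decode_encode encode_decode\<close>)

section \<open>Small sets and the codes of functors and transformations\<close>

lemma elts_set_code [simp]: "small X \<Longrightarrow> elts (set_code X) = X"
  by (simp add: small_def set_code_def f_inv_into_f)

lemma small_subset: "small Y \<Longrightarrow> X \<subseteq> Y \<Longrightarrow> small X"
  using elts_subset by (auto simp: small_def)

lemma small_pair [simp]: "small {x, y}"
  by (simp add: small_def elts_pair)

lemma small_singleton [simp]: "small {x}"
  using small_pair[of x x] by simp

lemma small_UN:
  fixes X :: "'u::universe set" and F :: "'u \<Rightarrow> 'u set"
  assumes "small X" "\<And>x. x \<in> X \<Longrightarrow> small (F x)"
  shows "small (\<Union>x\<in>X. F x)"
proof -
  have "(\<Union>x\<in>elts (set_code X). elts (set_code (F x))) = (\<Union>x\<in>X. F x)"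
    using assms by simp
  then show ?thesis
    using elts_UN[of "\<lambda>x. set_code (F x)" "set_code X"] by (simp add: small_def)
qed

lemma small_image [simp]:
  fixes X :: "'u::universe set" and f :: "'u \<Rightarrow> 'u"
  assumes "small X"
  shows "small (f ` X)"
proof -
  have "f ` X = (\<Union>x\<in>X. {f x})"
    by auto
  then show ?thesis
    using small_UN[OF assms, of "\<lambda>x. {f x}"] by simp
qed

lemma small_Pow: "small X \<Longrightarrow> small {w. elts w \<subseteq> X}"
  using elts_Pow[of "set_code X"] by (simp add: small_def[of "{w. elts w \<subseteq> X}"])

lemma set_code_eq_iff: "small X \<Longrightarrow> small Y \<Longrightarrow> set_code X = set_code Y \<longleftrightarrow> X = Y"
  by (metis elts_set_code)

lemma pair_code_eq_iff [simp]: "pair_code p = pair_code q \<longleftrightarrow> p = q"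
  by (cases p, cases q) (auto simp: pair_code_def set_code_eq_iff doubleton_eq_iff)

lemma inj_on_pair_code [simp]: "inj_on pair_code X"
  by (auto simp: inj_on_def)

lemma small_pair_code_image:
  assumes "small X" "small Y"
  shows "small (pair_code ` (X \<times> Y))"
proof -
  have "pair_code ` (X \<times> Y) = (\<Union>x\<in>X. (\<lambda>y. pair_code (x, y)) ` Y)"
    by auto
  then show ?thesis
    using assms by (simp add: small_UN)
qed

lemma graph_code_in:
  assumes "small X" "small Y" "\<And>x. x \<in> X \<Longrightarrow> f x \<in> Y"
  shows "graph_code X f \<in> {w. elts w \<subseteq> pair_code ` (X \<times> Y)}"
  using assms by (auto simp: graph_code_def)

lemma graph_code_eqD:
  assumes "small X" "graph_code X f = graph_code X g" "x \<in> X"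
  shows "f x = g x"
proof -
  have "(\<lambda>x. pair_code (x, f x)) ` X = (\<lambda>x. pair_code (x, g x)) ` X"
    using assms by (simp add: graph_code_def set_code_eq_iff)
  then have "pair_code (x, f x) \<in> (\<lambda>x. pair_code (x, g x)) ` X"
    using assms(3) by blast
  then show ?thesis
    by auto
qed

section \<open>The category of small categories with pullbacks\<close>

lemma Ob_Cat_pb:
  "C \<in> Ob Cat_pb \<longleftrightarrow> category C \<and> small (Ob C) \<and> small (Ar C) \<and> has_pullbacks C"
  by (simp add: Cat_pb_def)

lemma Ob_Cat_pbD:
  assumes "C \<in> Ob Cat_pb"
  shows "category C" "small (Ob C)" "small (Ar C)" "has_pullbacks C"
  using assms by (auto simp: Ob_Cat_pb)

lemma Ar_Cat_pb: "F \<in> Ar Cat_pb \<longleftrightarrow> pb_functor F \<and> Src F \<in> Ob Cat_pb \<and> Tgt F \<in> Ob Cat_pb"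
  by (auto simp: Cat_pb_def pb_functor_def)

lemma Ar_Cat_pbD:
  assumes "F \<in> Ar Cat_pb"
  shows "pb_functor F" "is_functor F" "Src F \<in> Ob Cat_pb" "Tgt F \<in> Ob Cat_pb"
  using assms by (auto simp: Ar_Cat_pb pb_functor_def)

lemma Cat_pb_simps [simp]:
  "F \<in> Ar Cat_pb \<Longrightarrow> Dom Cat_pb F = Src F"
  "F \<in> Ar Cat_pb \<Longrightarrow> Cod Cat_pb F = Tgt F"
  "C \<in> Ob Cat_pb \<Longrightarrow> Ide Cat_pb C = id_func C"
  "G \<in> Ar Cat_pb \<Longrightarrow> F \<in> Ar Cat_pb \<Longrightarrow> Src G = Tgt F \<Longrightarrow> Cmp Cat_pb G F = G \<circ>\<^sub>F F"
  by (auto simp: Cat_pb_def)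

lemma id_func_arrow: "C \<in> Ob Cat_pb \<Longrightarrow> id_func C \<in> Ar Cat_pb"
  by (simp add: Ar_Cat_pb Ob_Cat_pbD)

lemma comp_func_arrow: "F \<in> Ar Cat_pb \<Longrightarrow> G \<in> Ar Cat_pb \<Longrightarrow> Src G = Tgt F \<Longrightarrow> G \<circ>\<^sub>F F \<in> Ar Cat_pb"
  by (simp add: Ar_Cat_pb)

lemma category_Cat_pb [simp]: "category Cat_pb"
proof -
  have Ob: "{C. category C \<and> small (Ob C) \<and> small (Ar C) \<and> has_pullbacks C} = Ob Cat_pb"
    by (auto simp: Ob_Cat_pb)
  have Ar: "{F. pb_functor F \<and> small (Ob (Src F)) \<and> small (Ar (Src F)) \<and>
      small (Ob (Tgt F)) \<and> small (Ar (Tgt F))} = Ar Cat_pb"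
    by (auto simp: Cat_pb_def)
  show ?thesis
  proof (subst Cat_pb_def, unfold Ob Ar, rule category_build_cat)
    fix H G F :: "'a sfunc"
    assume "H \<in> Ar Cat_pb" "G \<in> Ar Cat_pb" "F \<in> Ar Cat_pb" "Src G = Tgt F" "Src H = Tgt G"
    then show "H \<circ>\<^sub>F G \<circ>\<^sub>F F = (H \<circ>\<^sub>F G) \<circ>\<^sub>F F"
      by (intro comp_func_assoc) (auto simp: Ar_Cat_pbD)
  qed (auto simp: Ar_Cat_pbD intro: id_func_arrow comp_func_arrow)
qed

section \<open>The product with a fixed category\<close>

text \<open>
  The next lemma folds the copy of the product back into its name, so that the rules for
  \<open>encode\<close> and \<open>decode\<close> state the source and target in terms of \<open>times_cat\<close>.
\<close>

lemma transport_pair_code [simp]: "transport pair_code pair_code (prod_cat B A) = times_cat B A"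
  by (simp add: times_cat_def)

context
  fixes B A :: "'u::universe scat"
  assumes B: "B \<in> Ob Cat_pb" and A: "A \<in> Ob Cat_pb"
begin

lemma times_cat_simps:
  "Ob (times_cat B A) = pair_code ` (Ob B \<times> Ob A)"
  "Ar (times_cat B A) = pair_code ` (Ar B \<times> Ar A)"
  "f \<in> Ar B \<Longrightarrow> g \<in> Ar A \<Longrightarrow> Dom (times_cat B A) (pair_code (f, g)) = pair_code (Dom B f, Dom A g)"
  "f \<in> Ar B \<Longrightarrow> g \<in> Ar A \<Longrightarrow> Cod (times_cat B A) (pair_code (f, g)) = pair_code (Cod B f, Cod A g)"
  "f' \<in> Ar B \<Longrightarrow> g' \<in> Ar A \<Longrightarrow> f \<in> Ar B \<Longrightarrow> g \<in> Ar A \<Longrightarrow> Dom B f' = Cod B f \<Longrightarrow> Dom A g' = Cod A g \<Longrightarrow>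
    Cmp (times_cat B A) (pair_code (f', g')) (pair_code (f, g)) = pair_code (Cmp B f' f, Cmp A g' g)"
  using Ob_Cat_pbD[OF A] Ob_Cat_pbD[OF B]
  by (auto simp: times_cat_def transport_simps simp del: transport_pair_code)

lemma pair_decode_simps:
  "x \<in> Ob B \<Longrightarrow> y \<in> Ob A \<Longrightarrow> FOb (pair_decode B A) (pair_code (x, y)) = (x, y)"
  "f \<in> Ar B \<Longrightarrow> g \<in> Ar A \<Longrightarrow> FAr (pair_decode B A) (pair_code (f, g)) = (f, g)"
  by (auto simp: decode_simps)

lemma pb_functor_pair_encode: "pb_functor (pair_encode B A)"
  using Ob_Cat_pbD[OF A] Ob_Cat_pbD[OF B] by (intro pb_functor_encode) auto

lemma pb_functor_pair_decode: "pb_functor (pair_decode B A)"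
  using Ob_Cat_pbD[OF A] Ob_Cat_pbD[OF B] by (intro pb_functor_decode) auto

lemma times_cat_Ob: "times_cat B A \<in> Ob Cat_pb"
  using pb_functorD(3)[OF pb_functor_pair_encode] functor_category(2)[OF pb_functorD(1)[OF pb_functor_pair_encode]]
    Ob_Cat_pbD[OF A] Ob_Cat_pbD[OF B]
  by (simp add: Ob_Cat_pb times_cat_simps small_pair_code_image)

lemma times_cat_func_eqI:
  assumes "is_functor F" "is_functor G" "Src F = times_cat B A" "Src G = times_cat B A" "Tgt F = Tgt G"
    and "\<And>x y. x \<in> Ob B \<Longrightarrow> y \<in> Ob A \<Longrightarrow> FOb F (pair_code (x, y)) = FOb G (pair_code (x, y))"
    and "\<And>f g. f \<in> Ar B \<Longrightarrow> g \<in> Ar A \<Longrightarrow> FAr F (pair_code (f, g)) = FAr G (pair_code (f, g))"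
  shows "F = G"
  using assms by (intro functor_eqI) (auto simp: times_cat_simps)

lemma proj1_simps:
  "Src (proj1 A B) = times_cat B A" "Tgt (proj1 A B) = B"
  "x \<in> Ob B \<Longrightarrow> y \<in> Ob A \<Longrightarrow> FOb (proj1 A B) (pair_code (x, y)) = x"
  "f \<in> Ar B \<Longrightarrow> g \<in> Ar A \<Longrightarrow> FAr (proj1 A B) (pair_code (f, g)) = f"
  by (auto simp: proj1_def times_cat_simps pair_decode_simps)

lemma proj2_simps:
  "Src (proj2 A B) = times_cat B A" "Tgt (proj2 A B) = A"
  "x \<in> Ob B \<Longrightarrow> y \<in> Ob A \<Longrightarrow> FOb (proj2 A B) (pair_code (x, y)) = y"
  "f \<in> Ar B \<Longrightarrow> g \<in> Ar A \<Longrightarrow> FAr (proj2 A B) (pair_code (f, g)) = g"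
  by (auto simp: proj2_def times_cat_simps pair_decode_simps)

lemma proj_arrow: "proj1 A B \<in> Ar Cat_pb" "proj2 A B \<in> Ar Cat_pb"
proof -
  have "pb_functor (proj1 A B)" "pb_functor (proj2 A B)"
    unfolding proj1_def proj2_def using Ob_Cat_pbD[OF A] Ob_Cat_pbD[OF B]
    by (auto intro!: pb_functor_comp_func pb_functor_pair_decode)
  then show "proj1 A B \<in> Ar Cat_pb" "proj2 A B \<in> Ar Cat_pb"
    using A B times_cat_Ob by (auto simp: Ar_Cat_pb proj1_simps proj2_simps)
qed

lemma is_product_times_cat:
  "is_product Cat_pb B A (times_cat B A) (proj1 A B) (proj2 A B)"
  unfolding is_product_def
proof (intro conjI allI impI)
  show "times_cat B A \<in> Ob Cat_pb"
    by (rule times_cat_Ob)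
  show "proj1 A B \<in> hom Cat_pb (times_cat B A) B" "proj2 A B \<in> hom Cat_pb (times_cat B A) A"
    by (auto simp: hom_def proj_arrow proj1_simps proj2_simps)
  fix W H K
  assume "H \<in> hom Cat_pb W B" "K \<in> hom Cat_pb W A"
  then have ar: "H \<in> Ar Cat_pb" "K \<in> Ar Cat_pb"
    and HK [simp]: "Src H = W" "Src K = W" "Tgt H = B" "Tgt K = A"
    by (auto simp: hom_def)
  note [simp] = Ar_Cat_pbD[OF ar(1)] Ar_Cat_pbD[OF ar(2)] Ar_Cat_pbD[OF proj_arrow(1)] Ar_Cat_pbD[OF proj_arrow(2)]
    proj1_simps proj2_simps proj_arrow ar
  have W: "W \<in> Ob Cat_pb"
    using Ar_Cat_pbD(3)[OF ar(1)] by simp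
  let ?U = "pair_encode B A \<circ>\<^sub>F tuple_func H K"
  have "pb_functor ?U"
    using pb_functor_pair_encode by simp
  then have U [simp]: "?U \<in> Ar Cat_pb" and U' [simp]: "is_functor ?U"
    using W times_cat_Ob by (auto simp: Ar_Cat_pb pb_functor_def)
  have comp: "proj1 A B \<circ>\<^sub>F ?U = H" "proj2 A B \<circ>\<^sub>F ?U = K"
    by (rule functor_eqI; simp)+
  show "\<exists>!U. U \<in> hom Cat_pb W (times_cat B A) \<and> Cmp Cat_pb (proj1 A B) U = H \<and> Cmp Cat_pb (proj2 A B) U = K"
  proof (rule ex1I[of _ ?U])
    show "?U \<in> hom Cat_pb W (times_cat B A) \<and> Cmp Cat_pb (proj1 A B) ?U = H \<and> Cmp Cat_pb (proj2 A B) ?U = K"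
      using comp by (simp add: hom_def)
    fix V
    assume V: "V \<in> hom Cat_pb W (times_cat B A) \<and> Cmp Cat_pb (proj1 A B) V = H \<and> Cmp Cat_pb (proj2 A B) V = K"
    then have [simp]: "V \<in> Ar Cat_pb" "Src V = W" "Tgt V = times_cat B A"
      by (auto simp: hom_def)
    then have [simp]: "is_functor V"
      by (simp add: Ar_Cat_pbD)
    have eq: "H = proj1 A B \<circ>\<^sub>F V" "K = proj2 A B \<circ>\<^sub>F V"
      using V by auto
    show "V = ?U"
    proof (rule functor_eqI)
      fix x
      assume x: "x \<in> Ob (Src V)"
      then have "FOb V x \<in> Ob (times_cat B A)"
        by simp
      then obtain b a where ba: "FOb V x = pair_code (b, a)" "b \<in> Ob B" "a \<in> Ob A"
        by (auto simp: times_cat_simps)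
      then have "FOb H x = b" "FOb K x = a"
        using x eq by (auto simp: comp_func_simps(3))
      with ba x show "FOb V x = FOb ?U x"
        by simp
    next
      fix f
      assume f: "f \<in> Ar (Src V)"
      then have "FAr V f \<in> Ar (times_cat B A)"
        by simp
      then obtain b a where ba: "FAr V f = pair_code (b, a)" "b \<in> Ar B" "a \<in> Ar A"
        by (auto simp: times_cat_simps)
      then have "FAr H f = b" "FAr K f = a"
        using f eq by (auto simp: comp_func_simps(4))
      with ba f show "FAr V f = FAr ?U f"
        by simp
    qed auto
  qed
qed

end

text \<open>The arrow \<open>F \<times> 1\<close> between the coded products with \<open>A\<close>.\<close>

definition times_map :: "'u::universe scat \<Rightarrow> 'u sfunc \<Rightarrow> 'u sfunc"
  where "times_map A F = pair_encode (Tgt F) A \<circ>\<^sub>F prod_func F (id_func A) \<circ>\<^sub>F pair_decode (Src F) A"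

lemma times_func_simps [simp]:
  "Src (times_func A) = Cat_pb" "Tgt (times_func A) = Cat_pb"
  "B \<in> Ob Cat_pb \<Longrightarrow> FOb (times_func A) B = times_cat B A"
  "F \<in> Ar Cat_pb \<Longrightarrow> FAr (times_func A) F = times_map A F"
  by (auto simp: times_func_def times_map_def)

lemma times_map_simps:
  assumes "A \<in> Ob Cat_pb" "F \<in> Ar Cat_pb"
  shows "Src (times_map A F) = times_cat (Src F) A" "Tgt (times_map A F) = times_cat (Tgt F) A"
    "x \<in> Ob (Src F) \<Longrightarrow> y \<in> Ob A \<Longrightarrow> FOb (times_map A F) (pair_code (x, y)) = pair_code (FOb F x, y)"
    "f \<in> Ar (Src F) \<Longrightarrow> g \<in> Ar A \<Longrightarrow> FAr (times_map A F) (pair_code (f, g)) = pair_code (FAr F f, g)"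
  using assms Ar_Cat_pbD[OF assms(2)]
  by (auto simp: times_map_def times_cat_simps pair_decode_simps)

lemma times_map_arrow:
  assumes "A \<in> Ob Cat_pb" "F \<in> Ar Cat_pb"
  shows "times_map A F \<in> Ar Cat_pb"
proof -
  note [simp] = Ar_Cat_pbD[OF assms(2)] assms Ob_Cat_pbD[OF assms(1)]
  have "pb_functor (times_map A F)"
    unfolding times_map_def by (auto intro!: pb_functor_comp_func pb_functor_pair_decode pb_functor_pair_encode)
  then show ?thesis
    using assms by (simp add: Ar_Cat_pb times_map_simps times_cat_Ob)
qed

lemma functor_times_func:
  assumes A: "A \<in> Ob Cat_pb"
  shows "is_functor (times_func A)"
  unfolding times_func_def times_map_def[symmetric]
proof (rule functor_build_func)
  fix B :: "'a scat"
  assume B: "B \<in> Ob Cat_pb"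
  note [simp] = A B id_func_arrow[OF B] times_map_simps[OF A]
  show "times_map A (Ide Cat_pb B) = Ide Cat_pb (times_cat B A)"
    using times_cat_Ob[OF B A] Ar_Cat_pbD(2)[OF times_map_arrow[OF A id_func_arrow[OF B]]]
    by simp (rule times_cat_func_eqI[OF B A]; simp add: times_cat_simps Ob_Cat_pbD)
next
  fix G F :: "'a sfunc"
  assume F: "F \<in> Ar Cat_pb" and G: "G \<in> Ar Cat_pb" and "Dom Cat_pb G = Cod Cat_pb F"
  then have eq [simp]: "Src G = Tgt F"
    by simp
  note [simp] = A F G times_map_simps[OF A] times_map_arrow[OF A] comp_func_arrow[OF F G eq]
    Ar_Cat_pbD[OF F] Ar_Cat_pbD[OF G] Ar_Cat_pbD(2)[OF times_map_arrow[OF A]]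
  show "times_map A (Cmp Cat_pb G F) = Cmp Cat_pb (times_map A G) (times_map A F)"
    by simp (rule times_cat_func_eqI[of "Src F" A]; simp add: times_cat_simps)
qed (use A in \<open>auto simp: times_cat_Ob times_map_arrow Ar_Cat_pbD times_map_simps\<close>)

lemma product_functor_times_func:
  assumes A: "A \<in> Ob Cat_pb"
  shows "product_functor Cat_pb A (times_func A) (proj1 A) (proj2 A)"
  unfolding product_functor_def
proof (intro conjI allI ballI)
  fix B :: "'a scat"
  assume "B \<in> Ob Cat_pb"
  then show "is_product Cat_pb B A (FOb (times_func A) B) (proj1 A B) (proj2 A B)"
    using is_product_times_cat A by simp
next
  fix B B' :: "'a scat" and F
  assume "F \<in> hom Cat_pb B B'"
  then have F [simp]: "F \<in> Ar Cat_pb" and [simp]: "Src F = B" "Tgt F = B'"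
    by (auto simp: hom_def)
  have [simp]: "B \<in> Ob Cat_pb" "B' \<in> Ob Cat_pb"
    using Ar_Cat_pbD[OF F] by auto
  note [simp] = A times_map_simps[OF A F] times_map_arrow[OF A F] proj_arrow proj1_simps proj2_simps
    Ar_Cat_pbD(2)[OF times_map_arrow[OF A F]] Ar_Cat_pbD(2)[OF F] Ar_Cat_pbD(2)[OF proj_arrow(1)]
    Ar_Cat_pbD(2)[OF proj_arrow(2)]
  show "Cmp Cat_pb (proj1 A B') (FAr (times_func A) F) = Cmp Cat_pb F (proj1 A B)"
    by simp (rule times_cat_func_eqI[of B A]; simp add: times_cat_simps)
  show "Cmp Cat_pb (proj2 A B') (FAr (times_func A) F) = proj2 A B"
    by simp (rule times_cat_func_eqI[of B A]; simp add: times_cat_simps)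
qed (use A functor_times_func in auto)

lemma terminal_Cat_pb: "\<exists>t. is_terminal (Cat_pb :: ('u::universe scat, 'u sfunc) cat) t"
proof -
  \<comment> \<open>Any element serves as the single object and arrow of the terminal category.\<close>
  define c :: 'u where "c = undefined"
  define T where "T = build_cat {c} {c} (\<lambda>_. c) (\<lambda>_. c) (\<lambda>_. c) (\<lambda>_ _. c)"
  have T_simps [simp]: "Ob T = {c}" "Ar T = {c}" "Dom T c = c" "Cod T c = c" "Ide T c = c" "Cmp T c c = c"
    by (auto simp: T_def)
  have T_cat [simp]: "category T"
    unfolding T_def by (rule category_build_cat) auto
  have pb: "is_pullback T p q f g" if "p = c" "q = c" "f = c" "g = c" for p q f g
    using that by (intro is_pullbackI) auto
  have "has_pullbacks T"
    unfolding has_pullbacks_def using pb[OF refl refl refl refl] by auto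
  then have T: "T \<in> Ob Cat_pb"
    by (simp add: Ob_Cat_pb)
  have "\<exists>!F. F \<in> hom Cat_pb B T" if B: "B \<in> Ob Cat_pb" for B
  proof -
    let ?F = "build_func B T (\<lambda>_. c) (\<lambda>_. c)"
    have F: "is_functor ?F"
      using Ob_Cat_pbD[OF B] by (intro functor_build_func) auto
    have "pb_functor ?F"
      using F Ob_Cat_pbD[OF B] Ob_Cat_pbD[OF T] by (intro pb_functorI) (auto simp: is_pullbackD(1-4) intro!: pb)
    then have "?F \<in> hom Cat_pb B T"
      using B T by (simp add: hom_def Ar_Cat_pb)
    moreover have "G = ?F" if "G \<in> hom Cat_pb B T" for G
    proof -
      have G: "is_functor G" "Src G = B" "Tgt G = T"
        using that by (auto simp: hom_def Ar_Cat_pbD)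
      show ?thesis
        using FOb_in[OF G(1) _ G(3)] FAr_in[OF G(1) _ G(3)] G F by (intro functor_eqI) auto
    qed
    ultimately show ?thesis
      by blast
  qed
  then show ?thesis
    using T unfolding is_terminal_def by blast
qed

lemma has_finite_products_Cat_pb:
  "has_finite_products (Cat_pb :: ('u::universe scat, 'u sfunc) cat)"
  unfolding has_finite_products_def using terminal_Cat_pb is_product_times_cat by blast

section \<open>The internal hom\<close>

context
  fixes A B :: "'u::universe scat"
  assumes A: "A \<in> Ob Cat_pb" and B: "B \<in> Ob Cat_pb"
begin

lemma inj_on_func_code: "inj_on func_code (pb_functors A B)"
proof (rule inj_onI)
  fix F G
  assume F: "F \<in> pb_functors A B" and G: "G \<in> pb_functors A B" and eq: "func_code F = func_code G"
  note FG [simp] = pb_functorsD[OF F] pb_functorsD[OF G]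
  have *: "graph_code (Ob A) (FOb F) = graph_code (Ob A) (FOb G)"
    "graph_code (Ar A) (FAr F) = graph_code (Ar A) (FAr G)"
    using eq by (auto simp: func_code_def)
  show "F = G"
    using graph_code_eqD[OF Ob_Cat_pbD(2)[OF A] *(1)] graph_code_eqD[OF Ob_Cat_pbD(3)[OF A] *(2)]
    by (intro functor_eqI) auto
qed

lemma inj_on_ntrans_code: "inj_on ntrans_code (Ar (pb_hom_cat A B))"
proof (rule inj_onI)
  fix \<sigma> \<tau>
  assume \<sigma>: "\<sigma> \<in> Ar (pb_hom_cat A B)" and \<tau>: "\<tau> \<in> Ar (pb_hom_cat A B)"
    and eq: "ntrans_code \<sigma> = ntrans_code \<tau>"
  note [simp] = pb_hom_cat_arrowD[OF \<sigma>] pb_hom_cat_arrowD[OF \<tau>]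
  have *: "func_code (NSrc \<sigma>) = func_code (NSrc \<tau>)" "func_code (NTgt \<sigma>) = func_code (NTgt \<tau>)"
    "graph_code (Ob A) (Component \<sigma>) = graph_code (Ob A) (Component \<tau>)"
    using eq by (auto simp: ntrans_code_def)
  show "\<sigma> = \<tau>"
  proof (rule pb_hom_cat_eqI[OF \<sigma> \<tau>])
    show "NSrc \<sigma> = NSrc \<tau>" "NTgt \<sigma> = NTgt \<tau>"
      using * by (auto intro: inj_onD[OF inj_on_func_code])
    show "Component \<sigma> x = Component \<tau> x" if "x \<in> Ob A" for x
      using graph_code_eqD[OF Ob_Cat_pbD(2)[OF A] *(3) that] .
  qed
qed

lemma small_ihom:
  "small (func_code ` pb_functors A B)" "small (ntrans_code ` Ar (pb_hom_cat A B))"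
proof -
  note [simp] = Ob_Cat_pbD[OF A] Ob_Cat_pbD[OF B]
  \<comment> \<open>All graphs of functions from \<open>X\<close> to \<open>Y\<close> lie in the power set of the coded product.\<close>
  let ?graphs = "\<lambda>X Y :: 'u set. {w. elts w \<subseteq> pair_code ` (X \<times> Y)}"
  have small: "small (?graphs X Y)" if "small X" "small Y" for X Y
    using that by (intro small_Pow small_pair_code_image)
  let ?F = "pair_code ` (?graphs (Ob A) (Ob B) \<times> ?graphs (Ar A) (Ar B))"
  let ?T = "pair_code ` (?F \<times> pair_code ` (?F \<times> ?graphs (Ob A) (Ar B)))"
  have F: "func_code F \<in> ?F" if "F \<in> pb_functors A B" for F
  proof -
    have "graph_code (Ob A) (FOb F) \<in> ?graphs (Ob A) (Ob B)"
      "graph_code (Ar A) (FAr F) \<in> ?graphs (Ar A) (Ar B)"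
      using pb_functorsD[OF that] by (intro graph_code_in; simp)+
    then show ?thesis
      unfolding func_code_def using pb_functorsD[OF that] by blast
  qed
  have T: "ntrans_code \<tau> \<in> ?T" if "\<tau> \<in> Ar (pb_hom_cat A B)" for \<tau>
  proof -
    have "graph_code (Ob A) (Component \<tau>) \<in> ?graphs (Ob A) (Ar B)"
      using pb_hom_cat_arrowD[OF that] by (intro graph_code_in) auto
    then show ?thesis
      unfolding ntrans_code_def using pb_hom_cat_arrowD(5)[OF that]
        F[OF pb_hom_cat_arrowD(3)[OF that]] F[OF pb_hom_cat_arrowD(4)[OF that]] by (intro imageI SigmaI) auto
  qed
  have "small ?F"
    by (intro small_pair_code_image small) auto
  then show "small (func_code ` pb_functors A B)"
    by (rule small_subset) (use F in blast)
  have "small ?T"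
    by (intro small_pair_code_image small \<open>small ?F\<close>) auto
  then show "small (ntrans_code ` Ar (pb_hom_cat A B))"
    by (rule small_subset) (use T in blast)
qed

lemma ihom_cat_simps:
  "Ob (ihom_cat A B) = func_code ` pb_functors A B"
  "Ar (ihom_cat A B) = ntrans_code ` Ar (pb_hom_cat A B)"
  "\<tau> \<in> Ar (pb_hom_cat A B) \<Longrightarrow> Dom (ihom_cat A B) (ntrans_code \<tau>) = func_code (NSrc \<tau>)"
  "\<tau> \<in> Ar (pb_hom_cat A B) \<Longrightarrow> Cod (ihom_cat A B) (ntrans_code \<tau>) = func_code (NTgt \<tau>)"
  "F \<in> pb_functors A B \<Longrightarrow> Ide (ihom_cat A B) (func_code F) = ntrans_code (id_ntrans F)"
  using inj_on_func_code inj_on_ntrans_code by (auto simp: ihom_cat_def transport_simps)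

lemma transport_hom_code [simp]: "transport func_code ntrans_code (pb_hom_cat A B) = ihom_cat A B"
  by (simp add: ihom_cat_def)

lemma hom_decode_simps:
  "F \<in> pb_functors A B \<Longrightarrow> FOb (hom_decode A B) (func_code F) = F"
  "\<tau> \<in> Ar (pb_hom_cat A B) \<Longrightarrow> FAr (hom_decode A B) (ntrans_code \<tau>) = \<tau>"
  using inj_on_func_code inj_on_ntrans_code by (auto simp: decode_simps)

lemma pb_functor_hom_code: "pb_functor (hom_encode A B)" "pb_functor (hom_decode A B)"
  using inj_on_func_code inj_on_ntrans_code by (auto intro!: pb_functor_encode pb_functor_decode)

lemma ihom_cat_Ob: "ihom_cat A B \<in> Ob Cat_pb"
  using pb_functorD(3)[OF pb_functor_hom_code(1)] functor_category(2)[OF pb_functorD(1)[OF pb_functor_hom_code(1)]]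
    small_ihom by (simp add: Ob_Cat_pb ihom_cat_simps)

lemma ihom_cat_func_eqI:
  assumes "is_functor F" "is_functor G" "Src F = ihom_cat A B" "Src G = ihom_cat A B" "Tgt F = Tgt G"
    and "\<And>H. H \<in> pb_functors A B \<Longrightarrow> FOb F (func_code H) = FOb G (func_code H)"
    and "\<And>\<tau>. \<tau> \<in> Ar (pb_hom_cat A B) \<Longrightarrow> FAr F (ntrans_code \<tau>) = FAr G (ntrans_code \<tau>)"
  shows "F = G"
  using assms by (intro functor_eqI) (auto simp: ihom_cat_simps)

lemma ev_simps:
  "Src (ev A B) = times_cat (ihom_cat A B) A" "Tgt (ev A B) = B"
  "F \<in> pb_functors A B \<Longrightarrow> x \<in> Ob A \<Longrightarrow> FOb (ev A B) (pair_code (func_code F, x)) = FOb F x"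
  "\<tau> \<in> Ar (pb_hom_cat A B) \<Longrightarrow> f \<in> Ar A \<Longrightarrow>
    FAr (ev A B) (pair_code (ntrans_code \<tau>, f)) = Cmp B (FAr (NTgt \<tau>) f) (Component \<tau> (Dom A f))"
  by (auto simp: ev_def times_cat_simps[OF ihom_cat_Ob A] pair_decode_simps[OF ihom_cat_Ob A]
      ihom_cat_simps hom_decode_simps)

lemma ev_arrow: "ev A B \<in> Ar Cat_pb"
proof -
  note [simp] = Ob_Cat_pbD[OF A] Ob_Cat_pbD[OF B]
  have "pb_functor (ev A B)"
    unfolding ev_def
    by (auto intro!: pb_functor_comp_func pb_functor_eval_func pb_functor_prod_func
        pb_functor_hom_code pb_functor_pair_decode ihom_cat_Ob A)
  then show ?thesis
    using times_cat_Ob[OF ihom_cat_Ob A] B by (simp add: Ar_Cat_pb ev_simps)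
qed

end

text \<open>The arrow \<open>[A,F]\<^sub>p\<^sub>b\<close> between the coded internal homs.\<close>

definition ihom_map :: "'u::universe scat \<Rightarrow> 'u sfunc \<Rightarrow> 'u sfunc"
  where "ihom_map A F = hom_encode A (Tgt F) \<circ>\<^sub>F postcomp A F \<circ>\<^sub>F hom_decode A (Src F)"

lemma ihom_func_simps [simp]:
  "Src (ihom_func A) = Cat_pb" "Tgt (ihom_func A) = Cat_pb"
  "B \<in> Ob Cat_pb \<Longrightarrow> FOb (ihom_func A) B = ihom_cat A B"
  "F \<in> Ar Cat_pb \<Longrightarrow> FAr (ihom_func A) F = ihom_map A F"
  by (auto simp: ihom_func_def ihom_map_def)

lemma ihom_map_simps:
  assumes A: "A \<in> Ob Cat_pb" and F: "F \<in> Ar Cat_pb"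
  shows "Src (ihom_map A F) = ihom_cat A (Src F)" "Tgt (ihom_map A F) = ihom_cat A (Tgt F)"
    "G \<in> pb_functors A (Src F) \<Longrightarrow> FOb (ihom_map A F) (func_code G) = func_code (F \<circ>\<^sub>F G)"
    "\<tau> \<in> Ar (pb_hom_cat A (Src F)) \<Longrightarrow> FAr (ihom_map A F) (ntrans_code \<tau>) = ntrans_code (whisker F \<tau>)"
  using A Ar_Cat_pbD[OF F]
  by (auto simp: ihom_map_def ihom_cat_simps hom_decode_simps comp_func_pb_functors whisker_arrow)

lemma ihom_map_arrow:
  assumes A: "A \<in> Ob Cat_pb" and F: "F \<in> Ar Cat_pb"
  shows "ihom_map A F \<in> Ar Cat_pb"
proof -
  note [simp] = Ar_Cat_pbD[OF F] A Ob_Cat_pbD[OF A]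
  have "pb_functor (ihom_map A F)"
    unfolding ihom_map_def
    by (auto intro!: pb_functor_comp_func pb_functor_postcomp pb_functor_hom_code)
  then show ?thesis
    by (simp add: Ar_Cat_pb ihom_map_simps[OF A F] ihom_cat_Ob)
qed

lemma whisker_id_func:
  assumes "\<tau> \<in> Ar (pb_hom_cat A B)" "has_pullbacks B"
  shows "whisker (id_func B) \<tau> = \<tau>"
proof -
  note [simp] = assms pb_hom_cat_arrowD[OF assms(1)]
  show ?thesis
    by (rule pb_hom_cat_eqI[of _ A B]) (use whisker_arrow[of "id_func B" \<tau> A] in auto)
qed

lemma whisker_comp_func:
  assumes F: "pb_functor F" and G: "pb_functor G" and eq: "Src G = Tgt F"
    and \<tau>: "\<tau> \<in> Ar (pb_hom_cat A (Src F))"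
  shows "whisker (G \<circ>\<^sub>F F) \<tau> = whisker G (whisker F \<tau>)"
proof (rule pb_hom_cat_eqI)
  note [simp] = pb_functorD(1)[OF F] pb_functorD(1)[OF G] eq \<tau> pb_hom_cat_arrowD[OF \<tau>]
  show "whisker (G \<circ>\<^sub>F F) \<tau> \<in> Ar (pb_hom_cat A (Tgt G))"
    using whisker_arrow[of "G \<circ>\<^sub>F F" \<tau> A] F G by simp
  show "whisker G (whisker F \<tau>) \<in> Ar (pb_hom_cat A (Tgt G))"
    using whisker_arrow[OF F \<tau>] by (intro whisker_arrow G) simp
  show "NSrc (whisker (G \<circ>\<^sub>F F) \<tau>) = NSrc (whisker G (whisker F \<tau>))"
    "NTgt (whisker (G \<circ>\<^sub>F F) \<tau>) = NTgt (whisker G (whisker F \<tau>))"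
    by (simp_all add: comp_func_assoc)
qed (use pb_hom_cat_arrowD[OF \<tau>] in simp)

lemma functor_ihom_func:
  assumes A: "A \<in> Ob Cat_pb"
  shows "is_functor (ihom_func A)"
  unfolding ihom_func_def ihom_map_def[symmetric]
proof (rule functor_build_func)
  fix B :: "'a scat"
  assume B: "B \<in> Ob Cat_pb"
  note [simp] = A B id_func_arrow[OF B] ihom_map_simps[OF A] Ob_Cat_pbD[OF ihom_cat_Ob[OF A B]]
    Ar_Cat_pbD(2)[OF ihom_map_arrow[OF A id_func_arrow[OF B]]]
  show "ihom_map A (Ide Cat_pb B) = Ide Cat_pb (ihom_cat A B)"
    using ihom_cat_Ob[OF A B]
    by simp (rule ihom_cat_func_eqI[OF A B];
      simp add: ihom_cat_simps pb_functorsD[of _ A B] whisker_id_func[of _ A B] Ob_Cat_pbD[OF B])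
next
  fix G F :: "'a sfunc"
  assume F: "F \<in> Ar Cat_pb" and G: "G \<in> Ar Cat_pb" and "Dom Cat_pb G = Cod Cat_pb F"
  then have eq [simp]: "Src G = Tgt F"
    by simp
  note [simp] = A F G ihom_map_simps[OF A] ihom_map_arrow[OF A] comp_func_arrow[OF F G eq]
    Ar_Cat_pbD[OF F] Ar_Cat_pbD[OF G] Ar_Cat_pbD(2)[OF ihom_map_arrow[OF A]]
    comp_func_pb_functors[OF Ar_Cat_pbD(1)[OF F]] whisker_arrow[OF Ar_Cat_pbD(1)[OF F]]
  show "ihom_map A (Cmp Cat_pb G F) = Cmp Cat_pb (ihom_map A G) (ihom_map A F)"
    by simp (rule ihom_cat_func_eqI[of A "Src F"];
      simp add: ihom_cat_simps comp_func_assoc pb_functorsD[of _ A "Src F"] whisker_comp_func)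
qed (use A in \<open>auto simp: ihom_cat_Ob ihom_map_arrow Ar_Cat_pbD ihom_map_simps\<close>)

section \<open>Unit, counit and the adjunction\<close>

context
  fixes A B :: "'u::universe scat"
  assumes A: "A \<in> Ob Cat_pb" and B: "B \<in> Ob Cat_pb"
begin

lemma coev_simps:
  "Src (coev A B) = B" "Tgt (coev A B) = ihom_cat A (times_cat B A)"
  "b \<in> Ob B \<Longrightarrow> FOb (coev A B) b = func_code (pair_encode B A \<circ>\<^sub>F pair_func A B b)"
  "f \<in> Ar B \<Longrightarrow> FAr (coev A B) f = ntrans_code (whisker (pair_encode B A) (pair_ntrans A B f))"
proof -
  note [simp] = Ob_Cat_pbD[OF A] Ob_Cat_pbD[OF B] A B times_cat_Ob[OF B A]
  have *: "pair_func A B b \<in> pb_functors A (prod_cat B A)" if "b \<in> Ob B" for b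
    using that by (intro pair_func_pb_functors) auto
  have **: "pair_ntrans A B f \<in> Ar (pb_hom_cat A (prod_cat B A))" if "f \<in> Ar B" for f
    using that by (intro pair_ntrans_arrow) auto
  show "Src (coev A B) = B" "Tgt (coev A B) = ihom_cat A (times_cat B A)"
    by (auto simp: coev_def)
  show "b \<in> Ob B \<Longrightarrow> FOb (coev A B) b = func_code (pair_encode B A \<circ>\<^sub>F pair_func A B b)"
    using comp_func_pb_functors[OF pb_functor_pair_encode[OF B A], of "pair_func A B b" A] *[of b]
    by (simp add: coev_def)
  show "f \<in> Ar B \<Longrightarrow> FAr (coev A B) f = ntrans_code (whisker (pair_encode B A) (pair_ntrans A B f))"
    using whisker_arrow[OF pb_functor_pair_encode[OF B A], of "pair_ntrans A B f" A] **[of f]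
    by (simp add: coev_def)
qed

lemma coev_values:
  "b \<in> Ob B \<Longrightarrow> pair_encode B A \<circ>\<^sub>F pair_func A B b \<in> pb_functors A (times_cat B A)"
  "f \<in> Ar B \<Longrightarrow> whisker (pair_encode B A) (pair_ntrans A B f) \<in> Ar (pb_hom_cat A (times_cat B A))"
proof -
  note [simp] = Ob_Cat_pbD[OF A] Ob_Cat_pbD[OF B]
  show "b \<in> Ob B \<Longrightarrow> pair_encode B A \<circ>\<^sub>F pair_func A B b \<in> pb_functors A (times_cat B A)"
    using comp_func_pb_functors[OF pb_functor_pair_encode[OF B A], of "pair_func A B b" A]
      pair_func_pb_functors[of A B b] by simp
  show "f \<in> Ar B \<Longrightarrow> whisker (pair_encode B A) (pair_ntrans A B f) \<in> Ar (pb_hom_cat A (times_cat B A))"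
    using whisker_arrow[OF pb_functor_pair_encode[OF B A], of "pair_ntrans A B f" A]
      pair_ntrans_arrow[of A B f] by simp
qed

lemma coev_arrow: "coev A B \<in> Ar Cat_pb"
proof -
  note [simp] = Ob_Cat_pbD[OF A] Ob_Cat_pbD[OF B] A B times_cat_Ob[OF B A]
  have "pb_functor (coev A B)"
    unfolding coev_def
    by (auto intro!: pb_functor_comp_func pb_functor_postcomp pb_functor_hom_code
        pb_functor_pair_encode pb_functor_coeval_func)
  then show ?thesis
    by (simp add: Ar_Cat_pb coev_simps ihom_cat_Ob)
qed

end

lemma ev_natural:
  assumes A: "A \<in> Ob Cat_pb" and F: "F \<in> Ar Cat_pb"
  shows "ev A (Tgt F) \<circ>\<^sub>F times_map A (ihom_map A F) = F \<circ>\<^sub>F ev A (Src F)"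
proof -
  have S [simp]: "Src F \<in> Ob Cat_pb" and T [simp]: "Tgt F \<in> Ob Cat_pb"
    using Ar_Cat_pbD[OF F] by auto
  note [simp] = A F Ar_Cat_pbD(1,2)[OF F] ihom_map_simps[OF A F] ihom_map_arrow[OF A F] ihom_cat_Ob
    times_map_simps[OF A ihom_map_arrow[OF A F]] ev_simps ev_arrow
    Ar_Cat_pbD(2)[OF ev_arrow] Ar_Cat_pbD(2)[OF times_map_arrow[OF A ihom_map_arrow[OF A F]]]
    comp_func_pb_functors[OF Ar_Cat_pbD(1)[OF F]] whisker_arrow[OF Ar_Cat_pbD(1)[OF F]] Ob_Cat_pbD[OF A]
  show ?thesis
    by (rule times_cat_func_eqI[of "ihom_cat A (Src F)" A])
      (auto simp: times_cat_simps ihom_cat_simps pb_functorsD pb_hom_cat_arrowD)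
qed

lemma coev_natural:
  assumes A: "A \<in> Ob Cat_pb" and F: "F \<in> Ar Cat_pb"
  shows "coev A (Tgt F) \<circ>\<^sub>F F = ihom_map A (times_map A F) \<circ>\<^sub>F coev A (Src F)"
proof (rule functor_eqI)
  have S [simp]: "Src F \<in> Ob Cat_pb" and T [simp]: "Tgt F \<in> Ob Cat_pb"
    using Ar_Cat_pbD[OF F] by auto
  note TF = times_map_arrow[OF A F]
  note [simp] = A F TF Ar_Cat_pbD(1,2)[OF F] times_map_simps[OF A F] ihom_map_simps[OF A TF] times_cat_Ob
    coev_simps coev_arrow Ar_Cat_pbD(2)[OF coev_arrow] Ar_Cat_pbD(2)[OF ihom_map_arrow[OF A TF]]
    Ar_Cat_pbD(1,2)[OF TF] coev_values Ob_Cat_pbD[OF A] Ob_Cat_pbD[OF S] Ob_Cat_pbD[OF T]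
  have pe [simp]: "is_functor (pair_encode B A)" if "B \<in> Ob Cat_pb" for B
    using pb_functorD(1)[OF pb_functor_pair_encode[OF that A]] .
  have pf [simp]: "is_functor (pair_func A B b)" if "B \<in> Ob Cat_pb" "b \<in> Ob B" for B b
    using pb_functorD(1)[of "pair_func A B b"] that by (simp add: Ob_Cat_pbD)
  show "is_functor (coev A (Tgt F) \<circ>\<^sub>F F)" "is_functor (ihom_map A (times_map A F) \<circ>\<^sub>F coev A (Src F))"
    "Src (coev A (Tgt F) \<circ>\<^sub>F F) = Src (ihom_map A (times_map A F) \<circ>\<^sub>F coev A (Src F))"
    "Tgt (coev A (Tgt F) \<circ>\<^sub>F F) = Tgt (ihom_map A (times_map A F) \<circ>\<^sub>F coev A (Src F))"
    by auto
  have Ob_eq: "pair_encode (Tgt F) A \<circ>\<^sub>F pair_func A (Tgt F) (FOb F b) =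
      times_map A F \<circ>\<^sub>F pair_encode (Src F) A \<circ>\<^sub>F pair_func A (Src F) b" if "b \<in> Ob (Src F)" for b
    using that by (intro functor_eqI) auto
  then show "FOb (coev A (Tgt F) \<circ>\<^sub>F F) b = FOb (ihom_map A (times_map A F) \<circ>\<^sub>F coev A (Src F)) b"
    if "b \<in> Ob (Src (coev A (Tgt F) \<circ>\<^sub>F F))" for b
    using that by simp
  have "whisker (pair_encode (Tgt F) A) (pair_ntrans A (Tgt F) (FAr F f)) =
      whisker (times_map A F) (whisker (pair_encode (Src F) A) (pair_ntrans A (Src F) f))"
    if f: "f \<in> Ar (Src F)" for f
    using f whisker_arrow[OF Ar_Cat_pbD(1)[OF TF], of _ A]
    by (intro pb_hom_cat_eqI[of _ A "times_cat (Tgt F) A"]) (auto simp: Ob_eq)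
  then show "FAr (coev A (Tgt F) \<circ>\<^sub>F F) f = FAr (ihom_map A (times_map A F) \<circ>\<^sub>F coev A (Src F)) f"
    if "f \<in> Ar (Src (coev A (Tgt F) \<circ>\<^sub>F F))" for f
    using that by simp
qed

lemma triangle_times:
  assumes A: "A \<in> Ob Cat_pb" and B: "B \<in> Ob Cat_pb"
  shows "ev A (times_cat B A) \<circ>\<^sub>F times_map A (coev A B) = id_func (times_cat B A)"
proof -
  note AB = times_cat_Ob[OF B A]
  note [simp] = A B AB coev_simps[OF A B] coev_values[OF A B] coev_arrow[OF A B] ev_simps[OF A AB]
    times_map_simps[OF A coev_arrow[OF A B]] Ar_Cat_pbD(2)[OF ev_arrow[OF A AB]]
    Ar_Cat_pbD(2)[OF times_map_arrow[OF A coev_arrow[OF A B]]] Ob_Cat_pbD[OF A] Ob_Cat_pbD[OF B] Ob_Cat_pbD[OF AB]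
  show ?thesis
    by (rule times_cat_func_eqI[OF B A]) (auto simp: times_cat_simps[OF B A])
qed

lemma triangle_ihom:
  assumes A: "A \<in> Ob Cat_pb" and B: "B \<in> Ob Cat_pb"
  shows "ihom_map A (ev A B) \<circ>\<^sub>F coev A (ihom_cat A B) = id_func (ihom_cat A B)"
proof -
  note H = ihom_cat_Ob[OF A B]
  note HA = times_cat_Ob[OF H A]
  note ev = ev_arrow[OF A B]
  note [simp] = A B H HA ev coev_simps[OF A H] coev_values[OF A H] coev_arrow[OF A H] ev_simps[OF A B]
    ihom_map_simps[OF A ev] Ar_Cat_pbD(1,2)[OF ev] Ar_Cat_pbD(2)[OF ihom_map_arrow[OF A ev]]
    Ar_Cat_pbD(2)[OF coev_arrow[OF A H]] Ob_Cat_pbD[OF A] Ob_Cat_pbD[OF B] Ob_Cat_pbD[OF H]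
    ihom_cat_simps[OF A B]
  have pf [simp]: "is_functor (pair_encode (ihom_cat A B) A)"
    "b \<in> Ob (ihom_cat A B) \<Longrightarrow> is_functor (pair_func A (ihom_cat A B) b)" for b
    using pb_functorD(1)[OF pb_functor_pair_encode[OF H A]] pb_functorD(1)[OF pb_functor_pair_func[of A "ihom_cat A B" b]]
    by simp_all
  have Ob_eq: "ev A B \<circ>\<^sub>F pair_encode (ihom_cat A B) A \<circ>\<^sub>F pair_func A (ihom_cat A B) (func_code G) = G"
    if G: "G \<in> pb_functors A B" for G
    using G pb_functorsD[OF G] id_ntrans_arrow[OF G] by (intro functor_eqI) auto
  have Ar_eq: "whisker (ev A B) (whisker (pair_encode (ihom_cat A B) A) (pair_ntrans A (ihom_cat A B) (ntrans_code \<tau>))) = \<tau>"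
    if \<tau>: "\<tau> \<in> Ar (pb_hom_cat A B)" for \<tau>
  proof (rule pb_hom_cat_eqI[OF _ \<tau>])
    note [simp] = \<tau> pb_hom_cat_arrowD[OF \<tau>]
    show "whisker (ev A B) (whisker (pair_encode (ihom_cat A B) A) (pair_ntrans A (ihom_cat A B) (ntrans_code \<tau>)))
        \<in> Ar (pb_hom_cat A B)"
      using whisker_arrow[OF Ar_Cat_pbD(1)[OF ev], of _ A] by simp
  qed (use \<tau> pb_hom_cat_arrowD[OF \<tau>] in \<open>auto simp: Ob_eq\<close>)
  show ?thesis
    by (rule ihom_cat_func_eqI[OF A B]) (auto simp: Ob_eq Ar_eq)
qed

lemma adjunction_times_ihom:
  fixes A :: "'u::universe scat"
  assumes A: "A \<in> Ob Cat_pb"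
  shows "adjunction (times_func A) (ihom_func A) (coev_ntrans A) (ev_ntrans A)"
proof -
  note [simp] = A functor_times_func[OF A] functor_ihom_func[OF A] times_cat_Ob ihom_cat_Ob
    coev_arrow coev_simps ev_arrow ev_simps Ar_Cat_pbD(3,4) ihom_map_arrow times_map_arrow
    ihom_map_simps[OF A] times_map_simps[OF A]
  have "is_ntrans (coev_ntrans A)"
    unfolding coev_ntrans_def by (rule ntrans_build_ntrans) (auto simp: coev_natural)
  moreover have "is_ntrans (ev_ntrans A)"
    unfolding ev_ntrans_def by (rule ntrans_build_ntrans) (auto simp: ev_natural)
  ultimately show ?thesis
    unfolding adjunction_def
    by (auto simp: coev_ntrans_def ev_ntrans_def triangle_times triangle_ihom)
qed

theorem theorem3:
  shows "(\<forall>A \<in> Ob (Cat_pb :: ('u::universe scat, 'u sfunc) cat).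
            adjunction (times_func A) (ihom_func A) (coev_ntrans A) (ev_ntrans A)) \<and>
         cartesian_closed_structure (Cat_pb :: ('u scat, 'u sfunc) cat)
            times_func proj1 proj2 ihom_func coev_ntrans ev_ntrans"
  unfolding cartesian_closed_structure_def
  using adjunction_times_ihom product_functor_times_func has_finite_products_Cat_pb category_Cat_pb
  by blast

end
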